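(* Let $K$ be a field and let $S$ be an affine monoid whose complete integral closure $\widehat{S}$ is factorial and whose quotient group has rank at least $2$. Then every class of $\mathcal{C}_v(K[S])$ contains infinitely many prime divisors of the monoid algebra $K[S]$.
   Context: Monoids are commutative, cancellative, with identity, written additively. An affine monoid is a finitely generated monoid with torsion-free quotient group. For a monoid $S$ with quotient group $G$, the complete integral closure is $\widehat{S}=\{x\in G\mid \exists c\in S\ \forall n\in\mathbb{N}:\ c+nx\in S\}$. A monoid is factorial if every non-unit is a (finite) sum of prime elements. For a domain $D$ with quotient field $F$ and $A\subseteq F$, put $A^{-1}=\{x\in F\mid xA\subseteq D\}$ and $A_v=(A^{-1})^{-1}$. A fractional $v$-ideal is a subset $I\subseteq F$ with $I=I_v$ and $cI\subseteq D$ for some nonzero $c\in D$; it is a $v$-ideal if moreover $I\subseteq D$. A fractional $v$-ideal $I$ is $v$-invertible if $(IJ)_v=D$ for some fractional $v$-ideal $J$. The $v$-invertible fractional $v$-ideals form a group under $I\cdot_v J=(IJ)_v$, and the class group ($v$-class group, whose elements are called divisor classes) $\mathcal{C}_v(D)$ is the factor group of this group by the subgroup of nonzero principal fractional ideals. A prime divisor of $D$ is a height-one prime ideal of $D$ that is a $v$-invertible $v$-ideal; it lies in (is contained in) its class in $\mathcal{C}_v(D)$. *)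

theory Defs
  imports
    "HOL-Library.Poly_Mapping"
    "HOL-Library.Extended_Nat"
    "HOL-Computational_Algebra.Computational_Algebra"
    "HOL-Algebra.Algebra"
    "HOL-Algebra.Algebraic_Closure_Type"
begin

section \<open>Multiples in abelian groups\<close>

definition (in monoid_add) nscale :: "nat \<Rightarrow> 'a \<Rightarrow> 'a" where
  "nscale n x = (((+) x) ^^ n) 0"

definition zscale :: "int \<Rightarrow> 'a::ab_group_add \<Rightarrow> 'a" where
  "zscale k x = (if 0 \<le> k then nscale (nat k) x else - nscale (nat (- k)) x)"

context monoid_add
begin

lemma nscale_0 [simp]: "nscale 0 x = 0"
  and nscale_Suc: "nscale (Suc n) x = x + nscale n x"
  by (simp_all add: nscale_def)

lemma nscale_add: "nscale (m + n) x = nscale m x + nscale n x"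
  by (induction m) (simp_all add: nscale_Suc add.assoc)

lemma nscale_mult: "nscale (m * n) x = nscale m (nscale n x)"
  by (induction m) (simp_all add: nscale_Suc nscale_add)

end

lemma nscale_zero [simp]: "nscale n (0::'a::monoid_add) = 0"
  by (induction n) (simp_all add: nscale_Suc)

lemma nscale_plus: "nscale n (x + y) = nscale n x + nscale n (y::'a::comm_monoid_add)"
  by (induction n) (simp_all add: nscale_Suc ac_simps)

lemma nscale_minus: "nscale n (- x) = - nscale n (x::'a::ab_group_add)"
  by (induction n) (simp_all add: nscale_Suc)

lemma zscale_of_nat: "zscale (int n) x = nscale n x"
  by (simp add: zscale_def)

lemma zscale_minus_of_nat: "zscale (- int n) x = - nscale n x"
  by (auto simp: zscale_def)

lemma zscale_diff_of_nat: "zscale (int m - int n) x = nscale m x - nscale n x"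
proof (cases "n \<le> m")
  case True
  then have "nscale m x = nscale (m - n) x + nscale n x"
    by (simp flip: nscale_add)
  with True show ?thesis
    by (simp add: zscale_of_nat flip: of_nat_diff)
next
  case False
  then have "nscale n x = nscale (n - m) x + nscale m x"
    by (simp flip: nscale_add)
  moreover from False have "int m - int n = - int (n - m)" by simp
  ultimately show ?thesis
    by (simp only: zscale_minus_of_nat) simp
qed

lemma module_zscale: "Modules.module (zscale :: int \<Rightarrow> 'a::ab_group_add \<Rightarrow> 'a)"
proof
  fix a b :: int and x y :: 'a
  obtain m n where a: "a = int m - int n" by (cases a rule: int_diff_cases)
  obtain p q where b: "b = int p - int q" by (cases b rule: int_diff_cases)
  show "zscale a (x + y) = zscale a x + zscale a y"
    by (simp add: a zscale_diff_of_nat nscale_plus)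
  have "a + b = int (m + p) - int (n + q)" by (simp add: a b)
  then show "zscale (a + b) x = zscale a x + zscale b x"
    by (simp only: a b zscale_diff_of_nat nscale_add) (simp add: algebra_simps)
  have "a * b = int (m * p + n * q) - int (m * q + n * p)"
    by (simp add: a b algebra_simps)
  moreover have "nscale k (u - v) = nscale k u - nscale k v" for k and u v :: 'a
    using nscale_plus[of k u "- v"] by (simp add: nscale_minus)
  ultimately show "zscale a (zscale b x) = zscale (a * b) x"
    by (simp only: a b zscale_diff_of_nat nscale_add nscale_mult) (simp add: algebra_simps)
  show "zscale 1 x = x"
    by (simp add: zscale_def nscale_Suc)
qed

class torsion_free_ab_group_add = ab_group_add +
  assumes nscale_eq_0_D: "0 < n \<Longrightarrow> nscale n x = 0 \<Longrightarrow> x = 0"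

instance int :: torsion_free_ab_group_add
proof
  fix n :: nat and x :: int
  have "nscale n x = int n * x"
    by (induction n) (simp_all add: nscale_Suc algebra_simps)
  then show "0 < n \<Longrightarrow> nscale n x = 0 \<Longrightarrow> x = 0" by simp
qed


section \<open>Submonoids of abelian groups\<close>

text \<open>
  A cancellative monoid is a submonoid \<open>S\<close> of an abelian group, and its quotient group
  is the subgroup of differences of elements of \<open>S\<close>. The ambient group may be larger than
  this subgroup. The group algebras below need it to be torsion-free; an affine monoid can
  always be placed in its own, torsion-free, quotient group.
\<close>

definition add_submonoid :: "'a::monoid_add set \<Rightarrow> bool" where
  "add_submonoid S \<longleftrightarrow> 0 \<in> S \<and> (\<forall>x\<in>S. \<forall>y\<in>S. x + y \<in> S)"

definition quotient_group :: "'a::ab_group_add set \<Rightarrow> 'a set" where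
  "quotient_group S = {x - y |x y. x \<in> S \<and> y \<in> S}"

definition torsion_free :: "'a::ab_group_add set \<Rightarrow> bool" where
  "torsion_free G \<longleftrightarrow> (\<forall>x\<in>G. \<forall>n>0. nscale n x = 0 \<longrightarrow> x = 0)"

definition affine_monoid :: "'a::ab_group_add set \<Rightarrow> bool" where
  "affine_monoid S \<longleftrightarrow>
     add_submonoid S \<and> (\<exists>A. finite A \<and> S = add_submonoid hull A) \<and>
     torsion_free (quotient_group S)"

definition abelian_rank :: "'a::ab_group_add set \<Rightarrow> enat" where
  "abelian_rank G =
     (SUP B\<in>{B. finite B \<and> B \<subseteq> G \<and> \<not> Modules.module.dependent zscale B}. enat (card B))"

definition complete_integral_closure :: "'a::ab_group_add set \<Rightarrow> 'a set" where
  "complete_integral_closure S =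
     {x \<in> quotient_group S. \<exists>c\<in>S. \<forall>n. c + nscale n x \<in> S}"

text \<open>An additive submonoid, written multiplicatively for use with \<^theory>\<open>HOL-Algebra.Divisibility\<close>.\<close>

definition monoid_of :: "'a::monoid_add set \<Rightarrow> 'a monoid" where
  "monoid_of S = \<lparr>carrier = S, monoid.mult = (+), one = 0\<rparr>"

definition factorial_submonoid :: "'a::ab_group_add set \<Rightarrow> bool" where
  "factorial_submonoid S \<longleftrightarrow>
     (\<forall>x\<in>S - Units (monoid_of S).
        \<exists>ps. set ps \<subseteq> {p \<in> S. Divisibility.prime (monoid_of S) p} \<and> x = sum_list ps)"


section \<open>Divisorial ideals\<close>

text \<open>
  A domain is a subring \<open>D\<close> of some field, its quotient field being taken inside
  that field.
\<close>

definition domain_ring :: "'f::field set \<Rightarrow> 'f ring" where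
  "domain_ring D = ring_of_type_algebra\<lparr>carrier := D\<rparr>"

definition quotient_field :: "'f::field set \<Rightarrow> 'f set" where
  "quotient_field D = {a / b |a b. a \<in> D \<and> b \<in> D \<and> b \<noteq> 0}"

definition ideal_inverse :: "'f::field set \<Rightarrow> 'f set \<Rightarrow> 'f set" where
  "ideal_inverse D A = {x \<in> quotient_field D. \<forall>a\<in>A. x * a \<in> D}"

definition v_closure :: "'f::field set \<Rightarrow> 'f set \<Rightarrow> 'f set" where
  "v_closure D A = ideal_inverse D (ideal_inverse D A)"

definition fractional_v_ideal :: "'f::field set \<Rightarrow> 'f set \<Rightarrow> bool" where
  "fractional_v_ideal D I \<longleftrightarrow>
     I \<subseteq> quotient_field D \<and> I = v_closure D I \<and> (\<exists>c\<in>D. c \<noteq> 0 \<and> (\<lambda>x. c * x) ` I \<subseteq> D)"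

definition v_ideal :: "'f::field set \<Rightarrow> 'f set \<Rightarrow> bool" where
  "v_ideal D I \<longleftrightarrow> fractional_v_ideal D I \<and> I \<subseteq> D"

definition ideal_product :: "'f::field set \<Rightarrow> 'f set \<Rightarrow> 'f set" where
  "ideal_product I J =
     {\<Sum>i<n. a i * b i |(n::nat) a b. \<forall>i<n. a i \<in> I \<and> b i \<in> J}"

definition v_product :: "'f::field set \<Rightarrow> 'f set \<Rightarrow> 'f set \<Rightarrow> 'f set" where
  "v_product D I J = v_closure D (ideal_product I J)"

definition v_invertible :: "'f::field set \<Rightarrow> 'f set \<Rightarrow> bool" where
  "v_invertible D I \<longleftrightarrow>
     fractional_v_ideal D I \<and> (\<exists>J. fractional_v_ideal D J \<and> v_product D I J = D)"

definition v_ideal_group :: "'f::field set \<Rightarrow> 'f set monoid" where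
  "v_ideal_group D =
     \<lparr>carrier = {I. v_invertible D I}, monoid.mult = v_product D, one = D\<rparr>"

definition principal_fractional_ideals :: "'f::field set \<Rightarrow> 'f set set" where
  "principal_fractional_ideals D = {(\<lambda>d. x * d) ` D |x. x \<in> quotient_field D \<and> x \<noteq> 0}"

definition v_class_group :: "'f::field set \<Rightarrow> 'f set set monoid" where
  "v_class_group D = v_ideal_group D Mod principal_fractional_ideals D"

definition height :: "'f::field set \<Rightarrow> 'f set \<Rightarrow> enat" where
  "height D P =
     Sup {enat n |n. \<exists>Q. (\<forall>i\<le>n. primeideal (Q i) (domain_ring D)) \<and>
                         (\<forall>i<n. Q i \<subset> Q (Suc i)) \<and> Q n = P}"

definition prime_divisor :: "'f::field set \<Rightarrow> 'f set \<Rightarrow> bool" where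
  "prime_divisor D P \<longleftrightarrow>
     primeideal P (domain_ring D) \<and> height D P = 1 \<and> v_ideal D P \<and> v_invertible D P"


section \<open>Group algebras of torsion-free groups and their subalgebras\<close>

text \<open>
  The group algebra is the convolution ring of finitely supported functions
  from \<^theory>\<open>HOL-Library.Poly_Mapping\<close>. A copy of that type is needed because the library
  makes it an instance of \<^class>\<open>idom\<close> for linearly ordered exponents only, and this
  rules out a second instance for torsion-free groups.
\<close>

typedef (overloaded) ('g, 'k) group_algebra = "UNIV :: ('g \<Rightarrow>\<^sub>0 'k::zero) set"
  morphisms poly_mapping_of group_algebra_of ..

setup_lifting type_definition_group_algebra

instantiation group_algebra :: (comm_monoid_add, comm_ring_1) comm_ring_1
begin

lift_definition zero_group_algebra :: "('a, 'b) group_algebra" is 0 .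
lift_definition one_group_algebra :: "('a, 'b) group_algebra" is 1 .
lift_definition plus_group_algebra ::
  "('a, 'b) group_algebra \<Rightarrow> ('a, 'b) group_algebra \<Rightarrow> ('a, 'b) group_algebra" is "(+)" .
lift_definition minus_group_algebra ::
  "('a, 'b) group_algebra \<Rightarrow> ('a, 'b) group_algebra \<Rightarrow> ('a, 'b) group_algebra" is "(-)" .
lift_definition uminus_group_algebra ::
  "('a, 'b) group_algebra \<Rightarrow> ('a, 'b) group_algebra" is uminus .
lift_definition times_group_algebra ::
  "('a, 'b) group_algebra \<Rightarrow> ('a, 'b) group_algebra \<Rightarrow> ('a, 'b) group_algebra" is "(*)" .

instance
  by standard (transfer, simp add: algebra_simps)+

end

text \<open>
  For the absence of zero divisors, a maximal pointed cone (Zorn) serves as the set of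
  nonnegative elements of a group ordering.
\<close>

definition pointed_cone :: "'a::ab_group_add set \<Rightarrow> bool" where
  "pointed_cone P \<longleftrightarrow> add_submonoid P \<and> (\<forall>x\<in>P. - x \<in> P \<longrightarrow> x = 0)"

lemma nscale_in_submonoid: "add_submonoid P \<Longrightarrow> x \<in> P \<Longrightarrow> nscale n x \<in> P"
  by (induction n) (auto simp: nscale_Suc add_submonoid_def)

lemma pointed_cone_extend:
  fixes P :: "'a::torsion_free_ab_group_add set"
  assumes P: "pointed_cone P"
    and max: "\<And>Q. pointed_cone Q \<Longrightarrow> P \<subseteq> Q \<Longrightarrow> Q = P"
    and x: "x \<notin> P"
  shows "\<exists>k>0. - nscale k x \<in> P"
proof (rule ccontr)
  assume neg: "\<not> (\<exists>k>0. - nscale k x \<in> P)"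
  have P0: "0 \<in> P" and Padd: "\<And>u v. u \<in> P \<Longrightarrow> v \<in> P \<Longrightarrow> u + v \<in> P"
    and Pneg: "\<And>u. u \<in> P \<Longrightarrow> - u \<in> P \<Longrightarrow> u = 0"
    using P by (auto simp: pointed_cone_def add_submonoid_def)
  define Q where "Q = {p + nscale n x |p n. p \<in> P}"
  have "P \<subseteq> Q"
    unfolding Q_def by (force intro: exI[of _ "0::nat"])
  moreover have "pointed_cone Q"
    unfolding pointed_cone_def add_submonoid_def
  proof (intro conjI ballI impI)
    show "0 \<in> Q" using P0 \<open>P \<subseteq> Q\<close> by auto
  next
    fix u v assume "u \<in> Q" "v \<in> Q"
    then obtain p q m n where "p \<in> P" "q \<in> P" "u = p + nscale m x" "v = q + nscale n x"
      unfolding Q_def by blast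
    then have "u + v = (p + q) + nscale (m + n) x" "p + q \<in> P"
      by (auto simp: nscale_add algebra_simps Padd)
    then show "u + v \<in> Q" unfolding Q_def by blast
  next
    fix u assume "u \<in> Q" "- u \<in> Q"
    then obtain p q m n where pq: "p \<in> P" "q \<in> P"
      and u: "u = p + nscale m x" "- u = q + nscale n x"
      unfolding Q_def by blast
    then have "p + q + nscale (m + n) x = u + (- u)"
      by (simp only: nscale_add algebra_simps)
    then have eq: "- nscale (m + n) x = p + q"
      by (simp add: neg_eq_iff_add_eq_0 add.commute)
    with Padd pq neg have "\<not> 0 < m + n" by metis
    then have "m = 0" "n = 0" by auto
    with u pq Pneg show "u = 0" by auto
  qed
  ultimately have "Q = P" by (intro max)
  moreover have "x \<in> Q"
    unfolding Q_def using P0 by (force intro: exI[of _ "Suc 0"] simp: nscale_Suc)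
  ultimately show False using x by blast
qed

lemma ex_total_cone:
  "\<exists>P :: 'a::torsion_free_ab_group_add set. pointed_cone P \<and> (\<forall>x. x \<in> P \<or> - x \<in> P)"
proof -
  have "\<exists>P\<in>Collect pointed_cone. \<forall>Q\<in>Collect pointed_cone.
          P \<subseteq> Q \<longrightarrow> Q = (P :: 'a set)"
  proof (rule subset_Zorn_nonempty)
    show "Collect pointed_cone \<noteq> ({} :: 'a set set)"
    proof -
      have "pointed_cone ({0} :: 'a set)" by (simp add: pointed_cone_def add_submonoid_def)
      then show ?thesis by blast
    qed
  next
    fix \<C> :: "'a set set"
    assume ne: "\<C> \<noteq> {}" and chain: "subset.chain (Collect pointed_cone) \<C>"
    have common: "\<exists>P\<in>\<C>. u \<in> P \<and> v \<in> P" if "u \<in> \<Union>\<C>" "v \<in> \<Union>\<C>" for u v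
    proof -
      from that obtain P Q where "P \<in> \<C>" "Q \<in> \<C>" "u \<in> P" "v \<in> Q" by blast
      moreover from this chain have "P \<subseteq> Q \<or> Q \<subseteq> P"
        by (auto simp: subset_chain_def)
      ultimately show ?thesis by blast
    qed
    have cone: "pointed_cone P" if "P \<in> \<C>" for P
      using that chain by (auto simp: subset_chain_def)
    have "0 \<in> \<Union>\<C>"
    proof -
      from ne obtain P where "P \<in> \<C>" by blast
      with cone[of P] show ?thesis
        unfolding pointed_cone_def add_submonoid_def by blast
    qed
    moreover have "u + v \<in> \<Union>\<C>" if uv: "u \<in> \<Union>\<C>" "v \<in> \<Union>\<C>" for u v
    proof -
      from common[OF uv] obtain P where "P \<in> \<C>" "u \<in> P" "v \<in> P" by blast
      with cone[of P] show ?thesis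
        unfolding pointed_cone_def add_submonoid_def by blast
    qed
    moreover have "u = 0" if u: "u \<in> \<Union>\<C>" "- u \<in> \<Union>\<C>" for u
    proof -
      from common[OF u] obtain P where "P \<in> \<C>" "u \<in> P" "- u \<in> P" by blast
      with cone[of P] show ?thesis
        unfolding pointed_cone_def by blast
    qed
    ultimately show "\<Union>\<C> \<in> Collect pointed_cone"
      unfolding pointed_cone_def add_submonoid_def mem_Collect_eq by blast
  qed
  then obtain P :: "'a set" where P: "pointed_cone P"
    and max: "\<And>Q. pointed_cone Q \<Longrightarrow> P \<subseteq> Q \<Longrightarrow> Q = P" by blast
  have "x \<in> P \<or> - x \<in> P" for x
  proof (rule ccontr)
    assume "\<not> (x \<in> P \<or> - x \<in> P)"
    then obtain k l where k: "0 < k" "- nscale k x \<in> P" and l: "0 < l" "nscale l x \<in> P"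
      using pointed_cone_extend[OF P max, of x] pointed_cone_extend[OF P max, of "- x"]
      by (auto simp: nscale_minus)
    have sub: "add_submonoid P" using P by (simp add: pointed_cone_def)
    have "nscale k (nscale l x) \<in> P" "nscale l (- nscale k x) \<in> P"
      using nscale_in_submonoid[OF sub] k l by blast+
    moreover have "nscale l (- nscale k x) = - nscale k (nscale l x)"
      by (simp only: nscale_minus flip: nscale_mult) (simp add: mult.commute)
    ultimately have "nscale k (nscale l x) = 0"
      using P unfolding pointed_cone_def by metis
    then have "nscale (k * l) x = 0"
      by (simp only: nscale_mult)
    moreover have "0 < k * l" using k(1) l(1) by simp
    ultimately have "x = 0" by (metis nscale_eq_0_D)
    with \<open>\<not> (x \<in> P \<or> - x \<in> P)\<close> sub show False by (auto simp: add_submonoid_def)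
  qed
  with P show ?thesis by blast
qed

lemma ex_cone_max:
  assumes "finite A" "A \<noteq> {}" "add_submonoid P" "\<forall>x. x \<in> P \<or> - x \<in> P"
  shows "\<exists>m\<in>A. \<forall>a\<in>A. m - a \<in> (P :: 'a::ab_group_add set)"
  using assms(1,2)
proof (induction A rule: finite_ne_induct)
  case (singleton x)
  then show ?case using assms(3) by (auto simp: add_submonoid_def)
next
  case (insert x A)
  then obtain m where m: "m \<in> A" "\<forall>a\<in>A. m - a \<in> P" by blast
  have P: "0 \<in> P" "\<And>u v. u \<in> P \<Longrightarrow> v \<in> P \<Longrightarrow> u + v \<in> P"
    using assms(3) by (auto simp: add_submonoid_def)
  show ?case
  proof (cases "m - x \<in> P")
    case True
    with m show ?thesis by blast
  next
    case False
    then have xm: "x - m \<in> P" using assms(4)[rule_format, of "m - x"] by simp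
    have "x - a \<in> P" if "a \<in> A" for a
      using P(2)[OF xm, of "m - a"] m(2) that by simp
    with P(1) show ?thesis by auto
  qed
qed

lemma poly_mapping_mult_nonzero:
  fixes f g :: "'a::torsion_free_ab_group_add \<Rightarrow>\<^sub>0 'b::idom"
  assumes "f \<noteq> 0" "g \<noteq> 0"
  shows "f * g \<noteq> 0"
proof -
  obtain P :: "'a set" where P: "pointed_cone P" "\<forall>x. x \<in> P \<or> - x \<in> P"
    using ex_total_cone by blast
  have sub: "add_submonoid P" and neg: "\<And>u. u \<in> P \<Longrightarrow> - u \<in> P \<Longrightarrow> u = 0"
    using P(1) by (auto simp: pointed_cone_def)
  have "Poly_Mapping.keys f \<noteq> {}" "Poly_Mapping.keys g \<noteq> {}" using assms by auto
  then obtain m n where m: "m \<in> Poly_Mapping.keys f" "\<forall>a\<in>Poly_Mapping.keys f. m - a \<in> P"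
    and n: "n \<in> Poly_Mapping.keys g" "\<forall>b\<in>Poly_Mapping.keys g. n - b \<in> P"
    using ex_cone_max[OF finite_keys _ sub P(2)] by metis
  have uniq: "a = m \<and> b = n" if "a \<in> Poly_Mapping.keys f" "b \<in> Poly_Mapping.keys g" "m + n = a + b" for a b
  proof -
    have "n - b = - (m - a)" using that(3) by (simp add: algebra_simps)
    then have "m - a = 0" using m n that neg by metis
    with that(3) show ?thesis by simp
  qed
  have "Poly_Mapping.lookup (f * g) (m + n) =
      (\<Sum>(a, b). Poly_Mapping.lookup f a * Poly_Mapping.lookup g b when m + n = a + b)"
    by (simp add: times_poly_mapping.rep_eq prod_fun_unfold_prod)
  also have "(\<lambda>(a, b). Poly_Mapping.lookup f a * Poly_Mapping.lookup g b when m + n = a + b) =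
      (\<lambda>x. Poly_Mapping.lookup f m * Poly_Mapping.lookup g n when x = (m, n))"
  proof (rule ext, clarify)
    fix a b
    show "(Poly_Mapping.lookup f a * Poly_Mapping.lookup g b when m + n = a + b) =
          (Poly_Mapping.lookup f m * Poly_Mapping.lookup g n when (a, b) = (m, n))"
      using uniq[of a b] by (cases "a \<in> Poly_Mapping.keys f \<and> b \<in> Poly_Mapping.keys g")
        (auto simp: in_keys_iff when_def)
  qed
  also have "Sum_any \<dots> = Poly_Mapping.lookup f m * Poly_Mapping.lookup g n"
    by (rule Sum_any_when_equal)
  finally have "Poly_Mapping.lookup (f * g) (m + n) \<noteq> 0"
    using m(1) n(1) by (simp add: in_keys_iff)
  then show ?thesis by auto
qed

instance group_algebra :: (torsion_free_ab_group_add, idom) idom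
proof
  fix a b :: "('a, 'b) group_algebra"
  assume "a \<noteq> 0" "b \<noteq> 0"
  then show "a * b \<noteq> 0"
    using poly_mapping_mult_nonzero[of "poly_mapping_of a" "poly_mapping_of b"]
    by (simp add: zero_group_algebra.rep_eq times_group_algebra.rep_eq
        flip: poly_mapping_of_inject)
qed

text \<open>
  \<open>K[S]\<close> as a subring of the quotient field of \<open>K[G]\<close>, where \<open>G\<close> is
  the ambient group of \<open>S\<close>.
\<close>

definition monoid_algebra ::
  "'g::torsion_free_ab_group_add set \<Rightarrow> ('g, 'k::field) group_algebra fract set" where
  "monoid_algebra S = to_fract ` {f. Poly_Mapping.keys (poly_mapping_of f) \<subseteq> S}"

end

theory Submission
  imports Defs
begin

text \<open>
  Let \<open>G\<close> be the quotient group of \<open>S\<close>, let \<open>D = K[S]\<close>, and let \<open>c\<close> be a nonzero element in the interior of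
  \<open>S\<close>, so that every element of \<open>G\<close> is moved into \<open>S\<close> by adding a multiple of \<open>c\<close>. If \<open>u\<close> denotes the
  monomial of \<open>c\<close>, then inverting \<open>u\<close> turns \<open>D\<close> into \<open>L = K[G]\<close>. The group \<open>G\<close> is free of finite rank
  (\<open>basis_exists\<close>), so \<open>L\<close> is a ring of Laurent polynomials in finitely many variables and is factorial by
  Gauss's lemma (\<open>factorial_in_group_algebra\<close>). The domain \<open>D\<close> is Noetherian by Hilbert's basis theorem
  (\<open>noetherian_in_monoid_algebra\<close>).

  A divisor class consists of the principal multiples \<open>y I\<close> of a \<open>v\<close>-invertible ideal \<open>I\<close>. Dividing by a greatest common
  divisor in \<open>L\<close>, one may assume that \<open>I\<close> and its inverse \<open>J\<close> lie in \<open>L\<close> and contain a power of \<open>u\<close>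
  (\<open>v_invertible_normalize\<close>). For \<open>h \<in> J\<close> the ideal \<open>h I\<close> belongs to the class and is contained in the
  contraction of \<open>h L\<close> to \<open>D\<close>. Both are equal if \<open>h I\<close> lies in none of the finitely many primes that are maximal
  annihilators of nonzero elements of \<open>D / u D\<close>. As \<open>I\<close> is invertible, none of these primes contains \<open>I J\<close>, so
  that prime avoidance gives an element \<open>x \<in> J\<close> with this property (\<open>avoid_associated_primes\<close>). Adding
  multiples of a high power of \<open>u\<close> to \<open>x\<close> does not destroy the property. If the resulting \<open>h\<close> is a prime
  element of \<open>L\<close>, then \<open>h I\<close> is the contraction of \<open>h L\<close>, hence a prime ideal, and it has height one because
  nonzero elements of \<open>L\<close> are not infinitely often divisible by \<open>h\<close>. So it remains to find infinitely many
  primes \<open>h\<close> in the residue class of \<open>x\<close> modulo a power of \<open>u\<close> (\<open>prime_divisors_in_class\<close>).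

  This is where the rank of \<open>G\<close> matters. One adds two monomials to \<open>x\<close>, with exponents \<open>w1\<close> and \<open>w2\<close> deep
  inside \<open>S\<close>. Since the rank is at least two, there is a functional \<open>\<phi>\<close> that vanishes on \<open>c\<close> but not on \<open>G\<close>.
  The exponents can be chosen such that they are the unique minimum and maximum of \<open>\<phi>\<close> among the exponents of
  \<open>h\<close>, while a second functional takes its maximum exactly at these two points, and such that the edge from
  \<open>w1\<close> to \<open>w2\<close> is too short to be a sum of two edges (\<open>prime_near\<close>). In a factorization of \<open>h\<close> the edge of
  one factor is then a point, and this point is at the same time the minimum and the maximum of \<open>\<phi>\<close> on the
  exponents of that factor, which therefore is a monomial, a unit of \<open>L\<close> (\<open>monomial_factor\<close>). So \<open>h\<close> is
  irreducible, and prime since \<open>L\<close> is factorial. Different lengths of the edge give primes that are not associated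
  (\<open>infinitely_many_primes_near\<close>).
\<close>

section \<open>Divisibility in a subring of a domain\<close>

text \<open>
  Subrings are sets inside a fixed domain, so that polynomial rings in different numbers of
  variables have the same type and can be treated by induction on the number of variables.
\<close>

locale subdomain =
  fixes R :: "'a::idom set"
  assumes one_closed: "1 \<in> R"
    and diff_closed: "x \<in> R \<Longrightarrow> y \<in> R \<Longrightarrow> x - y \<in> R"
    and mult_closed: "x \<in> R \<Longrightarrow> y \<in> R \<Longrightarrow> x * y \<in> R"
begin

lemma zero_closed: "0 \<in> R"
  using diff_closed[OF one_closed one_closed] by simp

lemma uminus_closed: "x \<in> R \<Longrightarrow> - x \<in> R"
  using diff_closed[OF zero_closed] by simp

lemma add_closed: "x \<in> R \<Longrightarrow> y \<in> R \<Longrightarrow> x + y \<in> R"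
  using diff_closed[OF _ uminus_closed, of x y] by simp

lemma power_closed: "x \<in> R \<Longrightarrow> x ^ n \<in> R"
  by (induction n) (auto simp: one_closed mult_closed)

lemma sum_closed: "(\<And>i. i \<in> I \<Longrightarrow> f i \<in> R) \<Longrightarrow> sum f I \<in> R"
  by (induction I rule: infinite_finite_induct) (auto simp: zero_closed add_closed)

lemma prod_list_closed: "set xs \<subseteq> R \<Longrightarrow> prod_list xs \<in> R"
  by (induction xs) (auto simp: one_closed mult_closed)

lemmas closed = zero_closed one_closed diff_closed mult_closed uminus_closed add_closed
  power_closed sum_closed prod_list_closed

end

definition divides_in :: "'a::comm_ring_1 set \<Rightarrow> 'a \<Rightarrow> 'a \<Rightarrow> bool" where
  "divides_in R a b \<longleftrightarrow> (\<exists>c\<in>R. b = a * c)"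

definition unit_in :: "'a::comm_ring_1 set \<Rightarrow> 'a \<Rightarrow> bool" where
  "unit_in R x \<longleftrightarrow> x \<in> R \<and> (\<exists>y\<in>R. x * y = 1)"

definition prime_in :: "'a::comm_ring_1 set \<Rightarrow> 'a \<Rightarrow> bool" where
  "prime_in R p \<longleftrightarrow> p \<in> R \<and> p \<noteq> 0 \<and> \<not> unit_in R p \<and>
     (\<forall>a\<in>R. \<forall>b\<in>R. divides_in R p (a * b) \<longrightarrow> divides_in R p a \<or> divides_in R p b)"

definition factorial_in :: "'a::comm_ring_1 set \<Rightarrow> bool" where
  "factorial_in R \<longleftrightarrow> (\<forall>x\<in>R. x \<noteq> 0 \<longrightarrow>
     (\<exists>v ps. unit_in R v \<and> (\<forall>p\<in>set ps. prime_in R p) \<and> x = v * prod_list ps))"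

lemma factorial_inE:
  assumes "factorial_in R" "x \<in> R" "x \<noteq> 0"
  obtains v ps where "unit_in R v" "\<forall>p\<in>set ps. prime_in R p" "x = v * prod_list ps"
  using assms unfolding factorial_in_def by blast

context subdomain
begin

lemma unit_in_mult:
  assumes "unit_in R x" "unit_in R y" shows "unit_in R (x * y)"
proof -
  obtain x' y' where "x' \<in> R" "y' \<in> R" "x * x' = 1" "y * y' = 1"
    using assms unfolding unit_in_def by blast
  then have "(x * x') * (y * y') = 1" "x' * y' \<in> R" by (simp_all add: closed)
  moreover from this have "(x * y) * (x' * y') = 1" by (simp add: ac_simps)
  ultimately show ?thesis using assms unfolding unit_in_def by (auto intro: closed)
qed

lemma divides_in_refl: "divides_in R a a"
  unfolding divides_in_def by (metis mult_1_right one_closed)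

lemma divides_in_mult_left:
  "divides_in R p a \<Longrightarrow> b \<in> R \<Longrightarrow> divides_in R p (b * a)"
  unfolding divides_in_def by (metis mult_closed mult.left_commute)

lemma divides_in_mult_right:
  "divides_in R p a \<Longrightarrow> b \<in> R \<Longrightarrow> divides_in R p (a * b)"
  by (metis divides_in_mult_left mult.commute)

lemma divides_in_add:
  "divides_in R p a \<Longrightarrow> divides_in R p b \<Longrightarrow> divides_in R p (a + b)"
  unfolding divides_in_def by (metis add_closed distrib_left)

lemma divides_in_diff:
  "divides_in R p a \<Longrightarrow> divides_in R p b \<Longrightarrow> divides_in R p (a - b)"
  unfolding divides_in_def by (metis diff_closed right_diff_distrib)

lemma divides_in_zero: "divides_in R p 0"
  unfolding divides_in_def by (metis zero_closed mult_zero_right)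

lemma divides_in_sum:
  "(\<And>i. i \<in> I \<Longrightarrow> divides_in R p (f i)) \<Longrightarrow> divides_in R p (sum f I)"
  by (induction I rule: infinite_finite_induct) (auto simp: divides_in_zero divides_in_add)

lemma divides_in_trans:
  "divides_in R a b \<Longrightarrow> divides_in R b c \<Longrightarrow> divides_in R a c"
  unfolding divides_in_def by (metis mult_closed mult.assoc)

lemma not_prime_divides_unit:
  assumes "prime_in R p" "unit_in R v" shows "\<not> divides_in R p v"
proof
  assume "divides_in R p v"
  then obtain c where c: "c \<in> R" "v = p * c" unfolding divides_in_def by blast
  obtain w where w: "w \<in> R" "v * w = 1" using assms unfolding unit_in_def by blast
  then have "p * (c * w) = 1" "c * w \<in> R" using c by (simp_all add: mult.assoc closed)
  then show False using assms unfolding prime_in_def unit_in_def by blast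
qed

lemma prime_in_divides_prod_list:
  assumes "prime_in R p" "set xs \<subseteq> R" "divides_in R p (prod_list xs)"
  shows "\<exists>x\<in>set xs. divides_in R p x"
  using assms(2,3)
proof (induction xs)
  case Nil
  have "unit_in R 1" unfolding unit_in_def by (metis one_closed mult_1)
  then show ?case using not_prime_divides_unit[OF assms(1)] Nil by auto
next
  case (Cons x xs)
  then have "divides_in R p x \<or> divides_in R p (prod_list xs)"
    using assms(1) unfolding prime_in_def by (simp add: closed)
  with Cons show ?case by auto
qed

lemma set_primes_subset: "\<forall>p\<in>set ps. prime_in R p \<Longrightarrow> set ps \<subseteq> R"
  unfolding prime_in_def by blast

lemma prime_divides_prime:
  assumes p: "prime_in R p" and q: "prime_in R q" and "divides_in R p q"
  shows "\<exists>v. unit_in R v \<and> q = p * v"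
proof -
  obtain v where v: "v \<in> R" "q = p * v" using assms unfolding divides_in_def by blast
  then have "divides_in R q (p * v)" unfolding divides_in_def by (metis mult_1_right one_closed)
  then consider "divides_in R q p" | "divides_in R q v"
    using p q v unfolding prime_in_def by blast
  then show ?thesis
  proof cases
    case 1
    then obtain w where w: "w \<in> R" "p = q * w" unfolding divides_in_def by blast
    then have "p * (v * w) = p * 1" using v by (simp add: mult.assoc)
    moreover have "p \<noteq> 0" using p unfolding prime_in_def by blast
    ultimately have "v * w = 1" by (metis mult_cancel_left)
    then show ?thesis using v w unfolding unit_in_def by blast
  next
    case 2
    then obtain w where w: "w \<in> R" "v = q * w" unfolding divides_in_def by blast
    then have "q * (p * w) = q * 1" using v by (metis mult.commute mult.assoc mult_1_right)
    moreover have "q \<noteq> 0" using q unfolding prime_in_def by blast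
    ultimately have "p * w = 1" by (metis mult_cancel_left)
    then show ?thesis using p w unfolding prime_in_def unit_in_def by blast
  qed
qed

text \<open>
  The number of prime factors counted with multiplicity bounds the length of any product of
  primes that divides a given element; this is what makes greatest common divisors exist.
\<close>

lemma prime_list_length_le:
  assumes "\<forall>p\<in>set ps. prime_in R p" "\<forall>q\<in>set qs. prime_in R q" "unit_in R v"
    "divides_in R (prod_list ps) (v * prod_list qs)"
  shows "length ps \<le> length qs"
  using assms
proof (induction ps arbitrary: qs v)
  case (Cons p ps)
  have p: "prime_in R p" and psR: "set ps \<subseteq> R" and qsR: "set qs \<subseteq> R" and vR: "v \<in> R"
    using Cons.prems set_primes_subset unfolding unit_in_def by auto
  obtain c where c: "c \<in> R" "v * prod_list qs = p * prod_list ps * c"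
    using Cons.prems(4) unfolding divides_in_def by auto
  then have "divides_in R p (v * prod_list qs)"
    unfolding divides_in_def using psR by (metis mult.assoc mult_closed prod_list_closed)
  then have "divides_in R p (prod_list qs)"
    using p Cons.prems(3) not_prime_divides_unit qsR vR unfolding prime_in_def
    by (meson prod_list_closed)
  then obtain q where q: "q \<in> set qs" "divides_in R p q"
    using prime_in_divides_prod_list[OF p qsR] by blast
  then obtain w where w: "unit_in R w" "q = p * w"
    using prime_divides_prime[OF p] Cons.prems(2) by blast
  have qs: "prod_list qs = q * prod_list (remove1 q qs)"
    using q(1) by (induction qs) (auto simp: mult.left_commute)
  have "p * ((v * w) * prod_list (remove1 q qs)) = p * (prod_list ps * c)"
    using c(2) qs w(2) by (simp add: ac_simps)
  moreover have "p \<noteq> 0" using p unfolding prime_in_def by blast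
  ultimately have "(v * w) * prod_list (remove1 q qs) = prod_list ps * c" by simp
  then have "divides_in R (prod_list ps) ((v * w) * prod_list (remove1 q qs))"
    unfolding divides_in_def using c by blast
  then have "length ps \<le> length (remove1 q qs)"
    using Cons.prems w unit_in_mult by (intro Cons.IH) (auto dest: notin_set_remove1)
  then show ?case using q(1) by (simp add: length_remove1) (metis One_nat_def Suc_le_mono Suc_pred length_pos_if_in_set)
qed simp

lemma prime_factor_exists:
  assumes "factorial_in R" "x \<in> R" "x \<noteq> 0" "\<not> unit_in R x"
  shows "\<exists>p. prime_in R p \<and> divides_in R p x"
proof -
  obtain v ps where x: "unit_in R v" "\<forall>p\<in>set ps. prime_in R p" "x = v * prod_list ps"
    using assms by (metis factorial_inE)
  with assms(4) obtain p ps' where ps: "ps = p # ps'" by (cases ps) auto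
  then have "x = p * (v * prod_list ps')" using x by (simp add: mult.left_commute)
  moreover have "v * prod_list ps' \<in> R"
    using x ps set_primes_subset unfolding unit_in_def by (auto intro!: closed)
  ultimately show ?thesis using x(2) ps unfolding divides_in_def by (metis list.set_intros(1))
qed

text \<open>
  A prime factor of an irreducible element is associated to it.
\<close>

lemma irreducible_imp_prime_in:
  assumes "factorial_in R" "h \<in> R" "h \<noteq> 0" "\<not> unit_in R h"
    and irr: "\<And>a b. a \<in> R \<Longrightarrow> b \<in> R \<Longrightarrow> h = a * b \<Longrightarrow> unit_in R a \<or> unit_in R b"
  shows "prime_in R h"
proof -
  obtain p where p: "prime_in R p" "divides_in R p h"
    using prime_factor_exists assms by blast
  then obtain v where v: "v \<in> R" "h = p * v" unfolding divides_in_def by blast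
  moreover have "p \<in> R" "\<not> unit_in R p" using p unfolding prime_in_def by auto
  ultimately have "unit_in R v" using irr by blast
  then obtain w where w: "w \<in> R" "v * w = 1" unfolding unit_in_def by blast
  have iff: "divides_in R h a \<longleftrightarrow> divides_in R p a" if "a \<in> R" for a
  proof
    assume "divides_in R h a"
    with p(2) show "divides_in R p a" by (rule divides_in_trans)
  next
    assume "divides_in R p a"
    moreover have "divides_in R h p"
      unfolding divides_in_def using w v by (metis mult.assoc mult_1_right)
    ultimately show "divides_in R h a" by (metis divides_in_trans)
  qed
  show ?thesis
    using assms(2-4) p(1) iff unfolding prime_in_def by (simp add: closed)
qed

text \<open>
  Taking \<open>d\<close> to be a common divisor with the largest number of prime factors gives a
  greatest common divisor of an arbitrary set with a nonzero element.
\<close>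

lemma gcd_of_set:
  assumes "factorial_in R" "Z \<subseteq> R" "z \<in> Z" "z \<noteq> 0"
  shows "\<exists>d\<in>R. d \<noteq> 0 \<and> (\<forall>z\<in>Z. divides_in R d z) \<and>
           (\<forall>p. prime_in R p \<longrightarrow> \<not> (\<forall>z\<in>Z. divides_in R (p * d) z))"
proof -
  define Q where "Q n \<longleftrightarrow> (\<exists>ps. length ps = n \<and> (\<forall>p\<in>set ps. prime_in R p) \<and>
     (\<forall>z\<in>Z. divides_in R (prod_list ps) z))" for n
  obtain v qs where z: "unit_in R v" "\<forall>q\<in>set qs. prime_in R q" "z = v * prod_list qs"
    using assms by (metis factorial_inE subsetD)
  have bd: "n \<le> length qs" if "Q n" for n
    using that prime_list_length_le[OF _ z(2,1)] z(3) assms(3) unfolding Q_def by metis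
  have "Q 0" unfolding Q_def divides_in_def using assms(2) by auto
  then have "Q (GREATEST n. Q n)" and max: "\<And>n. Q n \<Longrightarrow> n \<le> (GREATEST n. Q n)"
    using bd by (metis GreatestI_nat, metis Greatest_le_nat)
  then obtain ps where ps: "length ps = (GREATEST n. Q n)" "\<forall>p\<in>set ps. prime_in R p"
    "\<forall>z\<in>Z. divides_in R (prod_list ps) z" unfolding Q_def by blast
  have "\<not> (\<forall>z\<in>Z. divides_in R (p * prod_list ps) z)" if p: "prime_in R p" for p
  proof
    assume "\<forall>z\<in>Z. divides_in R (p * prod_list ps) z"
    then have "Q (Suc (length ps))" unfolding Q_def
      using p ps(2) by (intro exI[of _ "p # ps"]) auto
    then show False using max ps(1) by fastforce
  qed
  moreover have "prod_list ps \<noteq> 0" using ps(2) unfolding prime_in_def by (auto simp: prod_list_zero_iff)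
  moreover have "prod_list ps \<in> R" using ps(2) set_primes_subset by (auto intro: closed)
  ultimately show ?thesis using ps(3) by blast
qed

text \<open>
  This clears the constants that pseudo-division introduces: each prime on the left-hand side divides
  one of the two factors on the right and is cancelled there.
\<close>

lemma split_prime_product:
  assumes "\<forall>p\<in>set ps. prime_in R p" "f \<in> R" "s \<in> R" "d \<in> R" "prod_list ps * f = s * d"
  shows "\<exists>r1\<in>R. \<exists>r2\<in>R. \<exists>s'\<in>R. \<exists>d'\<in>R. r1 * r2 = prod_list ps \<and> s = r1 * s' \<and> d = r2 * d' \<and> f = s' * d'"
  using assms
proof (induction ps arbitrary: s d)
  case Nil
  then show ?case by (intro bexI[of _ 1] bexI[of _ s] bexI[of _ d]) (auto intro: closed)
next
  case (Cons p ps)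
  have p: "prime_in R p" "p \<noteq> 0" "p \<in> R" using Cons.prems unfolding prime_in_def by auto
  have psR: "prod_list ps \<in> R" using Cons.prems set_primes_subset by (auto intro!: prod_list_closed)
  then have "divides_in R p (s * d)"
    using Cons.prems unfolding divides_in_def by (metis mult.assoc mult_closed prod_list.Cons)
  then consider "divides_in R p s" | "divides_in R p d"
    using p Cons.prems unfolding prime_in_def by blast
  then show ?case
  proof cases
    case 1
    then obtain t where t: "t \<in> R" "s = p * t" unfolding divides_in_def by blast
    have "prod_list ps * f = t * d" using Cons.prems(5) t p(2) by (simp add: mult.assoc)
    then obtain r1 r2 s' d' where r: "r1 \<in> R" "r2 \<in> R" "s' \<in> R" "d' \<in> R"
      "r1 * r2 = prod_list ps" "t = r1 * s'" "d = r2 * d'" "f = s' * d'"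
      using Cons.IH[of t d] Cons.prems t by auto
    then show ?thesis
      by (intro bexI[of _ "p * r1"] bexI[of _ r2] bexI[of _ s'] bexI[of _ d'])
        (auto simp: t mult.assoc intro!: closed p)
  next
    case 2
    then obtain t where t: "t \<in> R" "d = p * t" unfolding divides_in_def by blast
    have "p * (prod_list ps * f) = p * (s * t)" using Cons.prems(5) t by (simp add: ac_simps)
    then have "prod_list ps * f = s * t" using p(2) by simp
    then obtain r1 r2 s' d' where r: "r1 \<in> R" "r2 \<in> R" "s' \<in> R" "d' \<in> R"
      "r1 * r2 = prod_list ps" "s = r1 * s'" "t = r2 * d'" "f = s' * d'"
      using Cons.IH[of s t] Cons.prems t by auto
    then show ?thesis
      by (intro bexI[of _ r1] bexI[of _ "p * r2"] bexI[of _ s'] bexI[of _ d'])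
        (auto simp: t mult.left_commute mult.assoc intro!: closed p)
  qed
qed

lemma cancel_prime_product:
  assumes "\<forall>p\<in>set ps. prime_in R p \<and> \<not> divides_in R p q" "b \<in> R" "q \<in> R" "z \<in> R"
    "prod_list ps * b = q * z"
  shows "divides_in R q b"
  using assms
proof (induction ps arbitrary: z)
  case Nil
  then show ?case unfolding divides_in_def by auto
next
  case (Cons p ps)
  have p: "prime_in R p" "p \<noteq> 0" "p \<in> R" using Cons.prems unfolding prime_in_def by auto
  have psR: "prod_list ps \<in> R" using Cons.prems set_primes_subset by (auto intro!: prod_list_closed)
  then have "divides_in R p (q * z)"
    using Cons.prems unfolding divides_in_def by (metis mult.assoc mult_closed prod_list.Cons)
  then have "divides_in R p z"
    using p Cons.prems unfolding prime_in_def by auto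
  then obtain t where t: "t \<in> R" "z = p * t" unfolding divides_in_def by blast
  have "p * (prod_list ps * b) = p * (q * t)" using Cons.prems(5) t by (simp add: ac_simps)
  then have "prod_list ps * b = q * t" using p(2) by simp
  then show ?case using Cons t by auto
qed

end

section \<open>Gauss's lemma over a factorial subring\<close>

definition polys_over :: "'a::comm_ring_1 set \<Rightarrow> 'a poly set" where
  "polys_over R = {q. \<forall>i. coeff q i \<in> R}"

context subdomain
begin

lemma subdomain_polys_over: "subdomain (polys_over R)"
  by standard (auto simp: polys_over_def coeff_mult coeff_1 intro!: closed)

interpretation polys: subdomain "polys_over R"
  by (rule subdomain_polys_over)

lemma const_in_polys_over: "r \<in> R \<Longrightarrow> [:r:] \<in> polys_over R"
  by (auto simp: polys_over_def coeff_pCons zero_closed split: nat.split)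

lemma monom_in_polys_over: "r \<in> R \<Longrightarrow> monom r n \<in> polys_over R"
  by (auto simp: polys_over_def zero_closed)

lemma smult_in_polys_over: "r \<in> R \<Longrightarrow> q \<in> polys_over R \<Longrightarrow> smult r q \<in> polys_over R"
  by (auto simp: polys_over_def mult_closed)

lemma const_divides_iff:
  assumes "r \<noteq> 0"
  shows "divides_in (polys_over R) [:r:] q \<longleftrightarrow> (\<forall>i. divides_in R r (coeff q i))"
proof
  assume "divides_in (polys_over R) [:r:] q"
  then show "\<forall>i. divides_in R r (coeff q i)"
    unfolding divides_in_def polys_over_def by auto
next
  assume *: "\<forall>i. divides_in R r (coeff q i)"
  define c where "c i = (if coeff q i = 0 then 0 else SOME c. c \<in> R \<and> coeff q i = r * c)" for i
  have c: "c i \<in> R" "coeff q i = r * c i" for i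
    using someI_ex[of "\<lambda>c. c \<in> R \<and> coeff q i = r * c"] * zero_closed
    unfolding divides_in_def c_def by auto
  have "coeff (Abs_poly c) = c"
    by (rule coeff_Abs_poly[of "degree q"]) (auto simp: c_def coeff_eq_0)
  then have "q = [:r:] * Abs_poly c" "Abs_poly c \<in> polys_over R"
    using c by (auto simp: poly_eq_iff polys_over_def)
  then show "divides_in (polys_over R) [:r:] q" unfolding divides_in_def by blast
qed

lemma unit_const_iff: "unit_in (polys_over R) [:r:] \<longleftrightarrow> unit_in R r"
proof
  assume "unit_in (polys_over R) [:r:]"
  then obtain q where q: "[:r:] \<in> polys_over R" "q \<in> polys_over R" "[:r:] * q = 1"
    unfolding unit_in_def by blast
  have "coeff [:r:] 0 \<in> R" "coeff q 0 \<in> R" using q unfolding polys_over_def by blast+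
  moreover from arg_cong[OF q(3), of "\<lambda>p. coeff p 0"] have "r * coeff q 0 = 1" by simp
  ultimately show "unit_in R r" unfolding unit_in_def by auto
next
  assume "unit_in R r"
  then obtain s where "r \<in> R" "s \<in> R" "r * s = 1" unfolding unit_in_def by blast
  then show "unit_in (polys_over R) [:r:]" unfolding unit_in_def
    by (intro conjI bexI[of _ "[:s:]"] const_in_polys_over) (auto simp: one_pCons mult.commute)
qed

text \<open>
  If \<open>p\<close> divides neither factor, look at the first coefficient of each that it does not divide:
  their product is the only summand of a coefficient of the product not divisible by \<open>p\<close>.
\<close>

lemma prime_const:
  assumes p: "prime_in R p"
  shows "prime_in (polys_over R) [:p:]"
proof -
  have pR: "p \<in> R" "p \<noteq> 0" "\<not> unit_in R p" using p unfolding prime_in_def by auto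
  have "divides_in (polys_over R) [:p:] a \<or> divides_in (polys_over R) [:p:] b"
    if ab: "a \<in> polys_over R" "b \<in> polys_over R" "divides_in (polys_over R) [:p:] (a * b)" for a b
  proof (rule ccontr)
    assume "\<not> ?thesis"
    then have ex: "\<exists>i. \<not> divides_in R p (coeff a i)" "\<exists>i. \<not> divides_in R p (coeff b i)"
      using pR by (auto simp: const_divides_iff)
    define i where "i = (LEAST i. \<not> divides_in R p (coeff a i))"
    define j where "j = (LEAST i. \<not> divides_in R p (coeff b i))"
    have i: "\<not> divides_in R p (coeff a i)" "\<And>k. k < i \<Longrightarrow> divides_in R p (coeff a k)"
      using LeastI_ex[OF ex(1)] not_less_Least unfolding i_def by blast+
    have j: "\<not> divides_in R p (coeff b j)" "\<And>k. k < j \<Longrightarrow> divides_in R p (coeff b k)"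
      using LeastI_ex[OF ex(2)] not_less_Least unfolding j_def by blast+
    have aR: "coeff a k \<in> R" and bR: "coeff b k \<in> R" for k using ab unfolding polys_over_def by auto
    have "coeff (a * b) (i + j) = (\<Sum>k\<le>i + j. coeff a k * coeff b (i + j - k))"
      by (rule coeff_mult)
    also have "\<dots> = coeff a i * coeff b j + (\<Sum>k\<in>{..i + j} - {i}. coeff a k * coeff b (i + j - k))"
      by (subst sum.remove[of _ i]) auto
    finally have eq: "coeff a i * coeff b j =
      coeff (a * b) (i + j) - (\<Sum>k\<in>{..i + j} - {i}. coeff a k * coeff b (i + j - k))" by simp
    have "divides_in R p (coeff a k * coeff b (i + j - k))" if "k \<in> {..i + j} - {i}" for k
    proof (cases "k < i")
      case True
      then show ?thesis using i(2) bR divides_in_mult_right by blast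
    next
      case False
      with that have "i + j - k < j" by auto
      then show ?thesis using j(2) aR divides_in_mult_left by blast
    qed
    then have "divides_in R p (coeff a i * coeff b j)"
      unfolding eq using ab(3) pR by (intro divides_in_diff divides_in_sum) (auto simp: const_divides_iff)
    then show False using i(1) j(1) aR bR p unfolding prime_in_def by blast
  qed
  then show ?thesis
    unfolding prime_in_def using pR const_in_polys_over unit_const_iff by auto
qed

lemma pseudo_division:
  assumes "d \<in> polys_over R" "d \<noteq> 0" "y \<in> polys_over R"
  shows "\<exists>k. \<exists>s\<in>polys_over R. \<exists>r\<in>polys_over R.
           [:lead_coeff d ^ k:] * y = s * d + r \<and> (r = 0 \<or> degree r < degree d)"
  using assms(3)
proof (induction "degree y" arbitrary: y rule: less_induct)
  case less
  show ?case
  proof (cases "y = 0 \<or> degree y < degree d")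
    case True
    then show ?thesis
      using less.prems by (intro exI[of _ 0] bexI[of _ 0] bexI[of _ y]) (auto intro: polys.closed)
  next
    case False
    define q where "q = monom (lead_coeff y) (degree y - degree d)"
    define y' where "y' = [:lead_coeff d:] * y - q * d"
    have lR: "lead_coeff d \<in> R" "lead_coeff y \<in> R" using assms less.prems unfolding polys_over_def by auto
    have q: "q \<in> polys_over R" unfolding q_def using lR by (intro monom_in_polys_over)
    have y': "y' \<in> polys_over R"
      unfolding y'_def using q assms less.prems lR by (intro polys.closed const_in_polys_over)
    have small: "y' = 0 \<or> degree y' < degree y"
    proof (cases "y' = 0")
      case False
      have deg: "degree (q * d) = degree y" and q0: "lead_coeff q = lead_coeff y"
        using \<open>\<not> (y = 0 \<or> degree y < degree d)\<close> assms(2)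
        by (auto simp: q_def degree_mult_eq degree_monom_eq monom_eq_0_iff)
      have "coeff (q * d) (degree y) = lead_coeff y * lead_coeff d"
        using lead_coeff_mult[of q d] unfolding deg q0 .
      then have "coeff y' (degree y) = 0" unfolding y'_def by (simp add: mult.commute)
      moreover have "degree y' \<le> degree y"
        unfolding y'_def using deg by (intro degree_diff_le) (auto intro: degree_smult_le)
      ultimately show ?thesis using False by (metis le_neq_implies_less leading_coeff_0_iff)
    qed simp
    have "\<exists>k. \<exists>s\<in>polys_over R. \<exists>r\<in>polys_over R.
           [:lead_coeff d ^ k:] * y' = s * d + r \<and> (r = 0 \<or> degree r < degree d)"
    proof (cases "y' = 0")
      case True
      then show ?thesis
        by (intro exI[of _ 0] bexI[of _ 0]) (auto intro: polys.closed)
    next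
      case False
      then show ?thesis using small y' less.hyps by blast
    qed
    then obtain k s r where IH: "s \<in> polys_over R" "r \<in> polys_over R"
      "[:lead_coeff d ^ k:] * y' = s * d + r" "r = 0 \<or> degree r < degree d" by blast
    have "[:lead_coeff d ^ Suc k:] * y = [:lead_coeff d ^ k:] * y' + [:lead_coeff d ^ k:] * q * d"
      by (simp add: y'_def algebra_simps smult_diff_right)
    also have "\<dots> = (s + [:lead_coeff d ^ k:] * q) * d + r"
      using IH(3) by (simp add: algebra_simps)
    finally show ?thesis
      using IH q lR
      by (intro exI[of _ "Suc k"] bexI[of _ "s + [:lead_coeff d ^ k:] * q"] bexI[of _ r])
        (auto intro!: polys.closed const_in_polys_over simp del: mult_pCons_left intro: power_closed)
  qed
qed

end

locale factorial_subdomain = subdomain +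
  assumes factorial: "factorial_in R"
begin

interpretation polys: subdomain "polys_over R"
  by (rule subdomain_polys_over)

definition primitive :: "'a poly \<Rightarrow> bool" where
  "primitive q \<longleftrightarrow> q \<in> polys_over R \<and> q \<noteq> 0 \<and>
     (\<forall>p. prime_in R p \<longrightarrow> \<not> divides_in (polys_over R) [:p:] q)"

lemma const_prime_product:
  assumes "r \<in> R" "r \<noteq> 0"
  obtains v ps where "unit_in R v" "\<forall>p\<in>set ps. prime_in R p" "[:r:] = [:v:] * prod_list (map (\<lambda>p. [:p:]) ps)"
proof -
  obtain v ps where *: "unit_in R v" "\<forall>p\<in>set ps. prime_in R p" "r = v * prod_list ps"
    using factorial assms by (metis factorial_inE)
  have "prod_list (map (\<lambda>p. [:p:]) ps) = [:prod_list ps:]"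
    by (induction ps) (auto simp: one_pCons)
  then show ?thesis using * that[of v ps] by simp
qed

lemma primitive_cancel_const:
  assumes q: "primitive q" and "e \<in> R" "e \<noteq> 0" "b \<in> polys_over R"
    and "divides_in (polys_over R) q ([:e:] * b)"
  shows "divides_in (polys_over R) q b"
proof -
  obtain v ps where e: "unit_in R v" "\<forall>p\<in>set ps. prime_in R p"
    "[:e:] = [:v:] * prod_list (map (\<lambda>p. [:p:]) ps)"
    using const_prime_product assms by blast
  obtain w where w: "w \<in> R" "v * w = 1" using e unfolding unit_in_def by blast
  obtain z where z: "z \<in> polys_over R" "[:e:] * b = q * z"
    using assms unfolding divides_in_def by blast
  have "prod_list (map (\<lambda>p. [:p:]) ps) * b = ([:w:] * [:v:]) * (prod_list (map (\<lambda>p. [:p:]) ps) * b)"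
    using w by (simp add: mult.commute[of w])
  also have "\<dots> = [:w:] * ([:e:] * b)" unfolding e(3) by (simp only: ac_simps)
  also have "\<dots> = q * ([:w:] * z)" unfolding z by (simp only: ac_simps)
  finally show ?thesis
    using e(2) q w z assms(4) prime_const unfolding primitive_def
    by (intro polys.cancel_prime_product[of "map (\<lambda>p. [:p:]) ps" q b "[:w:] * z"])
      (auto intro!: polys.closed const_in_polys_over simp del: mult_pCons_left)
qed

lemma primitive_degree_0_factor:
  assumes q: "primitive q" and "q = a * b" "a \<in> polys_over R" "b \<in> polys_over R" "degree a = 0"
  shows "unit_in (polys_over R) a"
proof -
  obtain r where r: "a = [:r:]" using assms(5) by (metis degree_eq_zeroE)
  then have rR: "r \<in> R" "r \<noteq> 0"
    using assms unfolding primitive_def polys_over_def by (auto dest: spec[of _ 0])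
  have "unit_in R r"
  proof (rule ccontr)
    assume "\<not> unit_in R r"
    then obtain p where p: "prime_in R p" "divides_in R p r"
      using prime_factor_exists factorial rR by blast
    then obtain c where "c \<in> R" "r = p * c" unfolding divides_in_def by blast
    then have "q = [:p:] * ([:c:] * b)" "[:c:] * b \<in> polys_over R"
      using assms(2,4) r by (auto simp: mult.commute intro!: polys.closed smult_in_polys_over)
    then show False using q p unfolding primitive_def divides_in_def by blast
  qed
  then show ?thesis unfolding r unit_const_iff .
qed

text \<open>
  Let \<open>q\<close> be primitive without a factorization into polynomials of positive degree. A nonzero
  element \<open>d\<close> of least degree in the ideal generated by \<open>q\<close> and \<open>a\<close> divides both up to constants,
  because pseudo-division by \<open>d\<close> leaves no remainder. So \<open>d\<close> is either a constant, in which case \<open>q\<close>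
  divides every \<open>b\<close> for which it divides \<open>a * b\<close>, or a constant multiple of \<open>q\<close>, in which case
  \<open>q\<close> divides \<open>a\<close>.
\<close>

lemma primitive_irreducible_prime:
  assumes q: "primitive q" and deg: "degree q > 0"
    and irr: "\<And>a b. a \<in> polys_over R \<Longrightarrow> b \<in> polys_over R \<Longrightarrow> q = a * b \<Longrightarrow> degree a = 0 \<or> degree b = 0"
  shows "prime_in (polys_over R) q"
proof -
  have qP: "q \<in> polys_over R" "q \<noteq> 0" using q unfolding primitive_def by auto
  have "\<not> unit_in (polys_over R) q"
  proof
    assume "unit_in (polys_over R) q"
    then obtain y where y: "q * y = 1" unfolding unit_in_def by blast
    then have "degree q + degree y = 0" "y \<noteq> 0" using degree_mult_eq[of q y] qP by force+
    with deg show False by simp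
  qed
  moreover have "divides_in (polys_over R) q a \<or> divides_in (polys_over R) q b"
    if ab: "a \<in> polys_over R" "b \<in> polys_over R" "divides_in (polys_over R) q (a * b)" for a b
  proof -
    define I where "I = {x * a + y * q |x y. x \<in> polys_over R \<and> y \<in> polys_over R}"
    have IP: "I \<subseteq> polys_over R" unfolding I_def using ab qP by (auto intro!: polys.closed)
    have qI: "q \<in> I" unfolding I_def using polys.closed(1,2) by force
    have aI: "a \<in> I" unfolding I_def using polys.closed(1,2) by force
    have I_diff: "x - y \<in> I" if "x \<in> I" "y \<in> I" for x y
    proof -
      from that obtain x1 x2 y1 y2 where "x = x1 * a + x2 * q" "y = y1 * a + y2 * q"
        "x1 \<in> polys_over R" "x2 \<in> polys_over R" "y1 \<in> polys_over R" "y2 \<in> polys_over R"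
        unfolding I_def by blast
      then have "x - y = (x1 - y1) * a + (x2 - y2) * q" "x1 - y1 \<in> polys_over R" "x2 - y2 \<in> polys_over R"
        by (auto simp: algebra_simps intro: polys.closed)
      then show ?thesis unfolding I_def by blast
    qed
    have I_mult: "x * y \<in> I" if "x \<in> polys_over R" "y \<in> I" for x y
    proof -
      from that obtain y1 y2 where "y = y1 * a + y2 * q" "y1 \<in> polys_over R" "y2 \<in> polys_over R"
        unfolding I_def by blast
      then have "x * y = (x * y1) * a + (x * y2) * q" "x * y1 \<in> polys_over R" "x * y2 \<in> polys_over R"
        using that by (auto simp: algebra_simps intro: polys.closed)
      then show ?thesis unfolding I_def by blast
    qed
    obtain d where d: "d \<in> I" "d \<noteq> 0" "\<And>y. y \<in> I \<Longrightarrow> y \<noteq> 0 \<Longrightarrow> degree d \<le> degree y"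
      using qI qP(2) exists_least_iff[of "\<lambda>n. \<exists>y\<in>I. y \<noteq> 0 \<and> degree y = n"]
      by (metis linorder_not_less)
    have dP: "d \<in> polys_over R" using d IP by blast
    have lR: "lead_coeff d \<in> R" "lead_coeff d \<noteq> 0" using dP d(2) unfolding polys_over_def by auto
    have exact: "\<exists>k. \<exists>s\<in>polys_over R. [:lead_coeff d ^ k:] * y = s * d" if y: "y \<in> I" for y
    proof -
      obtain k s r where *: "s \<in> polys_over R" "r \<in> polys_over R"
        "[:lead_coeff d ^ k:] * y = s * d + r" "r = 0 \<or> degree r < degree d"
        using pseudo_division[OF dP d(2)] y IP by blast
      have "r = [:lead_coeff d ^ k:] * y - s * d" using *(3) by simp
      also have "\<dots> \<in> I" using * d(1) y lR by (intro I_diff I_mult const_in_polys_over power_closed) auto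
      finally have "r = 0" using *(4) d(3)[of r] by linarith
      then show ?thesis using * by auto
    qed
    obtain k s where s: "s \<in> polys_over R" "[:lead_coeff d ^ k:] * q = s * d" using exact qI by blast
    obtain l t where t: "t \<in> polys_over R" "[:lead_coeff d ^ l:] * a = t * d" using exact aI by blast
    have "lead_coeff d ^ k \<in> R" "lead_coeff d ^ k \<noteq> 0" using lR by (auto intro: power_closed)
    then obtain v ps where v: "unit_in R v" "\<forall>p\<in>set ps. prime_in R p"
      "[:lead_coeff d ^ k:] = [:v:] * prod_list (map (\<lambda>p. [:p:]) ps)"
      by (rule const_prime_product)
    obtain w where w: "w \<in> R" "v * w = 1" using v unfolding unit_in_def by blast
    have "prod_list (map (\<lambda>p. [:p:]) ps) * q = ([:w:] * [:v:]) * (prod_list (map (\<lambda>p. [:p:]) ps) * q)"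
      using w by (simp add: mult.commute[of w])
    also have "\<dots> = [:w:] * ([:lead_coeff d ^ k:] * q)" unfolding v(3) by (simp only: ac_simps)
    also have "\<dots> = ([:w:] * s) * d" unfolding s by (simp only: ac_simps)
    finally have "\<exists>r1\<in>polys_over R. \<exists>r2\<in>polys_over R. \<exists>s'\<in>polys_over R. \<exists>d'\<in>polys_over R.
        r1 * r2 = prod_list (map (\<lambda>p. [:p:]) ps) \<and> [:w:] * s = r1 * s' \<and> d = r2 * d' \<and> q = s' * d'"
      using v(2) prime_const qP s(1) w dP
      by (intro polys.split_prime_product) (auto intro!: polys.closed const_in_polys_over simp del: mult_pCons_left)
    then obtain r1 r2 s' d' where sp: "r1 \<in> polys_over R" "r2 \<in> polys_over R" "s' \<in> polys_over R" "d' \<in> polys_over R"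
      "r1 * r2 = prod_list (map (\<lambda>p. [:p:]) ps)" "d = r2 * d'" "q = s' * d'" by blast
    have "prod_list (map (\<lambda>p. [:p:]) ps) = [:prod_list ps:]"
      by (induction ps) (auto simp: one_pCons)
    then have "degree (r1 * r2) = 0" "r1 * r2 \<noteq> 0"
      using sp(5) v(2) by (auto simp: prod_list_zero_iff prime_in_def)
    then have "degree r2 = 0" using degree_mult_eq[of r1 r2] by force
    then obtain e where e: "r2 = [:e:]" by (metis degree_eq_zeroE)
    from irr[OF sp(3,4,7)] consider "degree d' = 0" | "degree s' = 0" by metis
    then show ?thesis
    proof cases
      case 1
      then have "degree d = 0" using sp(6) e by simp
      then obtain f where f: "d = [:f:]" by (metis degree_eq_zeroE)
      obtain x y where xy: "x \<in> polys_over R" "y \<in> polys_over R" "d = x * a + y * q"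
        using d(1) unfolding I_def by blast
      have "[:f:] * b = x * (a * b) + (y * b) * q" using xy(3) unfolding f by (simp only: algebra_simps)
      moreover have "divides_in (polys_over R) q (x * (a * b) + (y * b) * q)"
        using polys.divides_in_add[OF polys.divides_in_mult_left[OF ab(3) xy(1)]
            polys.divides_in_mult_left[OF polys.divides_in_refl]] ab xy by (blast intro: polys.closed)
      moreover have "f \<in> R" "f \<noteq> 0" using lR f by auto
      ultimately show ?thesis using primitive_cancel_const[OF q] ab by metis
    next
      case 2
      then obtain z where z: "z \<in> polys_over R" "s' * z = 1"
        using primitive_degree_0_factor[OF q sp(7)] sp unfolding unit_in_def by blast
      have "d' = z * q" unfolding sp(7) using z by (simp add: mult.left_commute flip: mult.assoc)
      then have "d = q * (r2 * z)" using sp(6) by (simp add: ac_simps)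
      then have "[:lead_coeff d ^ l:] * a = q * (t * (r2 * z))" using t by (simp only: ac_simps)
      then have "divides_in (polys_over R) q ([:lead_coeff d ^ l:] * a)"
        unfolding divides_in_def using t z sp by (intro bexI[of _ "t * (r2 * z)"]) (auto intro!: polys.closed)
      then show ?thesis using primitive_cancel_const[OF q] ab lR power_closed by (metis power_not_zero)
    qed
  qed
  ultimately show ?thesis using qP unfolding prime_in_def by blast
qed

lemma primitive_part_exists:
  assumes "q \<in> polys_over R" "q \<noteq> 0"
  shows "\<exists>r\<in>R. \<exists>q'. r \<noteq> 0 \<and> primitive q' \<and> q = [:r:] * q'"
proof -
  have "range (coeff q) \<subseteq> R" "lead_coeff q \<in> range (coeff q)" "lead_coeff q \<noteq> 0"
    using assms unfolding polys_over_def by auto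
  then obtain r where r: "r \<in> R" "r \<noteq> 0" "\<forall>z\<in>range (coeff q). divides_in R r z"
    "\<And>p. prime_in R p \<Longrightarrow> \<not> (\<forall>z\<in>range (coeff q). divides_in R (p * r) z)"
    using gcd_of_set[OF factorial] by blast
  then obtain q' where q': "q' \<in> polys_over R" "q = [:r:] * q'"
    using const_divides_iff[OF r(2), of q] unfolding divides_in_def by auto
  have "\<not> divides_in (polys_over R) [:p:] q'" if p: "prime_in R p" for p
  proof
    assume "divides_in (polys_over R) [:p:] q'"
    moreover have p0: "p \<noteq> 0" using p unfolding prime_in_def by blast
    ultimately have "divides_in R p (coeff q' i)" for i using const_divides_iff by blast
    then have "divides_in R (p * r) (coeff q i)" for i
      unfolding q'(2) divides_in_def by (simp add: ac_simps) (metis mult.left_commute)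
    then show False using r(4)[OF p] by blast
  qed
  then have "primitive q'" using q' assms(2) unfolding primitive_def by auto
  then show ?thesis using r q' by blast
qed

definition prime_product :: "'a poly \<Rightarrow> bool" where
  "prime_product q \<longleftrightarrow> (\<exists>v ps. unit_in (polys_over R) v \<and>
     (\<forall>p\<in>set ps. prime_in (polys_over R) p) \<and> q = v * prod_list ps)"

lemma prime_product_mult:
  assumes "prime_product a" "prime_product b"
  shows "prime_product (a * b)"
proof -
  obtain v ps where "unit_in (polys_over R) v"
    "\<forall>p\<in>set ps. prime_in (polys_over R) p" "a = v * prod_list ps"
    using assms(1) unfolding prime_product_def by blast
  moreover obtain w qs where "unit_in (polys_over R) w"
    "\<forall>p\<in>set qs. prime_in (polys_over R) p" "b = w * prod_list qs"
    using assms(2) unfolding prime_product_def by blast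
  ultimately show ?thesis unfolding prime_product_def
    by (intro exI[of _ "v * w"] exI[of _ "ps @ qs"]) (auto simp: ac_simps polys.unit_in_mult)
qed

text \<open>
  A primitive polynomial is split into factors of smaller degree as long as possible. What is left is
  prime, and the content is a product of primes of the coefficient ring, which stay prime.
\<close>

lemma factorial_in_polys_over: "factorial_in (polys_over R)"
proof -
  have const: "prime_product [:r:]" if r: "r \<in> R" "r \<noteq> 0" for r
  proof -
    from r obtain v ps where "unit_in R v" "\<forall>p\<in>set ps. prime_in R p"
      "[:r:] = [:v:] * prod_list (map (\<lambda>p. [:p:]) ps)"
      by (rule const_prime_product)
    then show ?thesis unfolding prime_product_def
      by (intro exI[of _ "[:v:]"] exI[of _ "map (\<lambda>p. [:p:]) ps"]) (auto simp: unit_const_iff prime_const)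
  qed
  have "prime_product q" if "q \<in> polys_over R" "q \<noteq> 0" for q
    using that
  proof (induction "degree q" arbitrary: q rule: less_induct)
    case less
    obtain r q' where r: "r \<in> R" "r \<noteq> 0" "primitive q'" "q = [:r:] * q'"
      using primitive_part_exists less.prems by blast
    have q': "q' \<in> polys_over R" "q' \<noteq> 0" using r unfolding primitive_def by auto
    have deg: "degree q = degree q'" using r by simp
    have "prime_product q'"
    proof (cases "\<exists>a b. a \<in> polys_over R \<and> b \<in> polys_over R \<and> q' = a * b \<and> degree a \<noteq> 0 \<and> degree b \<noteq> 0")
      case True
      then obtain a b where ab: "a \<in> polys_over R" "b \<in> polys_over R" "q' = a * b" "degree a \<noteq> 0" "degree b \<noteq> 0"
        by blast
      then have "a \<noteq> 0" "b \<noteq> 0" "degree a < degree q" "degree b < degree q"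
        using q'(2) deg by (auto simp: degree_mult_eq)
      then show ?thesis using less.hyps ab by (auto intro: prime_product_mult)
    next
      case irr: False
      show ?thesis
      proof (cases "degree q' = 0")
        case True
        then obtain c where "q' = [:c:]" by (metis degree_eq_zeroE)
        moreover have "coeff q' 0 \<in> R" using q' unfolding polys_over_def by blast
        ultimately show ?thesis using const q' by auto
      next
        case False
        then have "prime_in (polys_over R) q'"
          using r irr by (intro primitive_irreducible_prime) auto
        moreover have "unit_in (polys_over R) 1" unfolding unit_in_def by (auto intro: polys.closed)
        ultimately show ?thesis unfolding prime_product_def
          by (intro exI[of _ 1] exI[of _ "[q']"]) auto
      qed
    qed
    then show ?case unfolding r(4) using const r by (intro prime_product_mult) auto
  qed
  then show ?thesis unfolding factorial_in_def prime_product_def by blast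
qed

end

section \<open>Laurent polynomials over a factorial subring\<close>

definition adjoin :: "'a::comm_ring_1 set \<Rightarrow> 'a \<Rightarrow> 'a set" where
  "adjoin R t = (\<lambda>q. poly q t) ` polys_over R"

definition laurent :: "'a::comm_ring_1 set \<Rightarrow> 'a \<Rightarrow> 'a set" where
  "laurent R t = {x. \<exists>n. t ^ n * x \<in> adjoin R t}"

context subdomain
begin

interpretation polys: subdomain "polys_over R"
  by (rule subdomain_polys_over)

lemma subdomain_adjoin: "subdomain (adjoin R t)"
proof
  show "1 \<in> adjoin R t" unfolding adjoin_def by (rule image_eqI[of _ _ 1]) (auto intro: polys.closed)
  fix x y assume "x \<in> adjoin R t" "y \<in> adjoin R t"
  then obtain p q where pq: "p \<in> polys_over R" "q \<in> polys_over R" "x = poly p t" "y = poly q t"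
    unfolding adjoin_def by blast
  show "x - y \<in> adjoin R t" unfolding adjoin_def
    by (rule image_eqI[of _ _ "p - q"]) (auto intro: polys.closed pq(1,2) simp: pq(3,4))
  show "x * y \<in> adjoin R t" unfolding adjoin_def
    by (rule image_eqI[of _ _ "p * q"]) (auto intro: polys.closed pq(1,2) simp: pq(3,4))
qed

lemma coeff_in_adjoin: "r \<in> R \<Longrightarrow> r \<in> adjoin R t"
  unfolding adjoin_def by (rule image_eqI[of _ _ "[:r:]"]) (auto intro: const_in_polys_over)

lemma var_in_polys_over: "[:0, 1:] \<in> polys_over R"
  by (auto simp: polys_over_def coeff_pCons zero_closed one_closed split: nat.split)

lemma generator_in_adjoin: "t \<in> adjoin R t"
  unfolding adjoin_def by (rule image_eqI[of _ _ "[:0, 1:]"]) (auto intro: var_in_polys_over)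

lemma subdomain_laurent: "subdomain (laurent R t)"
proof
  interpret adj: subdomain "adjoin R t" by (rule subdomain_adjoin)
  show "1 \<in> laurent R t" unfolding laurent_def using adj.one_closed by (auto intro: exI[of _ 0])
  fix x y assume "x \<in> laurent R t" "y \<in> laurent R t"
  then obtain m n where "t ^ m * x \<in> adjoin R t" "t ^ n * y \<in> adjoin R t" unfolding laurent_def by blast
  then have *: "t ^ n * (t ^ m * x) - t ^ m * (t ^ n * y) \<in> adjoin R t" "(t ^ m * x) * (t ^ n * y) \<in> adjoin R t"
    by (auto intro!: adj.closed generator_in_adjoin)
  have "t ^ (m + n) * (x - y) \<in> adjoin R t" "t ^ (m + n) * (x * y) \<in> adjoin R t"
    using * by (simp_all add: algebra_simps power_add)
  then show "x - y \<in> laurent R t" "x * y \<in> laurent R t" unfolding laurent_def by blast+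
qed

lemma not_prime_divides_power:
  assumes "prime_in R p" "x \<in> R" "\<not> divides_in R p x"
  shows "\<not> divides_in R p (x ^ k)"
proof (induction k)
  case 0
  then show ?case using not_prime_divides_unit[OF assms(1), of 1]
    by (auto simp: unit_in_def one_closed)
next
  case (Suc k)
  then show ?case using assms unfolding prime_in_def by (auto intro: power_closed)
qed

lemma unit_or_prime_product:
  assumes "\<forall>x\<in>set xs. unit_in R x \<or> prime_in R x"
  shows "\<exists>v ps. unit_in R v \<and> (\<forall>p\<in>set ps. prime_in R p) \<and> prod_list xs = v * prod_list ps"
  using assms
proof (induction xs)
  case Nil
  have "unit_in R 1" unfolding unit_in_def by (auto intro: closed)
  then show ?case by (intro exI[of _ 1] exI[of _ "[]"]) auto
next
  case (Cons x xs)
  then obtain v ps where *: "unit_in R v" "\<forall>p\<in>set ps. prime_in R p" "prod_list xs = v * prod_list ps"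
    by auto
  show ?case
  proof (cases "unit_in R x")
    case True
    then show ?thesis using * by (intro exI[of _ "x * v"] exI[of _ ps]) (auto simp: unit_in_mult mult.assoc)
  next
    case False
    then show ?thesis using * Cons.prems
      by (intro exI[of _ v] exI[of _ "x # ps"]) (auto simp: mult.left_commute)
  qed
qed

end

text \<open>
  A prime of the polynomial ring stays prime in the Laurent polynomials unless it divides a
  power of the variable, in which case it becomes a unit.
\<close>

lemma (in factorial_subdomain) factorial_in_laurent:
  fixes t :: 'a
  assumes inv: "t * t' = 1" and transcendental: "\<And>q. q \<in> polys_over R \<Longrightarrow> poly q t = 0 \<Longrightarrow> q = 0"
  shows "factorial_in (laurent R t)"
proof -
  interpret polys: subdomain "polys_over R" by (rule subdomain_polys_over)
  interpret adj: subdomain "adjoin R t" by (rule subdomain_adjoin)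
  interpret L: subdomain "laurent R t" by (rule subdomain_laurent)
  have AL: "adjoin R t \<subseteq> laurent R t" unfolding laurent_def by (auto intro: exI[of _ 0])
  have inv_pow: "t ^ n * t' ^ n = 1" for n using inv by (simp flip: power_mult_distrib)
  have t'L: "t' ^ n \<in> laurent R t" for n
    unfolding laurent_def by (auto simp: inv_pow adj.one_closed intro!: exI[of _ n])
  have rep: "\<exists>n. \<exists>q\<in>polys_over R. t ^ n * x = poly q t" if "x \<in> laurent R t" for x
    using that unfolding laurent_def adjoin_def by blast
  have inj: "p = q" if "p \<in> polys_over R" "q \<in> polys_over R" "poly p t = poly q t" for p q
    using transcendental[of "p - q"] that by (auto intro: polys.closed)
  have PL: "poly q t \<in> laurent R t" if "q \<in> polys_over R" for q
    using that AL unfolding adjoin_def by blast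
  have X: "poly ([:0, 1:] ^ n) t = t ^ n" for n by simp
  have Xn: "[:0, 1:] ^ n \<in> polys_over R" for n by (intro polys.power_closed var_in_polys_over)
  have up: "unit_in (laurent R t) (poly p t) \<or> prime_in (laurent R t) (poly p t)"
    if p: "prime_in (polys_over R) p" for p
  proof (cases "divides_in (polys_over R) p [:0, 1:]")
    case True
    then obtain c where c: "c \<in> polys_over R" "[:0, 1:] = p * c" unfolding divides_in_def by blast
    have "t = poly (p * c) t" by (simp flip: c(2))
    then have "t = poly p t * poly c t" "poly c t \<in> laurent R t"
      using PL c(1) by simp_all
    then have "poly p t * (poly c t * t' ^ 1) = 1" "poly c t * t' ^ 1 \<in> laurent R t"
      using inv t'L by (simp_all only: L.mult_closed) (simp flip: mult.assoc)
    then show ?thesis using PL p unfolding unit_in_def prime_in_def by blast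
  next
    case False
    have pP: "p \<in> polys_over R" "p \<noteq> 0" using p unfolding prime_in_def by auto
    note nX = polys.not_prime_divides_power[OF p var_in_polys_over False]
    have "\<not> unit_in (laurent R t) (poly p t)"
    proof
      assume "unit_in (laurent R t) (poly p t)"
      then obtain c where c: "c \<in> laurent R t" "poly p t * c = 1" unfolding unit_in_def by blast
      then obtain n q where q: "q \<in> polys_over R" "t ^ n * c = poly q t" using rep by blast
      have "poly ([:0, 1:] ^ n) t = t ^ n * (poly p t * c)" using c by simp
      also have "\<dots> = poly (p * q) t" using q by (simp add: mult.left_commute flip: q(2))
      finally have "[:0, 1:] ^ n = p * q" by (intro inj Xn polys.mult_closed pP q)
      then show False using nX q unfolding divides_in_def by blast
    qed
    moreover have "poly p t \<noteq> 0" using transcendental pP by blast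
    moreover have "divides_in (laurent R t) (poly p t) a \<or> divides_in (laurent R t) (poly p t) b"
      if ab: "a \<in> laurent R t" "b \<in> laurent R t" "divides_in (laurent R t) (poly p t) (a * b)" for a b
    proof -
      obtain c where c: "c \<in> laurent R t" "a * b = poly p t * c" using ab unfolding divides_in_def by blast
      obtain l qa where a: "qa \<in> polys_over R" "t ^ l * a = poly qa t" using rep ab by blast
      obtain m qb where b: "qb \<in> polys_over R" "t ^ m * b = poly qb t" using rep ab by blast
      obtain n qc where qc: "qc \<in> polys_over R" "t ^ n * c = poly qc t" using rep c by blast
      have "poly ([:0, 1:] ^ n * (qa * qb)) t = t ^ n * t ^ l * t ^ m * (a * b)"
        by (simp add: ac_simps flip: a(2) b(2))
      also have "\<dots> = poly ([:0, 1:] ^ (l + m) * (p * qc)) t"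
        unfolding c by (simp add: ac_simps power_add flip: qc(2))
      finally have "[:0, 1:] ^ n * (qa * qb) = [:0, 1:] ^ (l + m) * (p * qc)"
        by (intro inj Xn polys.mult_closed pP a(1) b(1) qc(1))
      then have "divides_in (polys_over R) p ([:0, 1:] ^ n * (qa * qb))"
        unfolding divides_in_def using Xn qc by (auto intro!: bexI[of _ "[:0, 1:] ^ (l + m) * qc"] polys.mult_closed simp: mult.left_commute)
      then have "divides_in (polys_over R) p qa \<or> divides_in (polys_over R) p qb"
        using p nX[of n] Xn a(1) b(1) unfolding prime_in_def by (meson polys.mult_closed)
      moreover have "divides_in (laurent R t) (poly p t) x"
        if "t ^ k * x = poly q t" "divides_in (polys_over R) p q" for k x q
      proof -
        obtain d where d: "d \<in> polys_over R" "q = p * d" using \<open>divides_in (polys_over R) p q\<close> unfolding divides_in_def by blast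
        have "x = (t ^ k * t' ^ k) * x" by (simp add: inv_pow)
        also have "\<dots> = t' ^ k * (t ^ k * x)" by (simp only: ac_simps)
        also have "\<dots> = poly p t * (t' ^ k * poly d t)" using that d by (simp add: ac_simps)
        finally show ?thesis unfolding divides_in_def using t'L PL d L.mult_closed by blast
      qed
      ultimately show ?thesis using a b by blast
    qed
    ultimately show ?thesis using PL pP unfolding prime_in_def by blast
  qed
  show ?thesis unfolding factorial_in_def
  proof (intro ballI impI)
    fix x assume x: "x \<in> laurent R t" "x \<noteq> 0"
    then obtain n q where q: "q \<in> polys_over R" "t ^ n * x = poly q t" using rep by blast
    have "x = (t ^ n * t' ^ n) * x" by (simp add: inv_pow)
    also have "\<dots> = t' ^ n * poly q t" using q by (simp add: ac_simps)
    finally have x_eq: "x = t' ^ n * poly q t" .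
    then have "q \<noteq> 0" using x by auto
    then obtain v ps where v: "unit_in (polys_over R) v" "\<forall>p\<in>set ps. prime_in (polys_over R) p" "q = v * prod_list ps"
      using factorial_in_polys_over q by (metis factorial_inE)
    have ps: "poly (prod_list ps) t = prod_list (map (\<lambda>p. poly p t) ps)"
      by (induction ps) auto
    obtain w qs where w: "unit_in (laurent R t) w" "\<forall>p\<in>set qs. prime_in (laurent R t) p"
      "poly (prod_list ps) t = w * prod_list qs"
      using L.unit_or_prime_product[of "map (\<lambda>p. poly p t) ps"] v(2) up unfolding ps by auto
    obtain v' where v': "v \<in> polys_over R" "v' \<in> polys_over R" "v * v' = 1" using v unfolding unit_in_def by blast
    have "poly v t * poly v' t = 1" using arg_cong[OF v'(3), of "\<lambda>q. poly q t"] by simp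
    then have "unit_in (laurent R t) (poly v t)"
      using v' PL unfolding unit_in_def by blast
    moreover have "unit_in (laurent R t) (t' ^ n)"
      unfolding unit_in_def using t'L inv_pow AL generator_in_adjoin adj.power_closed
      by (metis mult.commute subsetD)
    ultimately have "unit_in (laurent R t) (t' ^ n * (poly v t * w))"
      using w by (intro L.unit_in_mult)
    moreover have "x = (t' ^ n * (poly v t * w)) * prod_list qs"
      unfolding x_eq v by (simp add: w ac_simps)
    ultimately show "\<exists>v ps. unit_in (laurent R t) v \<and> (\<forall>p\<in>set ps. prime_in (laurent R t) p) \<and> x = v * prod_list ps"
      using w by blast
  qed
qed

section \<open>Noetherian subrings\<close>

inductive_set lincomb :: "'a::comm_ring_1 set \<Rightarrow> 'a set \<Rightarrow> 'a set" for R Z where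
  zero: "0 \<in> lincomb R Z"
| step: "r \<in> R \<Longrightarrow> z \<in> Z \<Longrightarrow> x \<in> lincomb R Z \<Longrightarrow> r * z + x \<in> lincomb R Z"

definition noetherian_in :: "'a::comm_ring_1 set \<Rightarrow> bool" where
  "noetherian_in R \<longleftrightarrow> (\<forall>Z\<subseteq>R. \<exists>F\<subseteq>Z. finite F \<and> Z \<subseteq> lincomb R F)"

lemma noetherian_inE:
  assumes "noetherian_in R" "Z \<subseteq> R"
  obtains F where "F \<subseteq> Z" "finite F" "Z \<subseteq> lincomb R F"
  using assms unfolding noetherian_in_def by metis

lemma lincomb_add: "x \<in> lincomb R Z \<Longrightarrow> y \<in> lincomb R Z \<Longrightarrow> x + y \<in> lincomb R Z"
  by (induction rule: lincomb.induct) (auto simp: add.assoc intro: lincomb.intros)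

lemma lincomb_minimal:
  assumes "0 \<in> A" "\<And>r z. r \<in> R \<Longrightarrow> z \<in> Z \<Longrightarrow> r * z \<in> A" "\<And>x y. x \<in> A \<Longrightarrow> y \<in> A \<Longrightarrow> x + y \<in> A"
  shows "lincomb R Z \<subseteq> A"
proof
  fix x assume "x \<in> lincomb R Z"
  then show "x \<in> A" by induction (auto intro: assms)
qed

lemma lincomb_mono: "Z \<subseteq> Z' \<Longrightarrow> lincomb R Z \<subseteq> lincomb R Z'"
  by (rule lincomb_minimal) (auto intro: lincomb_add lincomb.intros lincomb.step[where x = 0, simplified])

lemma lincomb_finite_support:
  assumes "x \<in> lincomb R Z" shows "\<exists>F\<subseteq>Z. finite F \<and> x \<in> lincomb R F"
  using assms
proof induction
  case zero
  then show ?case by (intro exI[of _ "{}"]) (auto intro: lincomb.zero)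
next
  case (step r z x)
  then obtain F where F: "F \<subseteq> Z" "finite F" "x \<in> lincomb R F" by blast
  then have "r * z + x \<in> lincomb R (insert z F)"
    using step lincomb_mono[of F "insert z F" R] by (intro lincomb.step) auto
  then show ?case using F step by (intro exI[of _ "insert z F"]) auto
qed

lemma finite_lincomb_finite_support:
  assumes "finite A" "A \<subseteq> lincomb R Z" shows "\<exists>F\<subseteq>Z. finite F \<and> A \<subseteq> lincomb R F"
  using assms
proof (induction A)
  case (insert a A)
  then obtain F where "F \<subseteq> Z" "finite F" "A \<subseteq> lincomb R F" by auto
  moreover obtain G where "G \<subseteq> Z" "finite G" "a \<in> lincomb R G"
    using insert.prems lincomb_finite_support[of a R Z] by auto
  ultimately show ?case
    using lincomb_mono[of F "F \<union> G" R] lincomb_mono[of G "F \<union> G" R]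
    by (intro exI[of _ "F \<union> G"]) auto
qed auto

context subdomain
begin

lemma lincomb_mult:
  assumes "r \<in> R" "x \<in> lincomb R Z" shows "r * x \<in> lincomb R Z"
  using assms(2)
proof induction
  case zero
  then show ?case by (simp add: lincomb.zero)
next
  case (step s z x)
  then show ?case
    using lincomb.step[of "r * s" R z Z "r * x"] assms(1) by (simp add: distrib_left mult_closed mult.assoc)
qed

lemma lincomb_base: "z \<in> Z \<Longrightarrow> z \<in> lincomb R Z"
  using lincomb.step[of 1 R z Z 0] by (simp add: one_closed lincomb.zero)

lemma lincomb_uminus: "x \<in> lincomb R Z \<Longrightarrow> - x \<in> lincomb R Z"
  using lincomb_mult[of "- 1" x Z] by (simp add: uminus_closed one_closed)

lemma lincomb_diff: "x \<in> lincomb R Z \<Longrightarrow> y \<in> lincomb R Z \<Longrightarrow> x - y \<in> lincomb R Z"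
  using lincomb_add[OF _ lincomb_uminus] by fastforce

lemma lincomb_lincomb: "Z' \<subseteq> lincomb R Z \<Longrightarrow> lincomb R Z' \<subseteq> lincomb R Z"
  by (rule lincomb_minimal) (auto intro: lincomb_add lincomb.zero lincomb_mult)

lemma lincomb_subset: "Z \<subseteq> R \<Longrightarrow> lincomb R Z \<subseteq> R"
  by (rule lincomb_minimal) (auto intro: closed)

end

lemma noetherian_in_image:
  assumes noeth: "noetherian_in R"
    and add: "\<And>x y. h (x + y) = h x + h y" and mult: "\<And>x y. h (x * y) = h x * h y"
  shows "noetherian_in (h ` R)"
  unfolding noetherian_in_def
proof (intro allI impI)
  fix Z assume "Z \<subseteq> h ` R"
  then obtain Y where Y: "Y \<subseteq> R" "Z = h ` Y" by (auto simp: subset_image_iff)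
  then obtain F where F: "F \<subseteq> Y" "finite F" "Y \<subseteq> lincomb R F" using noeth unfolding noetherian_in_def by blast
  have "h x \<in> lincomb (h ` R) (h ` F)" if "x \<in> lincomb R F" for x
    using that
  proof induction
    case zero
    have "h 0 = 0" using add[of 0 0] by simp
    then show ?case by (simp add: lincomb.zero)
  qed (auto simp: add mult intro: lincomb.step)
  then show "\<exists>F\<subseteq>Z. finite F \<and> Z \<subseteq> lincomb (h ` R) F"
    using F Y by (intro exI[of _ "h ` F"]) auto
qed

text \<open>
  Hilbert's basis theorem. For each degree, finitely many polynomials suffice to represent the
  leading coefficients in that degree; from some degree on the same ones suffice.
\<close>

lemma (in subdomain) noetherian_in_polys_over:
  assumes noeth: "noetherian_in R"
  shows "noetherian_in (polys_over R)"
  unfolding noetherian_in_def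
proof (intro allI impI)
  interpret polys: subdomain "polys_over R" by (rule subdomain_polys_over)
  fix Z assume Z: "Z \<subseteq> polys_over R"
  define I where "I = lincomb (polys_over R) Z"
  have IP: "I \<subseteq> polys_over R" unfolding I_def by (rule polys.lincomb_subset[OF Z])
  have sel: "\<exists>F\<subseteq>A. finite F \<and> lead_coeff ` A \<subseteq> lincomb R (lead_coeff ` F)" if "A \<subseteq> I" for A
  proof -
    have "lead_coeff ` A \<subseteq> R" using that IP unfolding polys_over_def by auto
    then obtain G where "G \<subseteq> lead_coeff ` A" "finite G" "lead_coeff ` A \<subseteq> lincomb R G"
      using noeth unfolding noetherian_in_def by blast
    then show ?thesis using finite_subset_image[of G lead_coeff A] by metis
  qed
  obtain H where H: "H \<subseteq> I" "finite H" "lead_coeff ` I \<subseteq> lincomb R (lead_coeff ` H)"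
    using sel[of I] by auto
  define m where "m = Max (insert 0 (degree ` H))"
  have Hm: "degree f \<le> m" if "f \<in> H" for f unfolding m_def using H that by auto
  have "\<exists>F\<subseteq>{f \<in> I. degree f = d}. finite F \<and>
      lead_coeff ` {f \<in> I. degree f = d} \<subseteq> lincomb R (lead_coeff ` F)" for d
    by (rule sel) blast
  then have "\<forall>d. \<exists>F. F \<subseteq> {f \<in> I. degree f = d} \<and> finite F \<and>
      lead_coeff ` {f \<in> I. degree f = d} \<subseteq> lincomb R (lead_coeff ` F)"
    by iprover
  from choice[OF this] obtain Fd where "\<forall>d. Fd d \<subseteq> {f \<in> I. degree f = d} \<and> finite (Fd d) \<and>
      lead_coeff ` {f \<in> I. degree f = d} \<subseteq> lincomb R (lead_coeff ` Fd d)" ..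
  then have Fd: "\<And>d. Fd d \<subseteq> {f \<in> I. degree f = d}" "\<And>d. finite (Fd d)"
    "\<And>d. lead_coeff ` {f \<in> I. degree f = d} \<subseteq> lincomb R (lead_coeff ` Fd d)"
    by iprover+
  define F where "F = H \<union> (\<Union>d\<le>m. Fd d)"
  have F: "finite F" "F \<subseteq> I" unfolding F_def using H Fd(2) subsetD[OF Fd(1)] by auto
  have lift: "\<exists>g\<in>lincomb (polys_over R) F. degree g \<le> d \<and> coeff g d = r"
    if "r \<in> lincomb R (lead_coeff ` B)" "B \<subseteq> F" "\<And>f. f \<in> B \<Longrightarrow> degree f \<le> d" for r d B
    using that(1)
  proof induction
    case zero
    then show ?case by (intro bexI[of _ 0]) (auto intro: lincomb.zero)
  next
    case (step r z x)
    then obtain g f where g: "g \<in> lincomb (polys_over R) F" "degree g \<le> d" "coeff g d = x"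
      and f: "f \<in> B" "z = lead_coeff f" by blast
    let ?g = "monom r (d - degree f) * f + g"
    have "degree (monom r (d - degree f) * f) \<le> d"
      using degree_mult_le[of "monom r (d - degree f)" f] degree_monom_le[of r "d - degree f"] that(3)[OF f(1)]
      by linarith
    moreover have "coeff (monom r (d - degree f) * f) d = r * z"
      using coeff_monom_mult[of r "d - degree f" f d] that(3)[OF f(1)] f(2) by simp
    ultimately have "degree ?g \<le> d" "coeff ?g d = r * z + x"
      using g by (auto intro: degree_add_le)
    moreover have "?g \<in> lincomb (polys_over R) F"
      using g f that(2) step by (intro lincomb.step monom_in_polys_over) auto
    ultimately show ?case by blast
  qed
  have "f \<in> lincomb (polys_over R) F" if "f \<in> I" for f
    using that
  proof (induction "if f = 0 then 0 else Suc (degree f)" arbitrary: f rule: less_induct)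
    case less
    show ?case
    proof (cases "f = 0")
      case True
      then show ?thesis by (auto intro: lincomb.zero)
    next
      case False
      have "\<exists>g\<in>lincomb (polys_over R) F. degree g \<le> degree f \<and> coeff g (degree f) = lead_coeff f"
      proof (cases "degree f \<le> m")
        case True
        then show ?thesis using less.prems Fd(1)[of "degree f"] Fd(3)[of "degree f"]
          by (intro lift[of _ "Fd (degree f)"]) (auto simp: F_def)
      next
        case False
        then show ?thesis using less.prems H Hm
          by (intro lift[of _ H]) (force simp: F_def)+
      qed
      then obtain g where g: "g \<in> lincomb (polys_over R) F" "degree g \<le> degree f"
        "coeff g (degree f) = lead_coeff f" by blast
      have "g \<in> I" using g(1) F polys.lincomb_lincomb[of F Z] unfolding I_def by blast
      then have "f - g \<in> I" unfolding I_def using less.prems by (auto simp: I_def intro: polys.lincomb_diff)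
      moreover have "f - g = 0 \<or> degree (f - g) < degree f"
        using g degree_diff_le[of f "degree f" g] leading_coeff_0_iff[of "f - g"]
        by (metis coeff_diff diff_self le_neq_implies_less order_refl)
      ultimately have "f - g \<in> lincomb (polys_over R) F"
        using less.hyps[of "f - g"] False by auto
      then show ?thesis using lincomb_add[OF g(1), of "f - g"] by simp
    qed
  qed
  then have "Z \<subseteq> lincomb (polys_over R) F" using polys.lincomb_base unfolding I_def by blast
  moreover obtain G where G: "G \<subseteq> Z" "finite G" "F \<subseteq> lincomb (polys_over R) G"
    using finite_lincomb_finite_support F unfolding I_def by metis
  ultimately show "\<exists>F\<subseteq>Z. finite F \<and> Z \<subseteq> lincomb (polys_over R) F"
    using polys.lincomb_lincomb[OF G(3)] by blast
qed

lemma (in subdomain) noetherian_in_adjoin: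
  "noetherian_in R \<Longrightarrow> noetherian_in (adjoin R t)"
  unfolding adjoin_def by (rule noetherian_in_image[OF noetherian_in_polys_over]) auto

section \<open>Divisorial ideals of a subring of a field\<close>

text \<open>The prime ideals of a subring, without reference to ring records.\<close>

definition prime_ideal_in :: "'a::comm_ring_1 set \<Rightarrow> 'a set \<Rightarrow> bool" where
  "prime_ideal_in D P \<longleftrightarrow> P \<subseteq> D \<and> 0 \<in> P \<and> 1 \<notin> P \<and> (\<forall>x\<in>P. \<forall>y\<in>P. x + y \<in> P) \<and>
     (\<forall>x\<in>P. \<forall>d\<in>D. d * x \<in> P) \<and> (\<forall>a\<in>D. \<forall>b\<in>D. a * b \<in> P \<longrightarrow> a \<in> P \<or> b \<in> P)"

locale field_subdomain = subdomain D for D :: "'a::field set"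
begin

lemma domain_ring_simps [simp]:
  "carrier (domain_ring D) = D" "x \<otimes>\<^bsub>domain_ring D\<^esub> y = x * y" "x \<oplus>\<^bsub>domain_ring D\<^esub> y = x + y"
  "\<one>\<^bsub>domain_ring D\<^esub> = 1" "\<zero>\<^bsub>domain_ring D\<^esub> = 0"
  unfolding domain_ring_def ring_of_type_algebra_def by simp_all

lemma cring_domain_ring: "cring (domain_ring D)"
proof (intro cringI abelian_groupI comm_monoidI)
  fix x assume "x \<in> carrier (domain_ring D)"
  then show "\<exists>y\<in>carrier (domain_ring D). y \<oplus>\<^bsub>domain_ring D\<^esub> x = \<zero>\<^bsub>domain_ring D\<^esub>"
    using uminus_closed[of x] by (intro bexI[of _ "- x"]) auto
qed (auto simp: algebra_simps intro: closed)

lemma primeideal_iff: "primeideal P (domain_ring D) \<longleftrightarrow> prime_ideal_in D P"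
proof
  assume "primeideal P (domain_ring D)"
  then interpret primeideal P "domain_ring D" .
  have "P \<subseteq> D" using a_subset by simp
  moreover have "1 \<notin> P" using one_imp_carrier I_notcarr by auto
  moreover have "0 \<in> P" using additive_subgroup.zero_closed[OF is_additive_subgroup] by simp
  moreover have "\<forall>x\<in>P. \<forall>y\<in>P. x + y \<in> P" using additive_subgroup.a_closed[OF is_additive_subgroup] by simp
  moreover have "\<forall>x\<in>P. \<forall>d\<in>D. d * x \<in> P" using I_l_closed by simp
  ultimately show "prime_ideal_in D P"
    unfolding prime_ideal_in_def using I_prime by simp
next
  assume P: "prime_ideal_in D P"
  then have "- x \<in> P" if "x \<in> P" for x
    using that uminus_closed[OF one_closed] unfolding prime_ideal_in_def by (metis mult_minus1)
  moreover have "a_inv (domain_ring D) x = - x" if "x \<in> D" for x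
  proof -
    interpret cring "domain_ring D" by (rule cring_domain_ring)
    show ?thesis using that uminus_closed[OF that] by (intro minus_equality) auto
  qed
  ultimately have "subgroup P (add_monoid (domain_ring D))"
    using P abelian_group.a_group[OF ring.is_abelian_group[OF cring.axioms(1)[OF cring_domain_ring]]]
    by (intro group.subgroupI) (auto simp: prime_ideal_in_def a_inv_def)
  then have "ideal P (domain_ring D)"
    using P cring.axioms(1)[OF cring_domain_ring]
    by (intro idealI) (auto simp: prime_ideal_in_def mult.commute)
  then show "primeideal P (domain_ring D)"
    using P cring_domain_ring one_closed by (intro primeidealI) (auto simp: prime_ideal_in_def)
qed

lemma quotient_fieldI: "a \<in> D \<Longrightarrow> b \<in> D \<Longrightarrow> b \<noteq> 0 \<Longrightarrow> a / b \<in> quotient_field D"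
  unfolding quotient_field_def by blast

lemma quotient_fieldE:
  assumes "y \<in> quotient_field D" obtains a b where "a \<in> D" "b \<in> D" "b \<noteq> 0" "y = a / b"
  using assms unfolding quotient_field_def by blast

lemma quotient_field_mult:
  assumes "x \<in> quotient_field D" "y \<in> quotient_field D" shows "x * y \<in> quotient_field D"
proof -
  obtain a b c d where "a \<in> D" "b \<in> D" "b \<noteq> 0" "x = a / b" "c \<in> D" "d \<in> D" "d \<noteq> 0" "y = c / d"
    using assms by (metis quotient_fieldE)
  then have "x * y = (a * c) / (b * d)" "a * c \<in> D" "b * d \<in> D" "b * d \<noteq> 0"
    by (auto intro: mult_closed)
  then show ?thesis using quotient_fieldI by metis
qed

lemma quotient_field_inverse:
  assumes "x \<in> quotient_field D" shows "inverse x \<in> quotient_field D"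
proof (cases "x = 0")
  case True
  then show ?thesis using assms by simp
next
  case False
  obtain a b where *: "a \<in> D" "b \<in> D" "b \<noteq> 0" "x = a / b" using assms by (rule quotient_fieldE)
  then have "inverse x = b / a" "a \<noteq> 0" using False by auto
  then show ?thesis using * quotient_fieldI by simp
qed

lemma subset_quotient_field: "D \<subseteq> quotient_field D"
  using quotient_fieldI[OF _ one_closed] by auto

lemma ideal_inverse_scale:
  assumes y: "y \<in> quotient_field D" "y \<noteq> 0"
  shows "ideal_inverse D ((*) y ` A) = (*) (inverse y) ` ideal_inverse D A"
proof (intro equalityI subsetI)
  fix x assume "x \<in> ideal_inverse D ((*) y ` A)"
  then have "x * y \<in> ideal_inverse D A" "x = inverse y * (x * y)"
    using y quotient_field_mult unfolding ideal_inverse_def by (auto simp: ac_simps)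
  then show "x \<in> (*) (inverse y) ` ideal_inverse D A" by blast
next
  fix x assume "x \<in> (*) (inverse y) ` ideal_inverse D A"
  then obtain z where z: "z \<in> ideal_inverse D A" "x = inverse y * z" by blast
  have xa: "x * (y * a) = z * a" for a unfolding z(2) using y by (simp add: field_simps)
  have "x \<in> quotient_field D"
    unfolding z(2) using z(1) quotient_field_mult quotient_field_inverse[OF y(1)]
    unfolding ideal_inverse_def by blast
  then show "x \<in> ideal_inverse D ((*) y ` A)"
    using z(1) unfolding ideal_inverse_def by (auto simp: xa)
qed

lemma v_closure_scale:
  assumes y: "y \<in> quotient_field D" "y \<noteq> 0"
  shows "v_closure D ((*) y ` A) = (*) y ` v_closure D A"
  unfolding v_closure_def ideal_inverse_scale[OF y]
  using ideal_inverse_scale[of "inverse y"] y quotient_field_inverse by simp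

lemma fractional_v_ideal_scale:
  assumes y: "y \<in> quotient_field D" "y \<noteq> 0" and I: "fractional_v_ideal D I"
  shows "fractional_v_ideal D ((*) y ` I)"
proof -
  obtain c where c: "c \<in> D" "c \<noteq> 0" "(\<lambda>x. c * x) ` I \<subseteq> D" using I unfolding fractional_v_ideal_def by blast
  obtain a b where ab: "a \<in> D" "b \<in> D" "b \<noteq> 0" "y = a / b" using y by (metis quotient_fieldE)
  have "(\<lambda>x. (b * c) * x) ` (*) y ` I \<subseteq> D"
  proof clarify
    fix i assume "i \<in> I"
    then have "a * (c * i) \<in> D" using c ab by (auto intro: mult_closed)
    moreover have "b * c * (y * i) = (b * y) * (c * i)" "b * y = a" using ab by simp_all
    ultimately show "b * c * (y * i) \<in> D" by metis
  qed
  moreover have "b * c \<in> D" "b * c \<noteq> 0" using ab c by (auto intro: mult_closed)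
  moreover have "(*) y ` I \<subseteq> quotient_field D"
    using I y quotient_field_mult unfolding fractional_v_ideal_def by blast
  moreover have "(*) y ` I = v_closure D ((*) y ` I)"
    using I v_closure_scale[OF y, of I] unfolding fractional_v_ideal_def by simp
  ultimately show ?thesis unfolding fractional_v_ideal_def by blast
qed

lemma ideal_productI:
  fixes n :: nat
  assumes "\<And>i. i < n \<Longrightarrow> a i \<in> I \<and> b i \<in> J" shows "(\<Sum>i<n. a i * b i) \<in> ideal_product I J"
  unfolding ideal_product_def
  by (rule CollectI, rule exI[of _ n], rule exI[of _ a], rule exI[of _ b]) (use assms in auto)

lemma ideal_product_cancel:
  assumes "y \<noteq> 0"
  shows "ideal_product ((*) y ` I) ((*) (inverse y) ` J) = ideal_product I J"
proof (intro equalityI subsetI)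
  fix x assume "x \<in> ideal_product ((*) y ` I) ((*) (inverse y) ` J)"
  then obtain a b and n :: nat where x: "x = (\<Sum>i<n. a i * b i)"
    and ab: "\<And>i. i < n \<Longrightarrow> a i \<in> (*) y ` I \<and> b i \<in> (*) (inverse y) ` J"
    unfolding ideal_product_def by blast
  have "x = (\<Sum>i<n. (inverse y * a i) * (y * b i))"
    unfolding x using assms by (intro sum.cong) (auto simp: field_simps)
  moreover have "inverse y * a i \<in> I \<and> y * b i \<in> J" if "i < n" for i
    using ab[OF that] assms by (auto simp flip: mult.assoc)
  ultimately show "x \<in> ideal_product I J" by (simp only: ideal_productI)
next
  fix x assume "x \<in> ideal_product I J"
  then obtain a b and n :: nat where x: "x = (\<Sum>i<n. a i * b i)" and ab: "\<And>i. i < n \<Longrightarrow> a i \<in> I \<and> b i \<in> J"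
    unfolding ideal_product_def by blast
  have "x = (\<Sum>i<n. (y * a i) * (inverse y * b i))"
    unfolding x using assms by (intro sum.cong) (auto simp: field_simps)
  moreover have "y * a i \<in> (*) y ` I \<and> inverse y * b i \<in> (*) (inverse y) ` J" if "i < n" for i
    using ab[OF that] by auto
  ultimately show "x \<in> ideal_product ((*) y ` I) ((*) (inverse y) ` J)"
    by (simp only: ideal_productI)
qed

lemma v_invertible_scale:
  assumes y: "y \<in> quotient_field D" "y \<noteq> 0" and I: "v_invertible D I"
  shows "v_invertible D ((*) y ` I)"
proof -
  obtain J where J: "fractional_v_ideal D J" "v_product D I J = D" using I unfolding v_invertible_def by blast
  have "fractional_v_ideal D ((*) (inverse y) ` J)"
    using y J quotient_field_inverse by (intro fractional_v_ideal_scale) auto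
  moreover have "v_product D ((*) y ` I) ((*) (inverse y) ` J) = D"
    using J y unfolding v_product_def by (simp add: ideal_product_cancel)
  ultimately show ?thesis using I fractional_v_ideal_scale[OF y] unfolding v_invertible_def by blast
qed

text \<open>
  The fourth fact is how invertibility is used: nothing outside \<open>D\<close> multiplies the product of \<open>I\<close> and
  its inverse into \<open>D\<close>, because \<open>1\<close> lies in the closure of this product.
\<close>

lemma v_invertibleD:
  assumes "v_invertible D I"
  defines "J \<equiv> ideal_inverse D I"
  shows "I \<subseteq> quotient_field D" "I = ideal_inverse D J" "\<exists>c\<in>D. c \<noteq> 0 \<and> (*) c ` I \<subseteq> D"
    "\<And>y. y \<in> quotient_field D \<Longrightarrow> (\<And>i j. i \<in> I \<Longrightarrow> j \<in> J \<Longrightarrow> y * (i * j) \<in> D) \<Longrightarrow> y \<in> D"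
    "\<exists>i\<in>I. i \<noteq> 0"
proof -
  show I: "I \<subseteq> quotient_field D" "I = ideal_inverse D J" "\<exists>c\<in>D. c \<noteq> 0 \<and> (*) c ` I \<subseteq> D"
    using assms unfolding v_invertible_def fractional_v_ideal_def v_closure_def by auto
  obtain J' where J': "fractional_v_ideal D J'" "v_closure D (ideal_product I J') = D"
    using assms unfolding v_invertible_def v_product_def by blast
  have J'q: "J' \<subseteq> quotient_field D" using J' unfolding fractional_v_ideal_def by blast
  have "J' \<subseteq> J"
  proof
    fix j assume j: "j \<in> J'"
    have "i * j \<in> D" if "i \<in> I" for i
    proof -
      have "i * j \<in> ideal_product I J'"
        using ideal_productI[of "Suc 0" "\<lambda>_. i" I "\<lambda>_. j" J'] j that by simp
      moreover have "i * j \<in> quotient_field D" using that j I J'q quotient_field_mult by blast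
      ultimately have "i * j \<in> v_closure D (ideal_product I J')"
        unfolding v_closure_def ideal_inverse_def by (auto simp: mult.commute)
      then show ?thesis using J' by simp
    qed
    then show "j \<in> J" unfolding J_def ideal_inverse_def using j J'q by (auto simp: mult.commute)
  qed
  show *: "y \<in> D" if y: "y \<in> quotient_field D" "\<And>i j. i \<in> I \<Longrightarrow> j \<in> J \<Longrightarrow> y * (i * j) \<in> D" for y
  proof -
    have "y \<in> ideal_inverse D (ideal_product I J')"
      using y subsetD[OF \<open>J' \<subseteq> J\<close>] unfolding ideal_inverse_def ideal_product_def
      by (auto simp: sum_distrib_left intro!: sum_closed)
    moreover have "1 \<in> v_closure D (ideal_product I J')" using J' one_closed by simp
    ultimately show ?thesis unfolding v_closure_def ideal_inverse_def by auto
  qed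
  show "\<exists>i\<in>I. i \<noteq> 0"
  proof (rule ccontr)
    assume neg: "\<not> (\<exists>i\<in>I. i \<noteq> 0)"
    then have "quotient_field D \<subseteq> D" using * zero_closed by (metis mult_not_zero subsetI)
    then have "1 \<in> ideal_inverse D J"
      unfolding ideal_inverse_def J_def using subset_quotient_field one_closed by auto
    with neg I(2) show False by auto
  qed
qed

end

section \<open>Divisor classes of a Noetherian domain with a factorial localization\<close>

text \<open>
  In the application \<open>D\<close> is the monoid algebra and \<open>u\<close> is the monomial of an interior element of the
  monoid, so that inverting \<open>u\<close> gives the algebra of the whole quotient group.
\<close>

locale factorial_localization = field_subdomain D for D :: "'a::field set" +
  fixes u :: 'a
  assumes u_in: "u \<in> D" and u_nonzero: "u \<noteq> 0"
    and noetherian: "noetherian_in D"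
    and factorial_localization: "factorial_in {x. \<exists>n. u ^ n * x \<in> D}"
begin

definition L :: "'a set" where
  "L = {x. \<exists>n. u ^ n * x \<in> D}"

lemma L_I: "u ^ n * x \<in> D \<Longrightarrow> x \<in> L"
  unfolding L_def by blast

lemma power_in_D: "u ^ n * x \<in> D \<Longrightarrow> n \<le> m \<Longrightarrow> u ^ m * x \<in> D"
proof -
  assume *: "u ^ n * x \<in> D" "n \<le> m"
  then have "u ^ (m - n) * (u ^ n * x) \<in> D" using u_in by (auto intro: closed)
  moreover have "u ^ (m - n) * (u ^ n * x) = u ^ (m - n + n) * x" by (simp only: power_add mult.assoc)
  ultimately show ?thesis using *(2) by simp
qed

sublocale L: subdomain L
proof
  show "1 \<in> L" using L_I[of 0 1] one_closed by simp
  fix x y assume "x \<in> L" "y \<in> L"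
  then obtain m n where mn: "u ^ m * x \<in> D" "u ^ n * y \<in> D" unfolding L_def by blast
  have "u ^ (m + n) * x - u ^ (m + n) * y \<in> D"
    using power_in_D[OF mn(1), of "m + n"] power_in_D[OF mn(2), of "m + n"] by (simp add: diff_closed)
  then show "x - y \<in> L" by (intro L_I[of "m + n"]) (simp add: algebra_simps)
  have "(u ^ m * x) * (u ^ n * y) \<in> D" using mn by (rule mult_closed)
  then show "x * y \<in> L" by (intro L_I[of "m + n"]) (simp add: algebra_simps power_add)
qed

lemma factorial_L: "factorial_in L"
  using factorial_localization unfolding L_def .

lemma D_subset_L: "D \<subseteq> L"
  using L_I[of 0] by auto

lemma inverse_power_in_L: "inverse u ^ n \<in> L"
  using L_I[of n "inverse u ^ n"] u_nonzero one_closed by (simp flip: power_mult_distrib)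

lemma L_subset_quotient_field: "L \<subseteq> quotient_field D"
proof
  fix x assume "x \<in> L"
  then obtain n where "u ^ n * x \<in> D" unfolding L_def by blast
  moreover have "x = (u ^ n * x) / u ^ n" using u_nonzero by simp
  ultimately show "x \<in> quotient_field D"
    using quotient_fieldI[of "u ^ n * x" "u ^ n"] u_in u_nonzero by (auto intro: power_closed)
qed

text \<open>Write \<open>y\<close> in lowest terms over the factorial ring: a prime of the denominator would divide all of \<open>Z\<close>.\<close>

lemma multiplier_in_L:
  assumes Z: "Z \<subseteq> L" "\<And>p. prime_in L p \<Longrightarrow> \<exists>z\<in>Z. \<not> divides_in L p z"
    and y: "y \<in> quotient_field D" "\<And>z. z \<in> Z \<Longrightarrow> y * z \<in> L"
  shows "y \<in> L"
proof -
  obtain a b where ab: "a \<in> D" "b \<in> D" "b \<noteq> 0" "y = a / b" using y by (metis quotient_fieldE)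
  then have "{a, b} \<subseteq> L" using D_subset_L by auto
  then obtain d where d: "d \<in> L" "d \<noteq> 0" "divides_in L d a" "divides_in L d b"
    "\<And>p. prime_in L p \<Longrightarrow> \<not> divides_in L (p * d) a \<or> \<not> divides_in L (p * d) b"
    using L.gcd_of_set[OF factorial_L, of "{a, b}" b] ab(3) by auto
  then obtain a' b' where a': "a' \<in> L" "a = d * a'" and b': "b' \<in> L" "b = d * b'"
    unfolding divides_in_def by blast
  have b'0: "b' \<noteq> 0" and y_eq: "y * b' = a'" using ab d a' b' by auto
  have "unit_in L b'"
  proof (rule ccontr)
    assume "\<not> unit_in L b'"
    then obtain p where p: "prime_in L p" "divides_in L p b'"
      using L.prime_factor_exists[OF factorial_L b'(1) b'0] by blast
    have "\<not> divides_in L p a'"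
    proof
      assume "divides_in L p a'"
      with p(2) have "divides_in L (p * d) a \<and> divides_in L (p * d) b"
        unfolding divides_in_def a'(2) b'(2) by (metis mult.assoc mult.commute)
      then show False using d(5) p by blast
    qed
    moreover have "divides_in L p a' \<or> divides_in L p z" if z: "z \<in> Z" for z
    proof -
      have "a' * z = b' * (y * z)" by (simp flip: y_eq)
      then have "divides_in L p (a' * z)"
        using L.divides_in_mult_right[OF p(2) y(2)[OF z]] by metis
      then show ?thesis using p(1) a'(1) z Z(1) unfolding prime_in_def by blast
    qed
    ultimately show False using Z(2)[OF p(1)] by blast
  qed
  then obtain w where w: "w \<in> L" "b' * w = 1" unfolding unit_in_def by blast
  have "y = (y * b') * w" using w by (simp add: mult.assoc)
  then show ?thesis using y_eq a'(1) w(1) L.mult_closed by simp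
qed

text \<open>A fractional ideal inside \<open>L\<close> is finitely generated, so one power of \<open>u\<close> clears all denominators.\<close>

lemma uniform_denominator:
  assumes "Z \<subseteq> L" "c \<in> D" "c \<noteq> 0" "(*) c ` Z \<subseteq> D"
  shows "\<exists>N. \<forall>z\<in>Z. u ^ N * z \<in> D"
proof -
  obtain G where G: "G \<subseteq> (*) c ` Z" "finite G" "(*) c ` Z \<subseteq> lincomb D G"
    using noetherian_inE[OF noetherian assms(4)] .
  then obtain F where F: "F \<subseteq> Z" "finite F" "G = (*) c ` F" using finite_subset_image by metis
  have "\<forall>z\<in>F. \<exists>n. u ^ n * z \<in> D" using F(1) assms(1) unfolding L_def by blast
  then obtain n where n: "\<And>z. z \<in> F \<Longrightarrow> u ^ n z * z \<in> D" by metis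
  define N where "N = Max (insert 0 (n ` F))"
  have N: "u ^ N * z \<in> D" if "z \<in> F" for z
    by (rule power_in_D[OF n[OF that]]) (simp add: N_def F(2) that)
  have "lincomb D G \<subseteq> {x. u ^ N * (x / c) \<in> D}"
  proof (rule lincomb_minimal)
    fix r g assume r: "r \<in> D" "g \<in> G"
    then obtain z where z: "z \<in> F" "g = c * z" using F(3) by blast
    have "r * (u ^ N * z) \<in> D" using N[OF z(1)] r(1) by (rule mult_closed[rotated])
    moreover have "u ^ N * (r * g / c) = r * (u ^ N * z)" using assms(3) z(2) by simp
    ultimately show "r * g \<in> {x. u ^ N * (x / c) \<in> D}" by simp
  qed (auto simp: zero_closed add_divide_distrib distrib_left intro: add_closed)
  then have "\<forall>z\<in>Z. u ^ N * z \<in> D" using G(3) assms(3) by fastforce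
  then show ?thesis ..
qed

subsection \<open>Associated primes of the denominator\<close>

text \<open>
  The annihilator of the residue class of \<open>z\<close> modulo \<open>u D\<close>. The maximal ones among the annihilators of
  nonzero classes are prime. Together they detect whether an ideal that contains a power of \<open>u\<close> has the
  trivial closure \<open>D\<close>.
\<close>

definition ann :: "'a \<Rightarrow> 'a set" where
  "ann z = {d \<in> D. d * z \<in> (*) u ` D}"

lemma uD_add: "x \<in> (*) u ` D \<Longrightarrow> y \<in> (*) u ` D \<Longrightarrow> x + y \<in> (*) u ` D"
  by (auto simp flip: distrib_left intro: add_closed)

lemma uD_mult: "d \<in> D \<Longrightarrow> x \<in> (*) u ` D \<Longrightarrow> d * x \<in> (*) u ` D"
  by (auto simp: mult.left_commute intro!: imageI mult_closed)

lemma ann_add: "x \<in> ann z \<Longrightarrow> y \<in> ann z \<Longrightarrow> x + y \<in> ann z"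
  unfolding ann_def by (auto simp: distrib_right intro: closed uD_add)

lemma ann_mult: "d \<in> D \<Longrightarrow> x \<in> ann z \<Longrightarrow> d * x \<in> ann z"
  unfolding ann_def by (auto simp: mult.assoc intro: closed uD_mult)

lemma u_in_ann: "z \<in> D \<Longrightarrow> u \<in> ann z"
  unfolding ann_def using u_in by auto

lemma zero_in_ann: "z \<in> D \<Longrightarrow> 0 \<in> ann z"
  using ann_mult[OF zero_closed u_in_ann] by simp

definition associated_prime :: "'a set \<Rightarrow> bool" where
  "associated_prime M \<longleftrightarrow> (\<exists>z\<in>D. z \<notin> (*) u ` D \<and> M = ann z) \<and>
     (\<forall>z\<in>D. z \<notin> (*) u ` D \<longrightarrow> M \<subseteq> ann z \<longrightarrow> ann z = M)"

text \<open>
  The union of a chain of annihilators is finitely generated, hence equal to a member of the chain.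
\<close>

lemma associated_prime_exists:
  assumes z0: "z0 \<in> D" "z0 \<notin> (*) u ` D"
  shows "\<exists>M. associated_prime M \<and> ann z0 \<subseteq> M"
proof -
  define A where "A = {ann z |z. z \<in> D \<and> z \<notin> (*) u ` D \<and> ann z0 \<subseteq> ann z}"
  have "\<exists>M\<in>A. \<forall>N\<in>A. M \<subseteq> N \<longrightarrow> N = M"
  proof (rule subset_Zorn_nonempty)
    show "A \<noteq> {}" unfolding A_def using z0 by blast
    fix C :: "'a set set" assume C: "C \<noteq> {}" "subset.chain A C"
    then have CA: "C \<subseteq> A" by (simp add: subset_chain_def)
    then have "\<Union>C \<subseteq> D" unfolding A_def ann_def by blast
    then obtain F where F: "F \<subseteq> \<Union>C" "finite F" "\<Union>C \<subseteq> lincomb D F"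
      by (rule noetherian_inE[OF noetherian])
    obtain B where B: "B \<in> C" "F \<subseteq> B" by (rule finite_subset_Union_chain[OF F(2,1) C])
    then obtain z where z: "z \<in> D" "B = ann z" using CA unfolding A_def by blast
    have "lincomb D F \<subseteq> B"
      using B(2) z ann_add ann_mult zero_in_ann by (intro lincomb_minimal) auto
    then have "\<Union>C = B" using F B by blast
    then show "\<Union>C \<in> A" using B CA by blast
  qed
  then obtain M where MA: "M \<in> A" and max: "\<And>N. N \<in> A \<Longrightarrow> M \<subseteq> N \<Longrightarrow> N = M" by blast
  then obtain z where z: "z \<in> D" "z \<notin> (*) u ` D" "ann z0 \<subseteq> M" "M = ann z" unfolding A_def by blast
  have "ann w = M" if "w \<in> D" "w \<notin> (*) u ` D" "M \<subseteq> ann w" for w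
    using that z(3) by (intro max) (auto simp: A_def)
  then show ?thesis using z unfolding associated_prime_def by metis
qed

lemma associated_primeD:
  assumes M: "associated_prime M"
  shows "M \<subseteq> D" "u \<in> M" "1 \<notin> M" "\<And>x y. x \<in> M \<Longrightarrow> y \<in> M \<Longrightarrow> x + y \<in> M"
    "\<And>d x. d \<in> D \<Longrightarrow> x \<in> M \<Longrightarrow> d * x \<in> M"
    "\<And>a b. a \<in> D \<Longrightarrow> b \<in> D \<Longrightarrow> a * b \<in> M \<Longrightarrow> a \<in> M \<or> b \<in> M"
proof -
  obtain z where z: "z \<in> D" "z \<notin> (*) u ` D" "M = ann z" using M unfolding associated_prime_def by blast
  show "M \<subseteq> D" "1 \<notin> M" using z unfolding ann_def by auto
  show "u \<in> M" using z u_in_ann by blast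
  show "x + y \<in> M" if "x \<in> M" "y \<in> M" for x y using that z ann_add by blast
  show "d * x \<in> M" if "d \<in> D" "x \<in> M" for d x using that z ann_mult by blast
  show "a \<in> M \<or> b \<in> M" if ab: "a \<in> D" "b \<in> D" "a * b \<in> M" for a b
  proof (rule ccontr)
    assume neg: "\<not> (a \<in> M \<or> b \<in> M)"
    then have bz: "b * z \<in> D" "b * z \<notin> (*) u ` D" using ab z unfolding ann_def by (auto intro: closed)
    have "M \<subseteq> ann (b * z)"
    proof
      fix x assume "x \<in> M"
      then have "x \<in> D" "b * (x * z) \<in> (*) u ` D" using uD_mult[OF ab(2)] unfolding z(3) ann_def by auto
      then show "x \<in> ann (b * z)" unfolding ann_def by (simp add: mult.left_commute)
    qed
    then have "ann (b * z) = M" using M bz unfolding associated_prime_def by blast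
    moreover have "a \<in> ann (b * z)" using ab z unfolding ann_def by (auto simp: mult.assoc)
    ultimately show False using neg by blast
  qed
qed

lemma associated_prime_subset:
  "associated_prime M \<Longrightarrow> associated_prime M' \<Longrightarrow> M \<subseteq> M' \<Longrightarrow> M = M'"
  unfolding associated_prime_def by blast

lemma prod_not_in_associated_prime:
  assumes "associated_prime M" "finite A" "\<And>x. x \<in> A \<Longrightarrow> f x \<in> D \<and> f x \<notin> M"
  shows "prod f A \<in> D \<and> prod f A \<notin> M"
  using assms(2,3)
proof (induction A)
  case (insert x A)
  then show ?case using associated_primeD(6)[OF assms(1), of "f x" "prod f A"]
    by (auto intro: closed)
qed (use associated_primeD(3)[OF assms(1)] in \<open>auto intro: closed\<close>)

lemma prod_in_associated_prime:
  assumes "associated_prime M" "finite A" "\<And>x. x \<in> A \<Longrightarrow> f x \<in> D" "a \<in> A" "f a \<in> M"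
  shows "prod f A \<in> M"
proof -
  have "prod f A = prod f (A - {a}) * f a" using assms by (simp add: prod.remove mult.commute)
  moreover have "prod f B \<in> D" if "B \<subseteq> A" for B
    using that assms(3) by (induction B rule: infinite_finite_induct) (auto intro: closed)
  then have "prod f (A - {a}) \<in> D" by blast
  ultimately show ?thesis using associated_primeD(5)[OF assms(1) _ assms(5)] by metis
qed

text \<open>
  Finitely many elements \<open>z\<close> with maximal \<open>ann z\<close> generate all of them modulo \<open>u\<close>. An element that
  annihilates these finitely many annihilates all the others, so their primes are the only ones.
\<close>

lemma finite_associated_primes: "finite (Collect associated_prime)"
proof -
  define Z where "Z = {z \<in> D. z \<notin> (*) u ` D \<and> associated_prime (ann z)}"
  have "insert u Z \<subseteq> D" unfolding Z_def using u_in by auto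
  then obtain F where F: "F \<subseteq> insert u Z" "finite F" "insert u Z \<subseteq> lincomb D F"
    by (rule noetherian_inE[OF noetherian])
  have "M \<in> ann ` (F \<inter> Z)" if M: "associated_prime M" for M
  proof -
    obtain z where z: "z \<in> D" "z \<notin> (*) u ` D" "M = ann z" using M unfolding associated_prime_def by blast
    then have "z \<in> lincomb D F" using F(3) M unfolding Z_def by blast
    have "\<exists>f\<in>F \<inter> Z. ann f \<subseteq> M"
    proof (rule ccontr)
      assume "\<not> ?thesis"
      then have "\<forall>f\<in>F \<inter> Z. \<exists>d. d \<in> ann f \<and> d \<notin> M" by blast
      then obtain d where d: "\<And>f. f \<in> F \<inter> Z \<Longrightarrow> d f \<in> ann f \<and> d f \<notin> M" by metis
      then have dD: "\<And>f. f \<in> F \<inter> Z \<Longrightarrow> d f \<in> D" unfolding ann_def by blast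
      let ?e = "prod d (F \<inter> Z)"
      have e: "?e \<in> D \<and> ?e \<notin> M"
        using d dD F(2) by (intro prod_not_in_associated_prime[OF M]) auto
      have "?e \<in> ann f" if "f \<in> F \<inter> Z" for f
        using that d dD F(2) unfolding Z_def by (intro prod_in_associated_prime) auto
      then have eF: "?e * f \<in> (*) u ` D" if "f \<in> F" for f
      proof (cases "f \<in> Z")
        case True
        with that \<open>\<And>f. f \<in> F \<inter> Z \<Longrightarrow> ?e \<in> ann f\<close> show ?thesis unfolding ann_def by blast
      next
        case False
        then have "f = u" using that F(1) by blast
        then have "?e * f = u * ?e" by (simp add: mult.commute)
        then show ?thesis using e by blast
      qed
      have "lincomb D F \<subseteq> {x. ?e * x \<in> (*) u ` D}"
      proof (rule lincomb_minimal)
        show "0 \<in> {x. ?e * x \<in> (*) u ` D}" by (auto intro!: image_eqI[of _ _ 0] closed)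
        show "r * z \<in> {x. ?e * x \<in> (*) u ` D}" if "r \<in> D" "z \<in> F" for r z
          using uD_mult[OF that(1) eF[OF that(2)]] by (simp add: mult.left_commute)
        show "x + y \<in> {x. ?e * x \<in> (*) u ` D}" if "x \<in> {x. ?e * x \<in> (*) u ` D}" "y \<in> {x. ?e * x \<in> (*) u ` D}" for x y
          using that uD_add[of "?e * x" "?e * y"] by (simp add: distrib_left)
      qed
      then have "?e \<in> M" using \<open>z \<in> lincomb D F\<close> e unfolding z(3) ann_def by blast
      then show False using e by blast
    qed
    then obtain f where f: "f \<in> F \<inter> Z" "ann f \<subseteq> M" by blast
    then have "ann f = M" using associated_prime_subset[OF _ M] unfolding Z_def by simp
    then show ?thesis using f by blast
  qed
  then have "Collect associated_prime \<subseteq> ann ` (F \<inter> Z)" by blast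
  moreover have "finite (ann ` (F \<inter> Z))" using F(2) by simp
  ultimately show ?thesis by (rule finite_subset)
qed

text \<open>
  Prime avoidance. As the associated primes are incomparable, for each \<open>M\<close> some element \<open>e M\<close> lies in all
  the others but not in \<open>M\<close>. If \<open>j M\<close> avoids \<open>M\<close>, then the sum of all \<open>e M * j M\<close> avoids every \<open>M\<close>.
\<close>

lemma avoid_associated_primes:
  assumes IJ: "\<And>i j. i \<in> I \<Longrightarrow> j \<in> J \<Longrightarrow> i * j \<in> D"
    and J: "0 \<in> J" "\<And>x y. x \<in> J \<Longrightarrow> y \<in> J \<Longrightarrow> x + y \<in> J" "\<And>d x. d \<in> D \<Longrightarrow> x \<in> J \<Longrightarrow> d * x \<in> J"
    and ex: "\<And>M. associated_prime M \<Longrightarrow> \<exists>i\<in>I. \<exists>j\<in>J. i * j \<notin> M"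
  shows "\<exists>x\<in>J. \<forall>M. associated_prime M \<longrightarrow> (\<exists>i\<in>I. i * x \<notin> M)"
proof -
  let ?A = "Collect associated_prime"
  obtain i j where ij: "\<And>M. associated_prime M \<Longrightarrow> i M \<in> I \<and> j M \<in> J \<and> i M * j M \<notin> M"
    using ex by metis
  have "\<exists>t. t \<in> M' \<and> t \<notin> M" if "associated_prime M" "associated_prime M'" "M \<noteq> M'" for M M'
    using associated_prime_subset[OF that(2,1)] that(3) by auto
  then obtain t where t: "\<And>M M'. associated_prime M \<Longrightarrow> associated_prime M' \<Longrightarrow> M \<noteq> M' \<Longrightarrow> t M M' \<in> M' \<and> t M M' \<notin> M"
    by metis
  define e where "e M = prod (t M) (?A - {M})" for M
  have e: "e M \<in> D \<and> e M \<notin> M" if M: "associated_prime M" for M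
    unfolding e_def using t[OF M] finite_associated_primes associated_primeD(1)
    by (intro prod_not_in_associated_prime[OF M]) auto
  have e': "e M \<in> M'" if M: "associated_prime M" "associated_prime M'" "M \<noteq> M'" for M M'
    unfolding e_def using t[OF M(1)] finite_associated_primes associated_primeD(1) M
    by (intro prod_in_associated_prime[of _ _ _ M']) auto
  define x where "x = (\<Sum>M\<in>?A. e M * j M)"
  have sumJ: "sum f A \<in> J" if "\<And>M. M \<in> A \<Longrightarrow> f M \<in> J" for f :: "'a set \<Rightarrow> 'a" and A
    using that J by (induction A rule: infinite_finite_induct) auto
  have "x \<in> J" unfolding x_def
  proof (rule sumJ)
    fix M assume "M \<in> ?A"
    then show "e M * j M \<in> J" using e[of M] ij[of M] J(3) by simp
  qed
  have avoid: "i M * x \<notin> M" if M: "associated_prime M" for M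
  proof
    assume x: "i M * x \<in> M"
    let ?s = "\<Sum>M'\<in>?A - {M}. e M' * (i M * j M')"
    have M0: "0 \<in> M" using associated_primeD(5)[OF M zero_closed associated_primeD(2)[OF M]] by simp
    have sumM: "sum f A \<in> M" if "\<And>M'. M' \<in> A \<Longrightarrow> f M' \<in> M" for f :: "'a set \<Rightarrow> 'a" and A
      using that associated_primeD(4)[OF M] M0
      by (induction A rule: infinite_finite_induct) auto
    have "e M' * (i M * j M') \<in> M" if "M' \<in> ?A - {M}" for M'
      using associated_primeD(5)[OF M, of "i M * j M'" "e M'"] that e'[of M' M] M IJ ij
      by (auto simp: mult.commute)
    then have s: "?s \<in> M" by (rule sumM)
    have "i M * x = e M * (i M * j M) + ?s"
      unfolding x_def using M finite_associated_primes
      by (simp add: sum.remove[of ?A M] distrib_left sum_distrib_left mult.left_commute)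
    then have "e M * (i M * j M) = i M * x + (- 1) * ?s" by simp
    also have "\<dots> \<in> M" using x s associated_primeD(4,5)[OF M] uminus_closed[OF one_closed] by blast
    finally have "e M * (i M * j M) \<in> M" .
    then show False
      using associated_primeD(6)[OF M, of "e M" "i M * j M"] e[OF M] ij[OF M] IJ[of "i M" "j M"] by simp
  qed
  show ?thesis using \<open>x \<in> J\<close>
  proof (rule bexI[rotated], intro allI impI)
    fix M assume "associated_prime M"
    then show "\<exists>i\<in>I. i * x \<notin> M" using avoid ij by (intro bexI[of _ "i M"]) auto
  qed
qed

end

context factorial_localization
begin

text \<open>
  If \<open>w\<close> were not in \<open>D\<close>, then some \<open>u\<^sup>s * w\<close> would be the last one outside \<open>D\<close>. The elements of
  \<open>A\<close> multiply \<open>u\<^sup>s\<^sup>+\<^sup>1 * w\<close> into \<open>u D\<close>, so that they would all lie in a single associated prime.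
\<close>

lemma multiplier_in_D:
  assumes A: "A \<subseteq> D" "\<And>M. associated_prime M \<Longrightarrow> \<exists>a\<in>A. a \<notin> M"
    and w: "w \<in> L" "\<And>a. a \<in> A \<Longrightarrow> w * a \<in> D"
  shows "w \<in> D"
proof (rule ccontr)
  assume "w \<notin> D"
  define N where "N = (LEAST n. u ^ n * w \<in> D)"
  have ex: "\<exists>n. u ^ n * w \<in> D" using w(1) unfolding L_def by blast
  have N: "u ^ N * w \<in> D" "\<And>n. n < N \<Longrightarrow> u ^ n * w \<notin> D"
    using LeastI_ex[OF ex] not_less_Least unfolding N_def by blast+
  have "N \<noteq> 0" using N(1) \<open>w \<notin> D\<close> by (metis mult_1 power_0)
  then obtain s where s: "N = Suc s" by (cases N) auto
  have not_uD: "u ^ N * w \<notin> (*) u ` D"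
  proof
    assume "u ^ N * w \<in> (*) u ` D"
    then have "u ^ s * w \<in> D" using u_nonzero unfolding s by auto
    then show False using N(2)[of s] s by simp
  qed
  then obtain M where M: "associated_prime M" "ann (u ^ N * w) \<subseteq> M"
    using associated_prime_exists[OF N(1)] by blast
  have "a \<in> ann (u ^ N * w)" if a: "a \<in> A" for a
  proof -
    have "u ^ s * (w * a) \<in> D" using w(2)[OF a] u_in by (auto intro: closed)
    moreover have "a * (u ^ N * w) = u * (u ^ s * (w * a))" by (simp add: s ac_simps)
    ultimately have "a * (u ^ N * w) \<in> (*) u ` D" by (simp only: imageI)
    then show ?thesis using a A(1) unfolding ann_def by blast
  qed
  then show False using A(2)[OF M(1)] M(2) by blast
qed

text \<open>
  If \<open>M = ann z\<close> contained the product of \<open>I\<close> and its inverse, then \<open>z / u\<close> would multiply this product into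
  \<open>D\<close> without being in \<open>D\<close>.
\<close>

lemma v_invertible_avoids_associated_primes:
  assumes I: "v_invertible D I" and M: "associated_prime M"
  shows "\<exists>i\<in>I. \<exists>j\<in>ideal_inverse D I. i * j \<notin> M"
proof (rule ccontr)
  assume "\<not> ?thesis"
  then have neg: "\<And>i j. i \<in> I \<Longrightarrow> j \<in> ideal_inverse D I \<Longrightarrow> i * j \<in> M" by blast
  obtain z where z: "z \<in> D" "z \<notin> (*) u ` D" "M = ann z" using M unfolding associated_prime_def by blast
  have "z / u * (i * j) \<in> D" if ij: "i \<in> I" "j \<in> ideal_inverse D I" for i j
  proof -
    obtain d where d: "d \<in> D" "i * j * z = u * d" using neg[OF ij] unfolding z(3) ann_def by blast
    then have "z / u * (i * j) = d" using u_nonzero by (simp add: field_simps)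
    then show ?thesis using d by simp
  qed
  then have "z / u \<in> D" using v_invertibleD(4)[OF I] quotient_fieldI[OF z(1) u_in u_nonzero] by blast
  then have "z \<in> (*) u ` D" using u_nonzero by (intro image_eqI[of _ _ "z / u"]) auto
  with z show False by blast
qed

lemma power_divides_all_imp_zero:
  assumes h: "prime_in L h" and q: "q \<in> L" "\<And>k. divides_in L (h ^ k) q"
  shows "q = 0"
proof (rule ccontr)
  assume "q \<noteq> 0"
  then obtain v ps where v: "unit_in L v" "\<forall>p\<in>set ps. prime_in L p" "q = v * prod_list ps"
    using factorial_L q(1) by (metis factorial_inE)
  have "h ^ k = prod_list (replicate k h)" for k by (induction k) auto
  then have "length (replicate (Suc (length ps)) h) \<le> length ps"
    using q(2)[of "Suc (length ps)"] v h by (intro L.prime_list_length_le) auto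
  then show False by simp
qed

lemma prime_ideal_in_contraction:
  assumes h: "prime_in L h"
  shows "prime_ideal_in D ((*) h ` L \<inter> D)"
proof -
  have 1: "1 \<notin> (*) h ` L" using h unfolding prime_in_def unit_in_def by auto
  have "a \<in> (*) h ` L \<or> b \<in> (*) h ` L" if "a \<in> D" "b \<in> D" "a * b \<in> (*) h ` L" for a b
  proof -
    have "x \<in> (*) h ` L \<longleftrightarrow> divides_in L h x" for x unfolding divides_in_def by auto
    then show ?thesis using that h subsetD[OF D_subset_L] unfolding prime_in_def by simp
  qed
  moreover have "x + y \<in> (*) h ` L" if "x \<in> (*) h ` L" "y \<in> (*) h ` L" for x y
    using that by (auto simp flip: distrib_left intro: L.add_closed)
  moreover have "d * x \<in> (*) h ` L" if "x \<in> (*) h ` L" "d \<in> D" for d x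
    using that D_subset_L by (auto simp: mult.left_commute intro!: imageI L.mult_closed)
  moreover have "0 \<in> (*) h ` L" by (auto intro!: image_eqI[of _ _ 0] L.zero_closed)
  ultimately show ?thesis unfolding prime_ideal_in_def using 1 by (auto intro: closed)
qed

text \<open>
  The contraction of \<open>h L\<close> has height one: the elements of a smaller prime ideal \<open>Q\<close> can be divided by
  \<open>h\<close> again and again without leaving \<open>Q\<close>, up to powers of \<open>u\<close>.
\<close>

lemma contraction_minimal:
  assumes h: "prime_in L h" and Q: "prime_ideal_in D Q" "Q \<subset> (*) h ` L \<inter> D"
  shows "Q = {0}"
proof -
  have mult: "\<And>d x. d \<in> D \<Longrightarrow> x \<in> Q \<Longrightarrow> d * x \<in> Q"
    and prime: "\<And>a b. a \<in> D \<Longrightarrow> b \<in> D \<Longrightarrow> a * b \<in> Q \<Longrightarrow> a \<in> Q \<or> b \<in> Q"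
    using Q(1) unfolding prime_ideal_in_def by blast+
  have hL: "h \<in> L" and nu: "\<not> unit_in L h" using h unfolding prime_in_def by auto
  have "u ^ n \<notin> Q" for n
  proof
    assume "u ^ n \<in> Q"
    then obtain l where l: "l \<in> L" "u ^ n = h * l" using Q(2) by blast
    have "h * (l * inverse u ^ n) = u ^ n * inverse u ^ n" using l by (simp add: mult.assoc)
    also have "\<dots> = 1" using u_nonzero by (simp flip: power_mult_distrib)
    finally show False
      using nu hL L.mult_closed[OF l(1) inverse_power_in_L] unfolding unit_in_def by blast
  qed
  then have cancel: "x \<in> Q" if "x \<in> D" "u ^ n * x \<in> Q" for n x
    using prime[OF power_closed[OF u_in] that] by blast
  obtain n where n: "u ^ n * h \<in> D" using hL unfolding L_def by blast
  have nQ: "u ^ n * h \<notin> Q"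
  proof
    assume "u ^ n * h \<in> Q"
    have "x \<in> Q" if x: "x \<in> (*) h ` L \<inter> D" for x
    proof -
      obtain l where l: "l \<in> L" "x = h * l" using x by blast
      obtain m where m: "u ^ m * l \<in> D" using l unfolding L_def by blast
      have "u ^ (n + m) * x = (u ^ m * l) * (u ^ n * h)" by (simp add: l power_add ac_simps)
      then have "u ^ (n + m) * x \<in> Q" using mult[OF m \<open>u ^ n * h \<in> Q\<close>] by simp
      then show ?thesis using cancel x by blast
    qed
    then show False using Q(2) by blast
  qed
  have "\<forall>q\<in>Q. divides_in L (h ^ k) q" for k
  proof (induction k)
    case 0
    then show ?case using Q(2) D_subset_L unfolding divides_in_def by auto
  next
    case (Suc k)
    show ?case
    proof
      fix q assume q: "q \<in> Q"
      then obtain l where l: "l \<in> L" "q = h * l" using Q(2) by blast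
      obtain m where m: "u ^ m * l \<in> D" using l unfolding L_def by blast
      have "(u ^ n * h) * (u ^ m * l) = u ^ (n + m) * q" by (simp add: l power_add ac_simps)
      also have "\<dots> \<in> Q" using q mult u_in power_closed by blast
      finally have "u ^ m * l \<in> Q" using prime[OF n m] nQ by blast
      then obtain r where r: "r \<in> L" "u ^ m * l = h ^ k * r" using Suc unfolding divides_in_def by blast
      have "l = inverse u ^ m * (u ^ m * l)"
        using u_nonzero by (simp flip: mult.assoc power_mult_distrib)
      then have "q = h ^ Suc k * (inverse u ^ m * r)" unfolding l(2) r(2) by (simp add: ac_simps)
      then show "divides_in L (h ^ Suc k) q"
        unfolding divides_in_def using L.mult_closed[OF inverse_power_in_L r(1)] by blast
    qed
  qed
  then have "q = 0" if "q \<in> Q" for q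
    using power_divides_all_imp_zero[OF h] that Q(2) D_subset_L by blast
  then show ?thesis using Q(1) unfolding prime_ideal_in_def by blast
qed

lemma height_contraction:
  assumes h: "prime_in L h"
  shows "height D ((*) h ` L \<inter> D) = 1"
proof -
  let ?P = "(*) h ` L \<inter> D"
  let ?chain = "\<lambda>n Q. (\<forall>i\<le>n. primeideal (Q i) (domain_ring D)) \<and> (\<forall>i<n. Q i \<subset> Q (Suc i)) \<and> Q n = ?P"
  have zero: "prime_ideal_in D {0}" unfolding prime_ideal_in_def by (auto intro: closed)
  obtain n where n: "u ^ n * h \<in> D" "u ^ n * h \<noteq> 0"
    using h u_nonzero unfolding prime_in_def L_def by auto
  have "u ^ n \<in> L" using u_in D_subset_L power_closed by blast
  then have "h * u ^ n \<in> (*) h ` L" by (rule imageI)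
  then have "u ^ n * h \<in> ?P" using n(1) by (simp only: mult.commute Int_iff)
  then have "{0} \<subset> ?P" using n prime_ideal_in_contraction[OF h] unfolding prime_ideal_in_def by blast
  then have "?chain 1 (\<lambda>i. if i = 0 then {0} else ?P)"
    using zero prime_ideal_in_contraction[OF h] by (auto simp: primeideal_iff)
  then have "\<exists>Q. ?chain 1 Q" by (rule exI[of "?chain 1"])
  then have "enat 1 \<in> {enat n |n. \<exists>Q. ?chain n Q}" by (intro CollectI exI[of _ 1] conjI refl)
  then have "enat 1 \<le> height D ?P" unfolding height_def by (rule Sup_upper)
  moreover have "height D ?P \<le> enat 1" unfolding height_def
  proof (rule Sup_least, clarify)
    fix m Q assume Q: "\<forall>i\<le>m. primeideal (Q i) (domain_ring D)" "\<forall>i<m. Q i \<subset> Q (Suc i)" "Q m = ?P"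
    show "enat m \<le> enat 1"
    proof (rule ccontr)
      assume "\<not> enat m \<le> enat 1"
      then obtain k where k: "m = Suc (Suc k)" by (metis One_nat_def Suc_le_eq enat_ord_simps(1) less_Suc_eq_le not0_implies_Suc not_less zero_less_Suc le0 le_SucI)
      have "Q (Suc k) \<subset> ?P" "prime_ideal_in D (Q (Suc k))"
        using Q(1) Q(2)[rule_format, of "Suc k"] Q(3) k primeideal_iff by auto
      then have "Q (Suc k) = {0}" using contraction_minimal[OF h] by blast
      moreover have "Q k \<subset> Q (Suc k)" using Q(2) k by simp
      moreover have "0 \<in> Q k" using Q(1) k primeideal_iff[of "Q k"] unfolding prime_ideal_in_def by simp
      ultimately have "Q k \<subset> {0}" "0 \<in> Q k" by simp_all
      then show False by (metis empty_iff psubset_eq subset_singletonD)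
    qed
  qed
  ultimately show ?thesis by (simp add: one_enat_def)
qed

text \<open>
  A scaled copy of \<open>I\<close> lies in \<open>L\<close> without a common prime factor there; then \<open>I\<close> and its inverse
  both contain a power of \<open>u\<close>.
\<close>

lemma v_invertible_normalize:
  assumes I: "v_invertible D I"
  shows "\<exists>y\<in>quotient_field D. y \<noteq> 0 \<and> (*) y ` I \<subseteq> L \<and> ideal_inverse D ((*) y ` I) \<subseteq> L \<and>
           (\<exists>m. u ^ m \<in> (*) y ` I \<and> u ^ m \<in> ideal_inverse D ((*) y ` I))"
proof -
  obtain c where c: "c \<in> D" "c \<noteq> 0" "(*) c ` I \<subseteq> D" using v_invertibleD(3)[OF I] by blast
  obtain i where i: "i \<in> I" "i \<noteq> 0" using v_invertibleD(5)[OF I] by blast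
  have "(*) c ` I \<subseteq> L" using c D_subset_L by blast
  then obtain d where d: "d \<in> L" "d \<noteq> 0" "\<forall>z\<in>(*) c ` I. divides_in L d z"
    "\<And>p. prime_in L p \<Longrightarrow> \<exists>z\<in>(*) c ` I. \<not> divides_in L (p * d) z"
    using L.gcd_of_set[OF factorial_L, of "(*) c ` I" "c * i"] i c by auto
  define y where "y = c * inverse d"
  have y: "y \<in> quotient_field D" "y \<noteq> 0"
    using c d subsetD[OF subset_quotient_field c(1)] subsetD[OF L_subset_quotient_field d(1)]
    unfolding y_def by (auto intro: quotient_field_mult quotient_field_inverse)
  define I' where "I' = (*) y ` I"
  define J where "J = ideal_inverse D I'"
  have I': "v_invertible D I'" unfolding I'_def by (rule v_invertible_scale[OF y I])
  have I'L: "I' \<subseteq> L"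
  proof
    fix x assume "x \<in> I'"
    then obtain k where k: "k \<in> I" "x = y * k" unfolding I'_def by blast
    then obtain l where "l \<in> L" "c * k = d * l" using d(3) unfolding divides_in_def by blast
    then show "x \<in> L" using d(2) unfolding k y_def by (simp add: field_simps)
  qed
  have no_common: "\<exists>z\<in>I'. \<not> divides_in L p z" if p: "prime_in L p" for p
  proof -
    obtain k where k: "k \<in> I" "\<not> divides_in L (p * d) (c * k)" using d(4)[OF p] by blast
    have "c * k = d * (y * k)" using d(2) unfolding y_def by simp
    then have "\<not> divides_in L p (y * k)" using k(2) unfolding divides_in_def by (metis mult.assoc mult.commute)
    then show ?thesis using k(1) unfolding I'_def by blast
  qed
  have JL: "J \<subseteq> L"
  proof
    fix j assume "j \<in> J"
    then have "j \<in> quotient_field D" "\<And>z. z \<in> I' \<Longrightarrow> j * z \<in> D" unfolding J_def ideal_inverse_def by auto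
    then show "j \<in> L" using multiplier_in_L[OF I'L no_common] D_subset_L by blast
  qed
  obtain b where b: "b \<in> D" "b \<noteq> 0" "(*) b ` I' \<subseteq> D" using v_invertibleD(3)[OF I'] by blast
  obtain m1 where m1: "\<forall>z\<in>I'. u ^ m1 * z \<in> D" using uniform_denominator[OF I'L b] by blast
  obtain i' where i': "i' \<in> I'" "i' \<noteq> 0" using v_invertibleD(5)[OF I'] by blast
  have "u ^ m1 * i' \<in> D" "u ^ m1 * i' \<noteq> 0" using m1 i' u_nonzero by auto
  moreover have "(*) (u ^ m1 * i') ` J \<subseteq> D"
  proof clarify
    fix j assume "j \<in> J"
    then have "u ^ m1 * (j * i') \<in> D"
      using i' u_in unfolding J_def ideal_inverse_def by (auto intro: closed)
    then show "u ^ m1 * i' * j \<in> D" by (simp only: ac_simps)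
  qed
  ultimately obtain m2 where m2: "\<forall>z\<in>J. u ^ m2 * z \<in> D" using uniform_denominator[OF JL] by blast
  have uq: "u ^ m \<in> quotient_field D" for m using u_in power_closed subset_quotient_field by blast
  have "u ^ max m1 m2 \<in> J" unfolding J_def ideal_inverse_def
    using m1 uq power_in_D[of m1 _ "max m1 m2"] by auto
  moreover have "u ^ max m1 m2 \<in> ideal_inverse D J" unfolding ideal_inverse_def
    using m2 uq power_in_D[of m2 _ "max m1 m2"] by auto
  then have "u ^ max m1 m2 \<in> I'" using v_invertibleD(2)[OF I'] unfolding J_def by simp
  ultimately show ?thesis using y I'L JL unfolding I'_def J_def by blast
qed

text \<open>
  After normalizing \<open>I\<close>, the prime divisors found are the ideals \<open>h I\<close>, where \<open>h\<close> is an element of the inverse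
  of \<open>I\<close> that is prime in \<open>L\<close> and for which \<open>h I\<close> lies in no associated prime. These conditions make
  \<open>h I\<close> the contraction of \<open>h L\<close>. All but primality depend only on the residue class of \<open>h\<close> modulo a high power of \<open>u\<close>. The ideal \<open>h L\<close> can be
  recovered from its contraction, so that infinitely many ideals \<open>h L\<close> give infinitely many prime divisors.
\<close>

theorem prime_divisors_in_class:
  assumes dense: "\<And>x n. x \<in> L \<Longrightarrow> infinite {(*) h ` L |h. prime_in L h \<and> (\<exists>d\<in>D. h = x + u ^ n * d)}"
    and I: "v_invertible D I"
  shows "infinite {P. prime_divisor D P \<and> (\<exists>y\<in>quotient_field D. y \<noteq> 0 \<and> P = (*) y ` I)}"
proof -
  obtain y m where y: "y \<in> quotient_field D" "y \<noteq> 0" and "(*) y ` I \<subseteq> L"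
    "ideal_inverse D ((*) y ` I) \<subseteq> L" "u ^ m \<in> (*) y ` I" "u ^ m \<in> ideal_inverse D ((*) y ` I)"
    using v_invertible_normalize[OF I] by blast
  moreover define I' where "I' = (*) y ` I"
  moreover define J where "J = ideal_inverse D I'"
  ultimately have IL: "I' \<subseteq> L" and JL: "J \<subseteq> L" and umI: "u ^ m \<in> I'" and umJ: "u ^ m \<in> J" by auto
  have I': "v_invertible D I'" unfolding I'_def by (rule v_invertible_scale[OF y I])
  have IJ: "i * j \<in> D" if "i \<in> I'" "j \<in> J" for i j
    using that unfolding J_def ideal_inverse_def by (auto simp: mult.commute)
  have J_closed: "j + j' \<in> J" if "j \<in> J" "j' \<in> J" for j j'
    using that JL L_subset_quotient_field L.add_closed[of j j']
    unfolding J_def ideal_inverse_def by (auto simp: distrib_right intro: add_closed)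
  have J_mult: "d * j \<in> J" if "d \<in> D" "j \<in> J" for d j
    using that quotient_field_mult subset_quotient_field
    unfolding J_def ideal_inverse_def by (auto simp: mult.assoc intro: mult_closed)
  have J0: "0 \<in> J" using J_mult[OF zero_closed umJ] by simp
  obtain x0 where x0: "x0 \<in> J" "\<And>M. associated_prime M \<Longrightarrow> \<exists>i\<in>I'. i * x0 \<notin> M"
    using avoid_associated_primes[OF IJ J0 J_closed J_mult] v_invertible_avoids_associated_primes[OF I']
    unfolding J_def by blast
  have in_class: "prime_divisor D ((*) h ` L \<inter> D) \<and> (\<exists>y\<in>quotient_field D. y \<noteq> 0 \<and> (*) h ` L \<inter> D = (*) y ` I)"
    if h: "prime_in L h" and d: "d \<in> D" "h = x0 + u ^ Suc m * d" for h d
  proof -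
    (* The additional factor u moves the change from x0 to h into every associated prime. *)
    have uJ: "u ^ m * d \<in> J" using J_mult[OF d(1) umJ] by (simp add: mult.commute)
    then have "u * (u ^ m * d) \<in> J" by (rule J_mult[OF u_in])
    then have hJ: "h \<in> J" unfolding d(2) using J_closed[OF x0(1)] by (simp add: mult.assoc)
    have avoid: "\<exists>a\<in>(*) h ` I'. a \<notin> M" if M: "associated_prime M" for M
    proof -
      obtain i where i: "i \<in> I'" "i * x0 \<notin> M" using x0(2)[OF M] by blast
      have "i * (u ^ m * d) \<in> D" using IJ[OF i(1) uJ] .
      then have "(- (i * (u ^ m * d))) * u \<in> M"
        using associated_primeD(2,5)[OF M] uminus_closed by blast
      then have "h * i \<notin> M"
        using i(2) associated_primeD(4)[OF M, of "h * i" "(- (i * (u ^ m * d))) * u"]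
        unfolding d(2) by (auto simp: algebra_simps)
      then show ?thesis using i by blast
    qed
    have hI: "(*) h ` I' \<subseteq> D" using IJ[OF _ hJ] by (auto simp: mult.commute)
    have "(*) h ` L \<inter> D = (*) h ` I'"
    proof
      show "(*) h ` I' \<subseteq> (*) h ` L \<inter> D" using hI IL by blast
      show "(*) h ` L \<inter> D \<subseteq> (*) h ` I'"
      proof clarify
        fix l assume l: "l \<in> L" "h * l \<in> D"
        have "l * j \<in> D" if j: "j \<in> J" for j
        proof (rule multiplier_in_D[OF hI avoid])
          show "l * j \<in> L" using l j JL by (auto intro: L.mult_closed)
          fix a assume "a \<in> (*) h ` I'"
          then obtain i where i: "i \<in> I'" "a = h * i" by blast
          have "(h * l) * (i * j) \<in> D" using l(2) IJ[OF i(1) j] by (rule mult_closed)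
          then show "l * j * a \<in> D" by (simp add: i ac_simps)
        qed
        then have "l \<in> ideal_inverse D J"
          using l L_subset_quotient_field unfolding ideal_inverse_def by auto
        then have "l \<in> I'" using v_invertibleD(2)[OF I'] unfolding J_def by simp
        then show "h * l \<in> (*) h ` I'" by blast
      qed
    qed
    moreover have "h \<in> quotient_field D" "h \<noteq> 0"
      using h L_subset_quotient_field unfolding prime_in_def by auto
    ultimately have P: "v_invertible D ((*) h ` L \<inter> D)" "(*) h ` L \<inter> D = (*) (h * y) ` I"
      "h * y \<in> quotient_field D" "h * y \<noteq> 0"
      using v_invertible_scale[OF _ _ I'] y quotient_field_mult
      by (auto simp: I'_def image_image mult.assoc)
    have "prime_divisor D ((*) h ` L \<inter> D)"
      unfolding prime_divisor_def v_ideal_def primeideal_iff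
      using P(1) prime_ideal_in_contraction[OF h] height_contraction[OF h] unfolding v_invertible_def by blast
    then show ?thesis using P by blast
  qed
  have recover: "(*) h ` L = {x. \<exists>k. u ^ k * x \<in> (*) h ` L \<inter> D}" if "h \<in> L" for h
  proof (intro equalityI subsetI)
    fix x assume "x \<in> (*) h ` L"
    then obtain l where l: "l \<in> L" "x = h * l" by blast
    then have "x \<in> L" using that by (auto intro: L.mult_closed)
    then obtain k where k: "u ^ k * x \<in> D" unfolding L_def by blast
    have "u ^ k * x = h * (u ^ k * l)" "u ^ k * l \<in> L"
      using l u_in D_subset_L by (auto simp: mult.left_commute intro!: L.closed)
    then show "x \<in> {x. \<exists>k. u ^ k * x \<in> (*) h ` L \<inter> D}" using k by blast
  next
    fix x assume "x \<in> {x. \<exists>k. u ^ k * x \<in> (*) h ` L \<inter> D}"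
    then obtain k l where l: "l \<in> L" "u ^ k * x = h * l" by blast
    have "x = inverse u ^ k * (u ^ k * x)" using u_nonzero by (simp flip: mult.assoc power_mult_distrib)
    then have "x = h * (inverse u ^ k * l)" unfolding l(2) by (simp add: ac_simps)
    then show "x \<in> (*) h ` L" using L.mult_closed[OF inverse_power_in_L l(1)] by blast
  qed
  show ?thesis
  proof
    assume fin: "finite {P. prime_divisor D P \<and> (\<exists>y\<in>quotient_field D. y \<noteq> 0 \<and> P = (*) y ` I)}"
    have "{(*) h ` L |h. prime_in L h \<and> (\<exists>d\<in>D. h = x0 + u ^ Suc m * d)} \<subseteq>
      (\<lambda>P. {x. \<exists>k. u ^ k * x \<in> P}) ` {P. prime_divisor D P \<and> (\<exists>y\<in>quotient_field D. y \<noteq> 0 \<and> P = (*) y ` I)}"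
    proof
      fix z assume "z \<in> {(*) h ` L |h. prime_in L h \<and> (\<exists>d\<in>D. h = x0 + u ^ Suc m * d)}"
      then obtain h d where h: "prime_in L h" "d \<in> D" "h = x0 + u ^ Suc m * d" and z: "z = (*) h ` L"
        by blast
      then have hL: "h \<in> L" unfolding prime_in_def by blast
      show "z \<in> (\<lambda>P. {x. \<exists>k. u ^ k * x \<in> P}) `
          {P. prime_divisor D P \<and> (\<exists>y\<in>quotient_field D. y \<noteq> 0 \<and> P = (*) y ` I)}"
        unfolding z by (rule image_eqI[where x = "(*) h ` L \<inter> D"], rule recover[OF hL], rule CollectI, rule in_class[OF h])
    qed
    then have "finite {(*) h ` L |h. prime_in L h \<and> (\<exists>d\<in>D. h = x0 + u ^ Suc m * d)}"
      by (rule finite_subset[OF _ finite_imageI[OF fin]])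
    then show False by (rule notE[OF dense[OF subsetD[OF JL x0(1)]]])
  qed
qed

end

section \<open>Monoid algebras\<close>

abbreviation support :: "('g, 'k::zero) group_algebra \<Rightarrow> 'g set" where
  "support f \<equiv> Poly_Mapping.keys (poly_mapping_of f)"

definition monomial :: "'k \<Rightarrow> 'g \<Rightarrow> ('g, 'k::zero) group_algebra" where
  "monomial c g = group_algebra_of (Poly_Mapping.single g c)"

lemma poly_mapping_of_monomial [simp]: "poly_mapping_of (monomial c g) = Poly_Mapping.single g c"
  unfolding monomial_def by (simp add: group_algebra_of_inverse)

lemma monomial_mult:
  "monomial c g * monomial d h = (monomial (c * d) (g + h) :: ('g::comm_monoid_add, 'k::comm_ring_1) group_algebra)"
  by (simp add: times_group_algebra.rep_eq mult_single flip: poly_mapping_of_inject)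

lemma monomial_one: "monomial 1 0 = (1 :: ('g::comm_monoid_add, 'k::comm_ring_1) group_algebra)"
  by (simp add: one_group_algebra.rep_eq flip: poly_mapping_of_inject)

lemma monomial_zero [simp]: "monomial 0 g = (0 :: ('g::comm_monoid_add, 'k::comm_ring_1) group_algebra)"
  by (simp add: zero_group_algebra.rep_eq flip: poly_mapping_of_inject)

lemma monomial_add:
  "monomial (c + d) g = (monomial c g + monomial d g :: ('g::comm_monoid_add, 'k::comm_ring_1) group_algebra)"
  by (simp add: plus_group_algebra.rep_eq single_add flip: poly_mapping_of_inject)

lemma monomial_power:
  "monomial 1 g ^ n = (monomial 1 (nscale n g) :: ('g::comm_monoid_add, 'k::comm_ring_1) group_algebra)"
  by (induction n) (auto simp: monomial_one monomial_mult nscale_Suc)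

lemma support_zero_iff: "support f = {} \<longleftrightarrow> f = (0 :: ('g::comm_monoid_add, 'k::comm_ring_1) group_algebra)"
  by (simp add: zero_group_algebra.rep_eq flip: poly_mapping_of_inject)

lemma support_diff:
  "support (f - g) \<subseteq> support f \<union> support (g :: ('g::comm_monoid_add, 'k::comm_ring_1) group_algebra)"
  by (auto simp: minus_group_algebra.rep_eq in_keys_iff lookup_minus)

lemma support_add:
  "support (f + g) \<subseteq> support f \<union> support (g :: ('g::comm_monoid_add, 'k::comm_ring_1) group_algebra)"
  by (auto simp: plus_group_algebra.rep_eq in_keys_iff lookup_add)

lemma support_uminus:
  "support (- f) = support (f :: ('g::comm_monoid_add, 'k::comm_ring_1) group_algebra)"
  by (auto simp: uminus_group_algebra.rep_eq in_keys_iff)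

lemma support_sum:
  "support (sum f I) \<subseteq> (\<Union>i\<in>I. support (f i :: ('g::comm_monoid_add, 'k::comm_ring_1) group_algebra))"
proof (induction I rule: infinite_finite_induct)
  case (insert x I)
  then show ?case using support_add[of "f x" "sum f I"] by auto
qed (auto simp: zero_group_algebra.rep_eq)

lemma support_mult:
  "support (f * g) \<subseteq> {a + b |a b. a \<in> support f \<and> b \<in> support (g :: ('g::comm_monoid_add, 'k::comm_ring_1) group_algebra)}"
  unfolding times_group_algebra.rep_eq by (rule keys_mult)

lemma sum_of_monomials:
  fixes f :: "('g::comm_monoid_add, 'k::comm_ring_1) group_algebra"
  shows "f = (\<Sum>g\<in>support f. monomial (Poly_Mapping.lookup (poly_mapping_of f) g) g)"
proof -
  have of_sum: "poly_mapping_of (sum h I) = (\<Sum>i\<in>I. poly_mapping_of (h i))"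
    for h :: "'g \<Rightarrow> ('g, 'k) group_algebra" and I
    by (induction I rule: infinite_finite_induct) (auto simp: zero_group_algebra.rep_eq plus_group_algebra.rep_eq)
  have "poly_mapping_of f = (\<Sum>g\<in>support f. Poly_Mapping.single g (Poly_Mapping.lookup (poly_mapping_of f) g))"
    by (rule poly_mapping_eqI) (auto simp: lookup_sum lookup_single when_def in_keys_iff)
  then show ?thesis by (simp add: of_sum flip: poly_mapping_of_inject)
qed

lemma monomial_in_monoid_algebra: "g \<in> S \<Longrightarrow> to_fract (monomial c g) \<in> monoid_algebra S"
  unfolding monoid_algebra_def by (intro imageI) auto

lemma monoid_algebra_minimal:
  assumes "0 \<in> A" "\<And>x y. x \<in> A \<Longrightarrow> y \<in> A \<Longrightarrow> x + y \<in> A"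
    "\<And>c g. g \<in> S \<Longrightarrow> to_fract (monomial c g) \<in> A"
  shows "monoid_algebra S \<subseteq> A"
proof -
  have sum: "sum h I \<in> A" if "\<And>i. i \<in> I \<Longrightarrow> h i \<in> A" for h :: "'a \<Rightarrow> ('a, 'b) group_algebra fract" and I
    using that assms(1,2) by (induction I rule: infinite_finite_induct) auto
  have "to_fract f \<in> A" if "support f \<subseteq> S" for f :: "('a, 'b) group_algebra"
    by (subst sum_of_monomials) (use that assms(3) in \<open>auto intro!: sum\<close>)
  then show ?thesis unfolding monoid_algebra_def by auto
qed

lemma monoid_algebra_mono: "S \<subseteq> T \<Longrightarrow> monoid_algebra S \<subseteq> monoid_algebra T"
  unfolding monoid_algebra_def by auto

lemma subdomain_monoid_algebra:
  assumes "add_submonoid S" shows "subdomain (monoid_algebra S)"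
proof
  show "1 \<in> monoid_algebra S"
    using monomial_in_monoid_algebra[of 0 S 1] assms by (simp add: monomial_one add_submonoid_def)
  fix x y :: "('a, 'b) group_algebra fract" assume "x \<in> monoid_algebra S" "y \<in> monoid_algebra S"
  then obtain f g where fg: "x = to_fract f" "y = to_fract g" "support f \<subseteq> S" "support g \<subseteq> S"
    unfolding monoid_algebra_def by blast
  have "support (f - g) \<subseteq> S" "support (f * g) \<subseteq> S"
    using fg(3,4) support_diff[of f g] support_mult[of f g] assms unfolding add_submonoid_def by blast+
  then have "to_fract (f - g) \<in> monoid_algebra S" "to_fract (f * g) \<in> monoid_algebra S"
    unfolding monoid_algebra_def by blast+
  then show "x - y \<in> monoid_algebra S" "x * y \<in> monoid_algebra S"
    using fg(1,2) by simp_all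
qed

abbreviation variable :: "'g \<Rightarrow> ('g::torsion_free_ab_group_add, 'k::field) group_algebra fract" where
  "variable g \<equiv> to_fract (monomial 1 g)"

lemma variable_add: "variable (g + h) = variable g * variable h"
  using monomial_mult[of 1 g 1 h] by (metis mult_1 to_fract_mult)

lemma variable_0: "variable 0 = 1"
  by (simp add: monomial_one)

lemma variable_inverse: "variable g * variable (- g) = 1"
  by (simp add: variable_0 flip: variable_add)

lemma variable_nonzero: "variable g \<noteq> 0"
  using variable_inverse[of g] by (metis mult_zero_left zero_neq_one)

lemma variable_power: "variable g ^ n = variable (nscale n g)"
  by (induction n) (auto simp: variable_0 variable_add nscale_Suc simp del: to_fract_mult)

lemma monomial_split: "to_fract (monomial c (g + h)) = to_fract (monomial c g) * variable h"
  using monomial_mult[of c g 1 h] by (metis mult_1_right to_fract_mult)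

lemma adjoin_subset:
  assumes "subdomain B" "R \<subseteq> B" "t \<in> B" shows "adjoin R t \<subseteq> B"
proof -
  interpret subdomain B by fact
  show ?thesis
    unfolding adjoin_def polys_over_def using assms(2,3) by (auto simp: poly_altdef intro!: closed)
qed

lemma monoid_algebra_adjoin:
  assumes M: "add_submonoid M"
  shows "monoid_algebra {m + nscale n a |m n. m \<in> M} = adjoin (monoid_algebra M) (variable a)"
proof
  let ?N = "{m + nscale n a |m n. m \<in> M}"
  have N: "add_submonoid ?N" unfolding add_submonoid_def
  proof (intro conjI ballI)
    show "0 \<in> ?N" using M unfolding add_submonoid_def by (auto intro!: exI[of _ "0::'a"] exI[of _ "0::nat"])
    fix x y assume "x \<in> ?N" "y \<in> ?N"
    then obtain m n k l where "x = m + nscale k a" "y = n + nscale l a" "m \<in> M" "n \<in> M" by blast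
    then have "x + y = (m + n) + nscale (k + l) a" "m + n \<in> M"
      using M unfolding add_submonoid_def by (auto simp: nscale_add)
    then show "x + y \<in> ?N" by blast
  qed
  have "M \<subseteq> ?N" by (force intro: exI[of _ "0::nat"])
  moreover have "a \<in> ?N"
    using M unfolding add_submonoid_def
    by (intro CollectI exI[of _ "0::'a"] exI[of _ "Suc 0"]) (simp add: nscale_Suc)
  ultimately show "adjoin (monoid_algebra M) (variable a) \<subseteq> monoid_algebra ?N"
    using N by (intro adjoin_subset subdomain_monoid_algebra monoid_algebra_mono monomial_in_monoid_algebra)
  interpret M: subdomain "monoid_algebra M" using M by (rule subdomain_monoid_algebra)
  interpret A: subdomain "adjoin (monoid_algebra M) (variable a)" by (rule M.subdomain_adjoin)
  show "monoid_algebra ?N \<subseteq> adjoin (monoid_algebra M) (variable a)"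
  proof (rule monoid_algebra_minimal)
    fix c g assume "g \<in> ?N"
    then obtain m n where "m \<in> M" "g = m + nscale n a" by blast
    then show "to_fract (monomial c g) \<in> adjoin (monoid_algebra M) (variable a)"
      by (simp only: monomial_split variable_power[symmetric])
        (intro A.mult_closed A.power_closed M.coeff_in_adjoin M.generator_in_adjoin monomial_in_monoid_algebra)
  qed (auto intro: A.closed)
qed

lemma submonoid_hull: "add_submonoid (add_submonoid hull A)"
  by (rule hull_in) (auto simp: add_submonoid_def)

lemma hull_insert_eq:
  "add_submonoid hull (insert a A) = {m + nscale n a |m n. m \<in> add_submonoid hull A}" for a :: "'a::comm_monoid_add"
proof (rule hull_unique)
  let ?N = "{m + nscale n a |m n. m \<in> add_submonoid hull A}"
  have M: "0 \<in> add_submonoid hull A" "\<And>x y. x \<in> add_submonoid hull A \<Longrightarrow> y \<in> add_submonoid hull A \<Longrightarrow> x + y \<in> add_submonoid hull A"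
    using submonoid_hull[of A] unfolding add_submonoid_def by auto
  have "x \<in> ?N" if "x \<in> A" for x
    using hull_inc[OF that, of add_submonoid] by (intro CollectI exI[of _ x] exI[of _ "0::nat"]) simp
  moreover have "a \<in> ?N" using M(1)
    by (intro CollectI exI[of _ "0::'a"] exI[of _ "Suc 0"]) (simp add: nscale_Suc)
  ultimately show "insert a A \<subseteq> ?N" by blast
  show "add_submonoid ?N" unfolding add_submonoid_def[of ?N]
  proof (intro conjI ballI)
    show "0 \<in> ?N" using M(1) by (intro CollectI exI[of _ "0::'a"] exI[of _ "0::nat"]) simp
    fix x y assume "x \<in> ?N" "y \<in> ?N"
    then obtain m n k l where "x = m + nscale k a" "y = n + nscale l a"
      "m \<in> add_submonoid hull A" "n \<in> add_submonoid hull A" by blast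
    then have "x + y = (m + n) + nscale (k + l) a" "m + n \<in> add_submonoid hull A"
      using M(2) by (auto simp: nscale_add algebra_simps)
    then show "x + y \<in> ?N" by blast
  qed
  fix T assume T: "insert a A \<subseteq> T" "add_submonoid T"
  then have "add_submonoid hull A \<subseteq> T" by (intro hull_minimal) auto
  moreover have "nscale n a \<in> T" for n
    using T by (induction n) (auto simp: add_submonoid_def nscale_Suc)
  ultimately show "?N \<subseteq> T" using T(2) unfolding add_submonoid_def by blast
qed

lemma constants_in_monoid_algebra:
  "monoid_algebra {0} = range (\<lambda>c. to_fract (monomial c 0))"
proof
  show "monoid_algebra {0} \<subseteq> range (\<lambda>c. to_fract (monomial c (0::'a)) :: ('a, 'b) group_algebra fract)"
  proof (rule monoid_algebra_minimal)
    show "0 \<in> range (\<lambda>c. to_fract (monomial c (0::'a)) :: ('a, 'b) group_algebra fract)"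
      by (rule image_eqI[of _ _ 0]) auto
  qed (auto simp flip: monomial_add to_fract_add)
qed (auto intro: monomial_in_monoid_algebra)

lemma constant_unit:
  assumes "x \<in> monoid_algebra {0}" "x \<noteq> 0" shows "unit_in (monoid_algebra {0}) x"
proof -
  obtain c where c: "x = to_fract (monomial c 0)" using assms(1) unfolding constants_in_monoid_algebra by blast
  then have "c \<noteq> 0" using assms(2) by auto
  then have "x * to_fract (monomial (inverse c) 0) = 1"
    unfolding c by (simp add: monomial_mult monomial_one flip: to_fract_mult)
  then show ?thesis using assms(1) unfolding unit_in_def by (auto intro!: bexI monomial_in_monoid_algebra)
qed

lemma subdomain_constants: "subdomain (monoid_algebra {0})"
  by (rule subdomain_monoid_algebra) (simp add: add_submonoid_def)

lemma noetherian_in_constants: "noetherian_in (monoid_algebra {0})"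
  unfolding noetherian_in_def
proof (intro allI impI)
  fix Z :: "('a, 'b) group_algebra fract set" assume Z: "Z \<subseteq> monoid_algebra {0}"
  interpret subdomain "monoid_algebra {0} :: ('a, 'b) group_algebra fract set" by (rule subdomain_constants)
  show "\<exists>F\<subseteq>Z. finite F \<and> Z \<subseteq> lincomb (monoid_algebra {0}) F"
  proof (cases "Z \<subseteq> {0}")
    case True
    then show ?thesis by (intro exI[of _ "{}"]) (auto intro: lincomb.zero)
  next
    case False
    then obtain z where z: "z \<in> Z" "z \<noteq> 0" by blast
    then obtain w where w: "w \<in> monoid_algebra {0}" "z * w = 1" using constant_unit Z unfolding unit_in_def by blast
    have "y \<in> lincomb (monoid_algebra {0}) {z}" if "y \<in> Z" for y
    proof -
      have "(y * w) * z \<in> lincomb (monoid_algebra {0}) {z}"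
        using that w Z by (intro lincomb_mult lincomb_base mult_closed) auto
      moreover have "(y * w) * z = y" using w by (simp add: mult.assoc mult.commute[of w])
      ultimately show ?thesis by simp
    qed
    then show ?thesis using z by (intro exI[of _ "{z}"]) auto
  qed
qed

text \<open>
  The generators of the monoid are adjoined one by one to the field of constants.
\<close>

theorem noetherian_in_monoid_algebra:
  assumes "finite A" shows "noetherian_in (monoid_algebra (add_submonoid hull A))"
  using assms
proof (induction A)
  case empty
  have "add_submonoid hull {} = {0 :: 'a}" by (rule hull_unique) (auto simp: add_submonoid_def)
  then show ?case by (simp add: noetherian_in_constants)
next
  case (insert a A)
  interpret subdomain "monoid_algebra (add_submonoid hull A) :: ('a, 'b) group_algebra fract set"
    by (rule subdomain_monoid_algebra[OF submonoid_hull])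
  show ?case
    unfolding hull_insert_eq monoid_algebra_adjoin[OF submonoid_hull]
    by (rule noetherian_in_adjoin[OF insert.IH])
qed

section \<open>Group algebras of finitely generated free groups\<close>

interpretation zm: Modules.module "zscale :: int \<Rightarrow> 'a::ab_group_add \<Rightarrow> 'a"
  by (rule module_zscale)

lemma subspace_add_submonoid: "zm.subspace M \<Longrightarrow> add_submonoid M"
  by (auto simp: add_submonoid_def zm.subspace_def)

lemma monoid_algebra_laurent:
  fixes M :: "'g::torsion_free_ab_group_add set"
  assumes M: "zm.subspace M"
  shows "(monoid_algebra {m + zscale k a |m k. m \<in> M} :: ('g, 'k::field) group_algebra fract set) = laurent (monoid_algebra M) (variable a)"
proof
  let ?N = "{m + zscale k a |m k. m \<in> M}"
  have "zm.subspace ?N"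
  proof (rule zm.subspaceI)
    show "0 \<in> ?N" using zm.subspace_0[OF M] by (intro CollectI exI[of _ "0::'g"] exI[of _ "0::int"]) simp
    fix x y assume "x \<in> ?N" "y \<in> ?N"
    then obtain m n k l where "x = m + zscale k a" "y = n + zscale l a" "m \<in> M" "n \<in> M" by blast
    then have "x + y = (m + n) + zscale (k + l) a" "m + n \<in> M"
      using M by (auto simp: zm.scale_left_distrib zm.subspace_add)
    then show "x + y \<in> ?N" by blast
  next
    fix x and c :: int assume "x \<in> ?N"
    then obtain m k where "x = m + zscale k a" "m \<in> M" by blast
    then have "zscale c x = zscale c m + zscale (c * k) a" "zscale c m \<in> M"
      using M by (auto simp: zm.scale_right_distrib zm.subspace_scale)
    then show "zscale c x \<in> ?N" by blast
  qed
  then have N: "add_submonoid ?N" by (rule subspace_add_submonoid)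
  interpret N: subdomain "monoid_algebra ?N :: ('g, 'k) group_algebra fract set" using N by (rule subdomain_monoid_algebra)
  interpret M: subdomain "monoid_algebra M :: ('g, 'k) group_algebra fract set"
    using subspace_add_submonoid[OF M] by (rule subdomain_monoid_algebra)
  interpret A: subdomain "adjoin (monoid_algebra M) (variable a) :: ('g, 'k) group_algebra fract set" by (rule M.subdomain_adjoin)
  interpret L: subdomain "laurent (monoid_algebra M) (variable a) :: ('g, 'k) group_algebra fract set" by (rule M.subdomain_laurent)
  have zN: "zscale k a \<in> ?N" for k
    using zm.subspace_0[OF M] by (intro CollectI exI[of _ "0::'g"] exI[of _ k]) simp
  have MN: "M \<subseteq> ?N" by (force intro: exI[of _ "0::int"])
  have aN: "variable a \<in> monoid_algebra ?N" "variable (- a) \<in> monoid_algebra ?N"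
    using zN[of 1] zN[of "- 1"] by (auto intro: monomial_in_monoid_algebra)
  have AN: "adjoin (monoid_algebra M) (variable a) \<subseteq> monoid_algebra ?N"
    using N MN aN by (intro adjoin_subset subdomain_monoid_algebra monoid_algebra_mono)
  show "laurent (monoid_algebra M) (variable a) \<subseteq> (monoid_algebra ?N :: ('g, 'k) group_algebra fract set)"
  proof
    fix x :: "('g, 'k) group_algebra fract" assume "x \<in> laurent (monoid_algebra M) (variable a)"
    then obtain n where "variable a ^ n * x \<in> adjoin (monoid_algebra M) (variable a)" unfolding laurent_def by blast
    then have "variable (- a) ^ n * (variable a ^ n * x) \<in> monoid_algebra ?N"
      by (rule N.mult_closed[OF N.power_closed[OF aN(2)] subsetD[OF AN]])
    moreover have "variable (- a) ^ n * (variable a ^ n * x) = (variable a * variable (- a)) ^ n * x"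
      by (simp add: power_mult_distrib ac_simps)
    ultimately show "x \<in> monoid_algebra ?N" unfolding variable_inverse by simp
  qed
  show "(monoid_algebra ?N :: ('g, 'k) group_algebra fract set) \<subseteq> laurent (monoid_algebra M) (variable a)"
  proof (rule monoid_algebra_minimal)
    fix c :: 'k and g assume "g \<in> ?N"
    then obtain m k where g: "m \<in> M" "g = m + zscale k a" by blast
    define n where "n = nat (- k)"
    have "g + nscale n a = m + nscale (nat k) a"
      unfolding g n_def zscale_def by (auto simp: algebra_simps)
    then have "variable a ^ n * to_fract (monomial c g) = to_fract (monomial c m) * variable a ^ nat k"
      by (simp only: variable_power mult.commute[of "variable _"] flip: monomial_split)
    moreover have "\<dots> \<in> adjoin (monoid_algebra M) (variable a)"
      using g(1) by (intro A.mult_closed A.power_closed M.coeff_in_adjoin M.generator_in_adjoin monomial_in_monoid_algebra)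
    ultimately show "to_fract (monomial c g) \<in> laurent (monoid_algebra M) (variable a)"
      unfolding laurent_def by (intro CollectI exI[of _ n]) (simp only:)
  qed (auto intro: L.closed)
qed

text \<open>
  The powers of \<open>variable a\<close> shift the supports of the coefficients into different cosets of \<open>M\<close>, so that no
  cancellation can take place.
\<close>

lemma variable_transcendental:
  fixes M :: "'g::torsion_free_ab_group_add set"
  assumes M: "zm.subspace M" and a: "\<And>k. zscale k a \<in> M \<Longrightarrow> k = 0"
    and q: "q \<in> polys_over (monoid_algebra M)" "poly q (variable a) = (0 :: ('g, 'k::field) group_algebra fract)"
  shows "q = 0"
proof -
  have "\<forall>i. \<exists>f. coeff q i = to_fract f \<and> support f \<subseteq> M"
    using q(1) unfolding polys_over_def monoid_algebra_def by blast
  then obtain f where f: "\<And>i. coeff q i = to_fract (f i)" "\<And>i. support (f i) \<subseteq> M" by metis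
  define h where "h i = f i * monomial 1 (nscale i a)" for i
  have h: "support (h i) \<subseteq> {m + nscale i a |m. m \<in> M}" for i
    using support_mult[of "f i" "monomial 1 (nscale i a)"] f(2)[of i] unfolding h_def by (auto split: if_splits)
  have "to_fract (\<Sum>i\<le>degree q. h i) = poly q (variable a)"
    by (simp add: h_def poly_altdef f monomial_power flip: variable_power)
  then have sum0: "(\<Sum>i\<le>degree q. h i) = 0" using q(2) by (metis to_fract_eq_0_iff)
  have "coeff q i = 0" for i
  proof (cases "i \<le> degree q")
    case True
    have "support (h i) \<inter> support (h j) = {}" if "j \<noteq> i" for j
    proof (rule ccontr)
      assume "support (h i) \<inter> support (h j) \<noteq> {}"
      then obtain m m' where m: "m \<in> M" "m' \<in> M" "m + nscale i a = m' + nscale j a" using h by blast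
      have "zscale (int i - int j) a = m' - m"
        unfolding zscale_diff_of_nat using m(3) by (simp add: algebra_simps)
      then have "int i - int j = 0" using a m zm.subspace_diff[OF M] by metis
      with that show False by simp
    qed
    moreover have "support (h i) \<subseteq> (\<Union>j\<in>{..degree q} - {i}. support (h j))"
    proof -
      have "h i = - (\<Sum>j\<in>{..degree q} - {i}. h j)"
        using sum0 True by (simp add: sum.remove[of _ i] eq_neg_iff_add_eq_0)
      then show ?thesis using support_sum[of h "{..degree q} - {i}"] by (simp add: support_uminus)
    qed
    ultimately have "support (h i) = {}" by blast
    then have "h i = 0" by (simp only: support_zero_iff)
    moreover have "monomial 1 (nscale i a) \<noteq> (0 :: ('g, 'k) group_algebra)"
      using variable_nonzero[of "nscale i a"] by auto
    ultimately show ?thesis unfolding h_def f by simp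
  qed (simp add: coeff_eq_0)
  then show ?thesis by (simp add: poly_eq_iff)
qed

theorem factorial_in_group_algebra:
  assumes "finite B" "zm.independent (B :: 'g::torsion_free_ab_group_add set)"
  shows "factorial_in (monoid_algebra (zm.span B) :: ('g, 'k::field) group_algebra fract set)"
  using assms
proof (induction B)
  case empty
  show ?case unfolding factorial_in_def zm.span_empty
    using constant_unit by (metis empty_iff list.set(1) mult_1_right prod_list.Nil)
next
  case (insert b B)
  have M: "zm.subspace (zm.span B)" by simp
  have B: "zm.independent B" using insert.prems by (rule zm.independent_mono) auto
  interpret subdomain "monoid_algebra (zm.span B) :: ('g, 'k) group_algebra fract set"
    by (rule subdomain_monoid_algebra[OF subspace_add_submonoid[OF M]])
  interpret factorial_subdomain "monoid_algebra (zm.span B) :: ('g, 'k) group_algebra fract set"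
    by unfold_locales (rule insert.IH[OF B])
  have "k = 0" if k: "zscale k b \<in> zm.span B" for k
  proof -
    have "zm.representation (insert b B) (zscale k b) b = k"
      using insert.prems by (simp add: zm.representation_scale zm.span_base zm.representation_basis)
    moreover have "zm.representation (insert b B) (zscale k b) = zm.representation B (zscale k b)"
      using insert.prems k by (intro zm.representation_extend) auto
    ultimately show ?thesis using zm.representation_ne_zero[of B "zscale k b" b] insert.hyps by auto
  qed
  then have "factorial_in (laurent (monoid_algebra (zm.span B)) (variable b) :: ('g, 'k) group_algebra fract set)"
    by (intro factorial_in_laurent[OF variable_inverse]) (auto intro: variable_transcendental[OF M])
  moreover have "zm.span (insert b B) = {m + zscale k b |m k. m \<in> zm.span B}"
  proof (intro equalityI subsetI)
    fix x assume "x \<in> zm.span (insert b B)"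
    then obtain k where "x - zscale k b \<in> zm.span B" unfolding zm.span_insert by blast
    then show "x \<in> {m + zscale k b |m k. m \<in> zm.span B}"
      by (intro CollectI exI[of _ "x - zscale k b"] exI[of _ k]) simp
  next
    fix x assume "x \<in> {m + zscale k b |m k. m \<in> zm.span B}"
    then obtain m k where "x = m + zscale k b" "m \<in> zm.span B" by blast
    then have "x - zscale k b \<in> zm.span B" by simp
    then show "x \<in> zm.span (insert b B)" unfolding zm.span_insert by blast
  qed
  ultimately show ?case by (simp only: monoid_algebra_laurent[OF M])
qed

section \<open>Finitely generated torsion-free groups\<close>

lemma zscale_eq_0_D:
  fixes x :: "'a::torsion_free_ab_group_add"
  assumes "zscale k x = 0" "k \<noteq> 0" shows "x = 0"
  using assms nscale_eq_0_D[of "nat k" x] nscale_eq_0_D[of "nat (- k)" x]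
  by (auto simp: zscale_def split: if_splits)

text \<open>
  Euclid's algorithm on the coefficients of a relation: replacing \<open>x j\<close> by \<open>x j \<plusminus> x i\<close> makes the coefficient
  of \<open>x i\<close> smaller, until a single generator remains in the relation, and that one is zero.
\<close>

lemma fewer_generators:
  fixes x :: "'i \<Rightarrow> 'a::torsion_free_ab_group_add"
  assumes "finite I" "\<exists>i\<in>I. a i \<noteq> 0" "(\<Sum>i\<in>I. zscale (a i) (x i)) = 0"
  shows "\<exists>(y :: 'i \<Rightarrow> 'a) J. finite J \<and> card J < card I \<and> zm.span (y ` J) = zm.span (x ` I)"
  using assms
proof (induction "\<Sum>i\<in>I. nat \<bar>a i\<bar>" arbitrary: a x rule: less_induct)
  case less
  obtain i0 where i0: "i0 \<in> I" "a i0 \<noteq> 0" using less.prems by blast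
  show ?case
  proof (cases "\<exists>j\<in>I. j \<noteq> i0 \<and> a j \<noteq> 0")
    case False
    then have "(\<Sum>i\<in>I. zscale (a i) (x i)) = zscale (a i0) (x i0)"
      using i0 less.prems(1) by (subst sum.remove[of _ i0]) (auto intro!: sum.neutral)
    then have "x i0 = 0" using less.prems(3) i0 zscale_eq_0_D by metis
    moreover have "x ` I = insert (x i0) (x ` (I - {i0}))" using i0 by auto
    ultimately have "zm.span (x ` (I - {i0})) = zm.span (x ` I)"
      unfolding zm.span_eq by (auto intro: zm.span_base zm.span_zero)
    then show ?thesis using less.prems(1) i0 card_Diff1_less[of I i0] by (intro exI[of _ x] exI[of _ "I - {i0}"]) auto
  next
    case True
    then obtain i1 where i1: "i1 \<in> I" "i1 \<noteq> i0" "a i1 \<noteq> 0" by blast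
    obtain i j where ij: "i \<in> I" "j \<in> I" "i \<noteq> j" "a i \<noteq> 0" "a j \<noteq> 0" "\<bar>a j\<bar> \<le> \<bar>a i\<bar>"
      using i0 i1 by (metis linorder_le_cases)
    define e where "e = sgn (a i) * sgn (a j)"
    have less: "\<bar>a i - e * a j\<bar> < \<bar>a i\<bar>"
      using ij unfolding e_def by (auto simp: sgn_if)
    define a' where "a' = a(i := a i - e * a j)"
    define x' where "x' = x(j := x j + zscale e (x i))"
    have split: "sum f I = f i + (f j + sum f (I - {i} - {j}))" for f :: "'i \<Rightarrow> 'z::comm_monoid_add"
      using ij less.prems(1) by (simp add: sum.remove[of I i] sum.remove[of "I - {i}" j])
    have rest: "(\<Sum>k\<in>I - {i} - {j}. zscale (a' k) (x' k)) = (\<Sum>k\<in>I - {i} - {j}. zscale (a k) (x k))"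
      "(\<Sum>k\<in>I - {i} - {j}. nat \<bar>a' k\<bar>) = (\<Sum>k\<in>I - {i} - {j}. nat \<bar>a k\<bar>)"
      by (auto intro!: sum.cong simp: a'_def x'_def)
    have smaller: "(\<Sum>k\<in>I. nat \<bar>a' k\<bar>) < (\<Sum>k\<in>I. nat \<bar>a k\<bar>)"
      unfolding split[of "\<lambda>k. nat \<bar>a' k\<bar>"] split[of "\<lambda>k. nat \<bar>a k\<bar>"] rest
      using less ij(3) by (simp add: a'_def)
    have nontrivial: "\<exists>k\<in>I. a' k \<noteq> 0" using ij by (intro bexI[of _ j]) (auto simp: a'_def)
    have relation: "(\<Sum>k\<in>I. zscale (a' k) (x' k)) = 0"
      using less.prems(3) ij(3)
      unfolding split[of "\<lambda>k. zscale (a' k) (x' k)"] split[of "\<lambda>k. zscale (a k) (x k)"] rest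
      by (simp add: a'_def x'_def zm.scale_left_diff_distrib zm.scale_right_distrib algebra_simps)
    from less.hyps[OF smaller less.prems(1) nontrivial relation]
    obtain y :: "'i \<Rightarrow> 'a" and J where y: "finite J" "card J < card I" "zm.span (y ` J) = zm.span (x' ` I)"
      by blast
    have "zm.span (x' ` I) = zm.span (x ` I)"
      unfolding zm.span_eq
    proof
      show "x' ` I \<subseteq> zm.span (x ` I)"
      proof clarify
        fix k assume "k \<in> I"
        then have "x k \<in> zm.span (x ` I)" "x i \<in> zm.span (x ` I)" using ij(1) by (auto intro: zm.span_base)
        then show "x' k \<in> zm.span (x ` I)" by (cases "k = j") (auto simp: x'_def intro: zm.span_add zm.span_scale)
      qed
      have "x j = x' j - zscale e (x' i)" using ij(3) by (simp add: x'_def)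
      moreover have "x' k \<in> zm.span (x' ` I)" if "k \<in> I" for k using that by (auto intro: zm.span_base)
      ultimately have "x j \<in> zm.span (x' ` I)" using ij by (metis zm.span_diff zm.span_scale)
      moreover have "x k = x' k" if "k \<noteq> j" for k using that by (simp add: x'_def)
      ultimately show "x ` I \<subseteq> zm.span (x' ` I)"
        by (metis (no_types, lifting) image_subsetI zm.span_base imageI)
    qed
    then show ?thesis using y by metis
  qed
qed

theorem basis_exists:
  fixes A :: "'a::torsion_free_ab_group_add set"
  assumes "finite A"
  shows "\<exists>B. finite B \<and> zm.independent B \<and> zm.span B = zm.span A"
proof -
  define n where "n = (LEAST n. \<exists>B. finite B \<and> zm.span B = zm.span A \<and> card B = n)"
  have ex: "\<exists>n B. finite B \<and> zm.span B = zm.span A \<and> card B = n" using assms by blast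
  obtain B where B: "finite B" "zm.span B = zm.span A" "card B = n"
    using LeastI_ex[OF ex] unfolding n_def by blast
  have least: "n \<le> card B'" if "finite B'" "zm.span B' = zm.span A" for B'
    unfolding n_def by (rule Least_le) (use that in blast)
  have "zm.independent B"
  proof
    assume "zm.dependent B"
    then obtain a where "\<exists>v\<in>B. a v \<noteq> 0" "(\<Sum>v\<in>B. zscale (a v) v) = 0"
      using zm.dependent_finite[OF B(1)] by blast
    then obtain y and J :: "'a set" where J: "finite J" "card J < card B" "zm.span (y ` J) = zm.span ((\<lambda>x. x) ` B)"
      using fewer_generators[OF B(1), of a "\<lambda>x. x"] by blast
    then have "n \<le> card (y ` J)" using B(2) by (intro least) auto
    then show False using J card_image_le[OF J(1), of y] B(3) by linarith
  qed
  then show ?thesis using B by blast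
qed

lemma subspaceI_group:
  fixes H :: "'a::ab_group_add set"
  assumes "0 \<in> H" "\<And>x y. x \<in> H \<Longrightarrow> y \<in> H \<Longrightarrow> x + y \<in> H" "\<And>x. x \<in> H \<Longrightarrow> - x \<in> H"
  shows "zm.subspace H"
proof (rule zm.subspaceI)
  fix x and k :: int assume x: "x \<in> H"
  have "nscale n x \<in> H" for n using assms(1) x by (induction n) (auto simp: nscale_Suc assms(2))
  then show "zscale k x \<in> H" unfolding zscale_def using assms(3) by auto
qed (use assms in auto)

lemma quotient_group_hull:
  fixes A :: "'a::ab_group_add set"
  shows "quotient_group (add_submonoid hull A) = zm.span A"
proof
  let ?S = "add_submonoid hull A"
  have S: "0 \<in> ?S" "\<And>x y. x \<in> ?S \<Longrightarrow> y \<in> ?S \<Longrightarrow> x + y \<in> ?S"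
    using submonoid_hull[of A] unfolding add_submonoid_def by auto
  have "?S \<subseteq> zm.span A"
    by (rule hull_minimal) (auto simp: zm.span_superset subspace_add_submonoid)
  then show "quotient_group ?S \<subseteq> zm.span A"
    unfolding quotient_group_def by (auto intro: zm.span_diff)
  have "zm.subspace (quotient_group ?S)"
  proof (rule subspaceI_group)
    show "0 \<in> quotient_group ?S" unfolding quotient_group_def using S(1) by force
    fix x assume "x \<in> quotient_group ?S"
    then obtain a b where ab: "a \<in> ?S" "b \<in> ?S" "x = a - b" unfolding quotient_group_def by blast
    then have "- x = b - a" by simp
    then show "- x \<in> quotient_group ?S" unfolding quotient_group_def using ab by blast
    fix y assume "y \<in> quotient_group ?S"
    then obtain c d where cd: "c \<in> ?S" "d \<in> ?S" "y = c - d" unfolding quotient_group_def by blast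
    then have "x + y = (a + c) - (b + d)" using ab by simp
    then show "x + y \<in> quotient_group ?S" unfolding quotient_group_def using S(2) ab cd by blast
  qed
  moreover have "A \<subseteq> quotient_group ?S"
  proof
    fix a assume "a \<in> A"
    then have "a \<in> ?S" "a = a - 0" by (auto intro: hull_inc)
    then show "a \<in> quotient_group ?S" unfolding quotient_group_def using S(1) by blast
  qed
  ultimately show "zm.span A \<subseteq> quotient_group ?S" by (rule zm.span_minimal[rotated])
qed

text \<open>
  The sum of the generators lies in the interior of the cone: subtracting one generator from it leaves
  the sum of the others.
\<close>

lemma interior_element:
  fixes A :: "'a::ab_group_add set"
  assumes "finite A"
  shows "\<exists>c\<in>add_submonoid hull A. \<forall>g\<in>zm.span A. \<exists>k. g + nscale k c \<in> add_submonoid hull A"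
proof -
  let ?S = "add_submonoid hull A"
  have S: "0 \<in> ?S" "\<And>x y. x \<in> ?S \<Longrightarrow> y \<in> ?S \<Longrightarrow> x + y \<in> ?S"
    using submonoid_hull[of A] unfolding add_submonoid_def by auto
  have sumS: "\<Sum>B \<in> ?S" if "B \<subseteq> A" for B
    using that by (induction B rule: infinite_finite_induct) (auto intro: S hull_inc)
  define c where "c = \<Sum>A"
  define H where "H = {g. (\<exists>k. g + nscale k c \<in> ?S) \<and> (\<exists>k. - g + nscale k c \<in> ?S)}"
  have add: "\<exists>k. (g + h) + nscale k c \<in> ?S" if "\<exists>k. g + nscale k c \<in> ?S" "\<exists>k. h + nscale k c \<in> ?S" for g h
  proof -
    obtain k l where kl: "g + nscale k c \<in> ?S" "h + nscale l c \<in> ?S" using \<open>\<exists>k. g + nscale k c \<in> ?S\<close> \<open>\<exists>k. h + nscale k c \<in> ?S\<close> by blast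
    have "(g + h) + nscale (k + l) c = (g + nscale k c) + (h + nscale l c)"
      by (simp add: nscale_add algebra_simps)
    then show ?thesis using S(2)[OF kl] by (intro exI[of _ "k + l"]) (simp only:)
  qed
  have "zm.subspace H"
  proof (rule subspaceI_group)
    show "0 \<in> H" unfolding H_def using S(1) by (auto intro!: exI[of _ "0::nat"])
    show "x + y \<in> H" if "x \<in> H" "y \<in> H" for x y
      using that add[of x y] add[of "- x" "- y"] unfolding H_def by (simp add: algebra_simps)
    show "- x \<in> H" if "x \<in> H" for x using that unfolding H_def by (simp add: add.commute)
  qed
  moreover have "A \<subseteq> H"
  proof
    fix a assume a: "a \<in> A"
    have "a + nscale 0 c \<in> ?S" using a by (auto intro: hull_inc)
    moreover have "- a + nscale 1 c = \<Sum>(A - {a})"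
      using a assms by (simp add: c_def nscale_Suc sum.remove)
    then have "- a + nscale 1 c \<in> ?S" using sumS[of "A - {a}"] by simp
    ultimately show "a \<in> H" unfolding H_def by blast
  qed
  ultimately have "zm.span A \<subseteq> H" by (rule zm.span_minimal[rotated])
  moreover have "c \<in> ?S" unfolding c_def using sumS by blast
  ultimately show ?thesis unfolding H_def by blast
qed

section \<open>Group orderings and exponents of a product\<close>

definition cone_max :: "'a::ab_group_add set \<Rightarrow> 'a set \<Rightarrow> 'a \<Rightarrow> bool" where
  "cone_max P A m \<longleftrightarrow> m \<in> A \<and> (\<forall>a\<in>A. m - a \<in> P)"

lemma cone_max_unique:
  assumes "pointed_cone P" "cone_max P A m" "cone_max P A n" shows "m = n"
proof -
  have "m - n \<in> P" "- (m - n) \<in> P" using assms unfolding cone_max_def by auto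
  then have "m - n = 0" using assms(1) unfolding pointed_cone_def by blast
  then show ?thesis by simp
qed

text \<open>
  The sum of the largest exponents of the factors arises from no other pair of exponents, so that its
  coefficient in the product is a product of two nonzero coefficients.
\<close>

lemma cone_max_mult:
  fixes f g :: "('g::torsion_free_ab_group_add, 'k::field) group_algebra"
  assumes P: "pointed_cone P" and m: "cone_max P (support f) m" and n: "cone_max P (support g) n"
  shows "cone_max P (support (f * g)) (m + n)"
proof -
  have uniq: "a = m \<and> b = n" if "a \<in> support f" "b \<in> support g" "m + n = a + b" for a b
  proof -
    have "n - b = - (m - a)" using that(3) by (simp add: algebra_simps)
    then have "m - a \<in> P" "- (m - a) \<in> P" using m n that unfolding cone_max_def by metis+
    then have "m - a = 0" using P unfolding pointed_cone_def by blast
    with that(3) show ?thesis by simp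
  qed
  let ?lf = "Poly_Mapping.lookup (poly_mapping_of f)" and ?lg = "Poly_Mapping.lookup (poly_mapping_of g)"
  have "Poly_Mapping.lookup (poly_mapping_of (f * g)) (m + n) = (\<Sum>(a, b). ?lf a * ?lg b when m + n = a + b)"
    by (simp add: times_group_algebra.rep_eq times_poly_mapping.rep_eq prod_fun_unfold_prod)
  also have "(\<lambda>(a, b). ?lf a * ?lg b when m + n = a + b) = (\<lambda>x. ?lf m * ?lg n when x = (m, n))"
  proof (rule ext, clarify)
    fix a b
    show "(?lf a * ?lg b when m + n = a + b) = (?lf m * ?lg n when (a, b) = (m, n))"
      using uniq[of a b] by (cases "a \<in> support f \<and> b \<in> support g") (auto simp: in_keys_iff when_def)
  qed
  also have "Sum_any \<dots> = ?lf m * ?lg n" by (rule Sum_any_when_equal)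
  finally have "m + n \<in> support (f * g)" using m n unfolding cone_max_def by (simp add: in_keys_iff)
  moreover have "(m + n) - s \<in> P" if s: "s \<in> support (f * g)" for s
  proof -
    obtain a b where ab: "a \<in> support f" "b \<in> support g" "s = a + b" using support_mult[of f g] s by blast
    then have "(m - a) + (n - b) \<in> P"
      using m n P unfolding cone_max_def pointed_cone_def add_submonoid_def by blast
    then show ?thesis unfolding ab by (simp add: algebra_simps)
  qed
  ultimately show ?thesis unfolding cone_max_def by blast
qed

text \<open>
  Orderings are given by their cones of nonnegative elements. They are restricted to \<open>G\<close> since coordinates
  with respect to a basis of \<open>G\<close> are additive only there.
\<close>

locale ordered_subgroup =
  fixes G :: "'g::torsion_free_ab_group_add set"
  assumes subspace: "zm.subspace G"
begin

definition functional :: "('g \<Rightarrow> int) \<Rightarrow> bool" where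
  "functional \<phi> \<longleftrightarrow> (\<forall>x\<in>G. \<forall>y\<in>G. \<phi> (x + y) = \<phi> x + \<phi> y)"

definition ordering :: "'g set \<Rightarrow> bool" where
  "ordering P \<longleftrightarrow> pointed_cone P \<and> P \<subseteq> G \<and> (\<forall>x\<in>G. x \<in> P \<or> - x \<in> P)"

definition lex :: "('g \<Rightarrow> int) \<Rightarrow> 'g set \<Rightarrow> 'g set" where
  "lex \<phi> P = {x \<in> G. \<phi> x > 0 \<or> \<phi> x = 0 \<and> x \<in> P}"

lemma functional_add: "functional \<phi> \<Longrightarrow> x \<in> G \<Longrightarrow> y \<in> G \<Longrightarrow> \<phi> (x + y) = \<phi> x + \<phi> y"
  unfolding functional_def by blast

lemma functional_zero: "functional \<phi> \<Longrightarrow> \<phi> 0 = 0"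
  using functional_add[of \<phi> 0 0] zm.subspace_0[OF subspace] by simp

lemma functional_uminus: "functional \<phi> \<Longrightarrow> x \<in> G \<Longrightarrow> \<phi> (- x) = - \<phi> x"
  using functional_add[of \<phi> x "- x"] functional_zero[of \<phi>] zm.subspace_neg[OF subspace] by simp

lemma functional_diff: "functional \<phi> \<Longrightarrow> x \<in> G \<Longrightarrow> y \<in> G \<Longrightarrow> \<phi> (x - y) = \<phi> x - \<phi> y"
  using functional_add[of \<phi> x "- y"] functional_uminus[of \<phi> y] zm.subspace_neg[OF subspace] by simp

lemma nscale_in: "x \<in> G \<Longrightarrow> nscale n x \<in> G"
  using zm.subspace_scale[OF subspace, of x "int n"] by (simp add: zscale_of_nat)

lemma functional_nscale: "functional \<phi> \<Longrightarrow> x \<in> G \<Longrightarrow> \<phi> (nscale n x) = int n * \<phi> x"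
  by (induction n) (auto simp: functional_zero nscale_Suc functional_add nscale_in algebra_simps)

lemma functional_minus: "functional \<phi> \<Longrightarrow> functional (\<lambda>x. - \<phi> x)"
  unfolding functional_def by simp

lemma functional_combination:
  "functional \<phi> \<Longrightarrow> functional \<psi> \<Longrightarrow> functional (\<lambda>x. a * \<phi> x - b * \<psi> x)"
  unfolding functional_def by (simp add: algebra_simps)

lemma ordering_exists: "\<exists>P. ordering P"
proof -
  obtain P :: "'g set" where "pointed_cone P" "\<forall>x. x \<in> P \<or> - x \<in> P" using ex_total_cone by blast
  then have "ordering (P \<inter> G)"
    using subspace_add_submonoid[OF subspace] zm.subspace_neg[OF subspace]
    unfolding ordering_def pointed_cone_def add_submonoid_def by auto
  then show ?thesis ..
qed

lemma ordering_reverse: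
  assumes P: "ordering P" shows "ordering (uminus ` P)"
proof -
  have mem: "x \<in> uminus ` P \<longleftrightarrow> - x \<in> P" for x by (auto simp: image_iff intro: bexI[of _ "- x"])
  have P': "0 \<in> P" "\<And>x y. x \<in> P \<Longrightarrow> y \<in> P \<Longrightarrow> x + y \<in> P" "\<And>x. x \<in> P \<Longrightarrow> - x \<in> P \<Longrightarrow> x = 0" "P \<subseteq> G"
    "\<And>x. x \<in> G \<Longrightarrow> x \<in> P \<or> - x \<in> P"
    using P unfolding ordering_def pointed_cone_def add_submonoid_def by auto
  show ?thesis unfolding ordering_def pointed_cone_def add_submonoid_def
  proof (intro conjI ballI impI)
    show "0 \<in> uminus ` P" using P'(1) unfolding mem by simp
    show "x + y \<in> uminus ` P" if "x \<in> uminus ` P" "y \<in> uminus ` P" for x y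
      using that P'(2)[of "- x" "- y"] unfolding mem by (simp add: add.commute)
    show "x = 0" if "x \<in> uminus ` P" "- x \<in> uminus ` P" for x using that P'(3)[of x] unfolding mem by simp
    show "uminus ` P \<subseteq> G" using P'(4) zm.subspace_neg[OF subspace] by auto
    show "x \<in> uminus ` P \<or> - x \<in> uminus ` P" if "x \<in> G" for x
      using P'(5)[OF that] unfolding mem by auto
  qed
qed

lemma ordering_lex:
  assumes \<phi>: "functional \<phi>" and P: "ordering P" shows "ordering (lex \<phi> P)"
proof -
  have P': "0 \<in> P" "\<And>x y. x \<in> P \<Longrightarrow> y \<in> P \<Longrightarrow> x + y \<in> P" "\<And>x. x \<in> P \<Longrightarrow> - x \<in> P \<Longrightarrow> x = 0"
    "\<And>x. x \<in> G \<Longrightarrow> x \<in> P \<or> - x \<in> P"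
    using P unfolding ordering_def pointed_cone_def add_submonoid_def by auto
  show ?thesis unfolding ordering_def pointed_cone_def add_submonoid_def
  proof (intro conjI ballI impI)
    show "0 \<in> lex \<phi> P" unfolding lex_def using P'(1) zm.subspace_0[OF subspace] functional_zero[OF \<phi>] by simp
    show "lex \<phi> P \<subseteq> G" unfolding lex_def by blast
    show "x + y \<in> lex \<phi> P" if "x \<in> lex \<phi> P" "y \<in> lex \<phi> P" for x y
      using that P'(2) zm.subspace_add[OF subspace] functional_add[OF \<phi>] unfolding lex_def by auto
    show "x = 0" if "x \<in> lex \<phi> P" "- x \<in> lex \<phi> P" for x
      using that P'(3) functional_uminus[OF \<phi>] unfolding lex_def by auto
    show "x \<in> lex \<phi> P \<or> - x \<in> lex \<phi> P" if "x \<in> G" for x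
      using that P'(4) functional_uminus[OF \<phi>] zm.subspace_neg[OF subspace] unfolding lex_def by fastforce
  qed
qed

lemma cone_max_exists:
  assumes P: "ordering P" and A: "finite A" "A \<noteq> {}" "A \<subseteq> G"
  shows "\<exists>m. cone_max P A m"
  using A
proof (induction A rule: finite_ne_induct)
  case (singleton x)
  then show ?case using P unfolding cone_max_def ordering_def pointed_cone_def add_submonoid_def by auto
next
  case (insert x A)
  then obtain m where m: "cone_max P A m" by blast
  have P': "0 \<in> P" "\<And>u v. u \<in> P \<Longrightarrow> v \<in> P \<Longrightarrow> u + v \<in> P"
    using P unfolding ordering_def pointed_cone_def add_submonoid_def by auto
  show ?case
  proof (cases "m - x \<in> P")
    case True
    then show ?thesis using m unfolding cone_max_def by blast
  next
    case False
    have "m - x \<in> G" using m insert.prems zm.subspace_diff[OF subspace] unfolding cone_max_def by blast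
    then have xm: "x - m \<in> P" using P False unfolding ordering_def by fastforce
    have "x - a \<in> P" if "a \<in> A" for a
      using P'(2)[OF xm, of "m - a"] m that unfolding cone_max_def by simp
    then show ?thesis using P'(1) unfolding cone_max_def by (intro exI[of _ x]) auto
  qed
qed

lemma cone_max_lexD:
  assumes "functional \<phi>" "cone_max (lex \<phi> P) A m" "A \<subseteq> G" "a \<in> A"
  shows "\<phi> a \<le> \<phi> m" "\<phi> a = \<phi> m \<Longrightarrow> m - a \<in> P"
proof -
  have "m - a \<in> lex \<phi> P" "m \<in> G" "a \<in> G" using assms unfolding cone_max_def by auto
  then have "m - a \<in> lex \<phi> P" "\<phi> (m - a) = \<phi> m - \<phi> a"
    using functional_diff[OF assms(1)] by auto
  then show "\<phi> a \<le> \<phi> m" "\<phi> a = \<phi> m \<Longrightarrow> m - a \<in> P" unfolding lex_def by auto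
qed

lemma cone_max_lexI:
  assumes "functional \<phi>" "m \<in> A" "A \<subseteq> G"
    "\<And>a. a \<in> A \<Longrightarrow> a \<noteq> m \<Longrightarrow> \<phi> a < \<phi> m \<or> \<phi> a = \<phi> m \<and> m - a \<in> P" "0 \<in> P"
  shows "cone_max (lex \<phi> P) A m"
proof -
  have "m - a \<in> lex \<phi> P" if a: "a \<in> A" for a
  proof (cases "a = m")
    case True
    then show ?thesis using assms(1,5) zm.subspace_0[OF subspace] functional_zero unfolding lex_def by simp
  next
    case False
    have "m \<in> G" "a \<in> G" using assms(2,3) a by auto
    then have "\<phi> (m - a) = \<phi> m - \<phi> a" "m - a \<in> G"
      by (simp_all add: functional_diff[OF assms(1)] zm.subspace_diff[OF subspace])
    then show ?thesis using assms(4)[OF a False] unfolding lex_def by auto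
  qed
  then show ?thesis using assms(2) unfolding cone_max_def by blast
qed

text \<open>
  The support of \<open>f * g\<close> has a unique lowest point \<open>w1\<close> and a unique highest point \<open>w2\<close> with respect to
  \<open>\<phi>\<close>, and these two points form the top edge with respect to \<open>\<omega>\<close>. The edge is the sum of
  corresponding edges of the factors. By the last assumption it is too short to be divided, so that
  the edge of one factor is a point. As it runs from the bottom to the top of that factor with respect to
  \<open>\<phi>\<close>, the factor has only one exponent.
\<close>

lemma monomial_factor:
  fixes f g :: "('g, 'k::field) group_algebra"
  assumes \<phi>: "functional \<phi>" and \<omega>: "functional \<omega>"
    and fg: "f \<noteq> 0" "g \<noteq> 0" "support f \<subseteq> G" "support g \<subseteq> G" "support (f * g) \<subseteq> G"
    and w: "w1 \<in> support (f * g)" "w2 \<in> support (f * g)" "\<phi> w1 < \<phi> w2" "\<omega> w1 = \<omega> w2"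
    and inner: "\<And>s. s \<in> support (f * g) \<Longrightarrow> s \<noteq> w1 \<Longrightarrow> s \<noteq> w2 \<Longrightarrow> \<phi> w1 < \<phi> s \<and> \<phi> s < \<phi> w2 \<and> \<omega> s < \<omega> w1"
    and short: "\<And>d. d \<in> G \<Longrightarrow> \<omega> d = 0 \<Longrightarrow> \<phi> (w2 - w1) dvd \<phi> d"
  shows "(\<exists>a. support f = {a}) \<or> (\<exists>a. support g = {a})"
proof -
  let ?H = "support (f * g)" and ?n = "\<lambda>x. - \<phi> x"
  obtain P where P: "ordering P" using ordering_exists by blast
  define P' where "P' = uminus ` P"
  have P': "ordering P'" unfolding P'_def by (rule ordering_reverse[OF P])
  note \<phi>' = functional_minus[OF \<phi>]
  have zero: "0 \<in> Q" if "ordering Q" for Q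
    using that unfolding ordering_def pointed_cone_def add_submonoid_def by blast
  have cone: "pointed_cone Q" if "ordering Q" for Q using that unfolding ordering_def by blast
  have "\<exists>m n. cone_max Q (support f) m \<and> cone_max Q (support g) n \<and> (\<forall>w. cone_max Q ?H w \<longrightarrow> w = m + n)"
    if Q: "ordering Q" for Q
  proof -
    obtain m n where mn: "cone_max Q (support f) m" "cone_max Q (support g) n"
      using cone_max_exists[OF Q] fg support_zero_iff[of f] support_zero_iff[of g] finite_keys by metis
    then show ?thesis using cone_max_mult[OF cone[OF Q] mn] cone_max_unique[OF cone[OF Q]] by blast
  qed
  note split = this
  note lP = ordering_lex[OF \<phi> P] and lP' = ordering_lex[OF \<phi> P'] and nP = ordering_lex[OF \<phi>' P]
  obtain m1 m2 where m: "cone_max (lex \<omega> (lex \<phi> P)) (support f) m1" "cone_max (lex \<omega> (lex \<phi> P)) (support g) m2"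
    "\<And>w. cone_max (lex \<omega> (lex \<phi> P)) ?H w \<Longrightarrow> w = m1 + m2"
    using split[OF ordering_lex[OF \<omega> lP]] by blast
  obtain n1 n2 where n: "cone_max (lex \<omega> (lex ?n P)) (support f) n1" "cone_max (lex \<omega> (lex ?n P)) (support g) n2"
    "\<And>w. cone_max (lex \<omega> (lex ?n P)) ?H w \<Longrightarrow> w = n1 + n2"
    using split[OF ordering_lex[OF \<omega> nP]] by blast
  obtain M1 M2 where M: "cone_max (lex \<phi> P) (support f) M1" "cone_max (lex \<phi> P) (support g) M2"
    "\<And>w. cone_max (lex \<phi> P) ?H w \<Longrightarrow> w = M1 + M2"
    using split[OF lP] by blast
  obtain N1 N2 where N: "cone_max (lex \<phi> P') (support f) N1" "cone_max (lex \<phi> P') (support g) N2"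
    "\<And>w. cone_max (lex \<phi> P') ?H w \<Longrightarrow> w = N1 + N2"
    using split[OF lP'] by blast
  obtain L1 L2 where L: "cone_max (lex ?n P) (support f) L1" "cone_max (lex ?n P) (support g) L2"
    "\<And>w. cone_max (lex ?n P) ?H w \<Longrightarrow> w = L1 + L2"
    using split[OF nP] by blast
  have w2w1: "w2 - w1 \<in> G" "\<phi> (w2 - w1) = \<phi> w2 - \<phi> w1"
    using w fg zm.subspace_diff[OF subspace] functional_diff[OF \<phi>] by blast+
  then have w1w2: "w1 - w2 \<in> G" "\<phi> (w1 - w2) = \<phi> w1 - \<phi> w2"
    using w fg zm.subspace_diff[OF subspace] functional_diff[OF \<phi>] by blast+
  have "cone_max (lex \<omega> (lex \<phi> P)) ?H w2"
  proof (rule cone_max_lexI[OF \<omega> w(2) fg(5) _ zero[OF lP]])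
    fix a assume "a \<in> ?H" "a \<noteq> w2"
    then show "\<omega> a < \<omega> w2 \<or> \<omega> a = \<omega> w2 \<and> w2 - a \<in> lex \<phi> P"
      using inner[of a] w w2w1 by (cases "a = w1") (auto simp: lex_def)
  qed
  then have m_eq: "w2 = m1 + m2" by (rule m(3))
  have "cone_max (lex \<omega> (lex ?n P)) ?H w1"
  proof (rule cone_max_lexI[OF \<omega> w(1) fg(5) _ zero[OF nP]])
    fix a assume "a \<in> ?H" "a \<noteq> w1"
    then show "\<omega> a < \<omega> w1 \<or> \<omega> a = \<omega> w1 \<and> w1 - a \<in> lex ?n P"
      using inner[of a] w w1w2 by (cases "a = w2") (auto simp: lex_def)
  qed
  then have n_eq: "w1 = n1 + n2" by (rule n(3))
  have top: "\<phi> a < \<phi> w2" if "a \<in> ?H" "a \<noteq> w2" for a using inner[of a] w that by (cases "a = w1") auto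
  have bottom: "- \<phi> a < - \<phi> w1" if "a \<in> ?H" "a \<noteq> w1" for a using inner[of a] w that by (cases "a = w2") auto
  have M_eq: "w2 = M1 + M2" using top by (intro M(3) cone_max_lexI[OF \<phi> w(2) fg(5) _ zero[OF P]]) auto
  have N_eq: "w2 = N1 + N2" using top by (intro N(3) cone_max_lexI[OF \<phi> w(2) fg(5) _ zero[OF P']]) auto
  have L_eq: "w1 = L1 + L2" using bottom by (intro L(3) cone_max_lexI[OF \<phi>' w(1) fg(5) _ zero[OF P]]) auto
  have in_f: "m1 \<in> support f" "n1 \<in> support f" "M1 \<in> support f" "N1 \<in> support f" "L1 \<in> support f"
    and in_g: "m2 \<in> support g" "n2 \<in> support g" "M2 \<in> support g" "N2 \<in> support g" "L2 \<in> support g"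
    using m(1,2) n(1,2) M(1,2) N(1,2) L(1,2) unfolding cone_max_def by auto
  have in_G: "m1 \<in> G" "n1 \<in> G" "M1 \<in> G" "N1 \<in> G" "L1 \<in> G" "m2 \<in> G" "n2 \<in> G" "M2 \<in> G" "N2 \<in> G" "L2 \<in> G"
    using in_f in_g fg(3,4) by blast+
  note Mf = cone_max_lexD[OF \<phi> M(1) fg(3)] and Mg = cone_max_lexD[OF \<phi> M(2) fg(4)]
    and Nf = cone_max_lexD[OF \<phi> N(1) fg(3)] and Ng = cone_max_lexD[OF \<phi> N(2) fg(4)]
    and Lf = cone_max_lexD(1)[OF \<phi>' L(1) fg(3)] and Lg = cone_max_lexD(1)[OF \<phi>' L(2) fg(4)]
  have "\<phi> N1 = \<phi> M1" "\<phi> N2 = \<phi> M2"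
    using Mf(1)[OF in_f(4)] Nf(1)[OF in_f(3)] Mg(1)[OF in_g(4)] Ng(1)[OF in_g(3)] by auto
  then have "M1 - N1 \<in> P" "M2 - N2 \<in> P" using Mf(2)[OF in_f(4)] Mg(2)[OF in_g(4)] by auto
  moreover have "M2 - N2 = - (M1 - N1)" using M_eq N_eq by (simp add: algebra_simps)
  ultimately have "M1 - N1 = 0" using cone[OF P] unfolding pointed_cone_def by metis
  then have MN: "N1 = M1" "N2 = M2" using M_eq N_eq by auto
  have pointed: "x = 0" if "x \<in> P" "x \<in> P'" for x
    using that cone[OF P] unfolding P'_def pointed_cone_def by auto
  have only_f: "a = M1" if "a \<in> support f" "\<phi> a = \<phi> M1" for a
    using pointed[of "M1 - a"] Mf(2)[OF that] Nf(2)[OF that(1)] that(2) MN by auto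
  have only_g: "a = M2" if "a \<in> support g" "\<phi> a = \<phi> M2" for a
    using pointed[of "M2 - a"] Mg(2)[OF that] Ng(2)[OF that(1)] that(2) MN by auto
  have "\<phi> m1 + \<phi> m2 = \<phi> M1 + \<phi> M2" "\<phi> n1 + \<phi> n2 = \<phi> L1 + \<phi> L2"
    using m_eq M_eq n_eq L_eq functional_add[OF \<phi>] in_G by metis+
  then have \<phi>_eq: "\<phi> m1 = \<phi> M1" "\<phi> m2 = \<phi> M2" "\<phi> n1 = \<phi> L1" "\<phi> n2 = \<phi> L2"
    using Mf(1)[OF in_f(1)] Mg(1)[OF in_g(1)] Lf[OF in_f(2)] Lg[OF in_g(2)] by linarith+
  have "\<omega> m1 = \<omega> n1" "\<omega> m2 = \<omega> n2"
    using cone_max_lexD(1)[OF \<omega> m(1) fg(3) in_f(2)] cone_max_lexD(1)[OF \<omega> n(1) fg(3) in_f(1)]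
      cone_max_lexD(1)[OF \<omega> m(2) fg(4) in_g(2)] cone_max_lexD(1)[OF \<omega> n(2) fg(4) in_g(1)] by linarith+
  then have "\<omega> (m1 - n1) = 0" "\<omega> (m2 - n2) = 0"
    using functional_diff[OF \<omega>] in_G by auto
  then have "\<phi> (w2 - w1) dvd \<phi> (m1 - n1)" "\<phi> (w2 - w1) dvd \<phi> (m2 - n2)"
    using short in_G zm.subspace_diff[OF subspace] by blast+
  then have dvd: "\<phi> w2 - \<phi> w1 dvd \<phi> M1 - \<phi> L1" "\<phi> w2 - \<phi> w1 dvd \<phi> M2 - \<phi> L2"
    using w2w1 functional_diff[OF \<phi>] in_G \<phi>_eq by auto
  have "\<phi> w2 - \<phi> w1 = (\<phi> M1 - \<phi> L1) + (\<phi> M2 - \<phi> L2)"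
    using M_eq L_eq functional_add[OF \<phi>] in_G by auto
  moreover have "\<phi> L1 \<le> \<phi> M1" "\<phi> L2 \<le> \<phi> M2" using Mf(1)[OF in_f(5)] Mg(1)[OF in_g(5)] by auto
  ultimately have "\<phi> M1 = \<phi> L1 \<or> \<phi> M2 = \<phi> L2"
    using dvd zdvd_imp_le[of "\<phi> w2 - \<phi> w1" "\<phi> M1 - \<phi> L1"] zdvd_imp_le[of "\<phi> w2 - \<phi> w1" "\<phi> M2 - \<phi> L2"] by linarith
  then show ?thesis
  proof
    assume eq: "\<phi> M1 = \<phi> L1"
    have "a = M1" if "a \<in> support f" for a using only_f[OF that] Mf(1)[OF that] Lf[OF that] eq by linarith
    then have "support f = {M1}" using in_f by blast
    then show ?thesis by blast
  next
    assume eq: "\<phi> M2 = \<phi> L2"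
    have "a = M2" if "a \<in> support g" for a using only_g[OF that] Mg(1)[OF that] Lg[OF that] eq by linarith
    then have "support g = {M2}" using in_g by blast
    then show ?thesis by blast
  qed
qed

lemma Max_support_mult:
  fixes f g :: "('g, 'k::field) group_algebra"
  assumes \<phi>: "functional \<phi>" and fg: "f \<noteq> 0" "g \<noteq> 0" "support f \<subseteq> G" "support g \<subseteq> G" "support (f * g) \<subseteq> G"
  shows "Max (\<phi> ` support (f * g)) = Max (\<phi> ` support f) + Max (\<phi> ` support g)"
proof -
  obtain P where P: "ordering P" using ordering_exists by blast
  note lP = ordering_lex[OF \<phi> P]
  have cone: "pointed_cone (lex \<phi> P)" using lP unfolding ordering_def by blast
  obtain m n where mn: "cone_max (lex \<phi> P) (support f) m" "cone_max (lex \<phi> P) (support g) n"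
    using cone_max_exists[OF lP] fg support_zero_iff[of f] support_zero_iff[of g] finite_keys by metis
  have Max: "Max (\<phi> ` A) = \<phi> m" if "cone_max (lex \<phi> P) A m" "finite A" "A \<subseteq> G" for A m
    using that cone_max_lexD(1)[OF \<phi> that(1,3)] unfolding cone_max_def by (intro Max_eqI) auto
  have "m \<in> G" "n \<in> G" using mn fg unfolding cone_max_def by auto
  then show ?thesis
    using Max[OF mn(1)] Max[OF mn(2)] Max[OF cone_max_mult[OF cone mn]] fg functional_add[OF \<phi>] by simp
qed

text \<open>
  The length of the image of \<open>A\<close> under \<open>\<phi>\<close>. It is written with two maxima since both are additive on products.
\<close>

definition width :: "('g \<Rightarrow> int) \<Rightarrow> 'g set \<Rightarrow> int" where
  "width \<phi> A = Max (\<phi> ` A) + Max ((\<lambda>x. - \<phi> x) ` A)"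

lemma width_mult_le:
  fixes f g :: "('g, 'k::field) group_algebra"
  assumes \<phi>: "functional \<phi>" and fg: "f \<noteq> 0" "g \<noteq> 0" "support f \<subseteq> G" "support g \<subseteq> G" "support (f * g) \<subseteq> G"
  shows "width \<phi> (support f) \<le> width \<phi> (support (f * g))"
proof -
  obtain a where a: "a \<in> support g" using fg(2) support_zero_iff[of g] by blast
  have "\<phi> a \<le> Max (\<phi> ` support g)" "- \<phi> a \<le> Max ((\<lambda>x. - \<phi> x) ` support g)"
    using a by (auto intro!: Max_ge)
  then show ?thesis
    unfolding width_def Max_support_mult[OF \<phi> fg] Max_support_mult[OF functional_minus[OF \<phi>] fg] by linarith
qed

end

section \<open>Primes in a residue class\<close>

context ordered_subgroup
begin

lemma unit_of_single_exponent:
  fixes f :: "('g, 'k::field) group_algebra"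
  assumes "support f = {a}" "a \<in> G"
  shows "unit_in (monoid_algebra G) (to_fract f)"
proof -
  define c where "c = Poly_Mapping.lookup (poly_mapping_of f) a"
  have f: "f = monomial c a" using sum_of_monomials[of f] assms(1) unfolding c_def by simp
  have "c \<noteq> 0" using assms(1) unfolding c_def by (metis in_keys_iff singletonI)
  then have "to_fract f * to_fract (monomial (inverse c) (- a)) = 1"
    unfolding f by (simp add: monomial_mult monomial_one flip: to_fract_mult)
  moreover have "- a \<in> G" using assms(2) by (rule zm.subspace_neg[OF subspace])
  ultimately show ?thesis
    unfolding unit_in_def f using assms(2) monomial_in_monoid_algebra by blast
qed

lemma prime_of_short_edge:
  fixes h :: "('g, 'k::field) group_algebra"
  assumes factorial: "factorial_in (monoid_algebra G :: ('g, 'k) group_algebra fract set)"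
    and \<phi>: "functional \<phi>" and \<omega>: "functional \<omega>"
    and h: "support h \<subseteq> G"
    and w: "w1 \<in> support h" "w2 \<in> support h" "\<phi> w1 < \<phi> w2" "\<omega> w1 = \<omega> w2"
    and inner: "\<And>s. s \<in> support h \<Longrightarrow> s \<noteq> w1 \<Longrightarrow> s \<noteq> w2 \<Longrightarrow> \<phi> w1 < \<phi> s \<and> \<phi> s < \<phi> w2 \<and> \<omega> s < \<omega> w1"
    and short: "\<And>d. d \<in> G \<Longrightarrow> \<omega> d = 0 \<Longrightarrow> \<phi> (w2 - w1) dvd \<phi> d"
  shows "prime_in (monoid_algebra G) (to_fract h)"
proof -
  interpret L: subdomain "monoid_algebra G :: ('g, 'k) group_algebra fract set"
    by (rule subdomain_monoid_algebra[OF subspace_add_submonoid[OF subspace]])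
  have h0: "h \<noteq> 0" using w(1) support_zero_iff[of h] by blast
  have rep: "\<exists>f. x = to_fract f \<and> support f \<subseteq> G" if "x \<in> monoid_algebra G" for x :: "('g, 'k) group_algebra fract"
    using that unfolding monoid_algebra_def by blast
  show ?thesis
  proof (rule L.irreducible_imp_prime_in[OF factorial])
    show "to_fract h \<in> monoid_algebra G" using h unfolding monoid_algebra_def by blast
    show "to_fract h \<noteq> 0" using h0 by simp
    show "\<not> unit_in (monoid_algebra G) (to_fract h)"
    proof
      assume "unit_in (monoid_algebra G) (to_fract h)"
      then obtain g where g: "support g \<subseteq> G" "to_fract h * to_fract g = 1"
        using rep unfolding unit_in_def by metis
      then have hg: "h * g = 1" by (metis to_fract_1 to_fract_eq_iff to_fract_mult)
      have one: "support (1 :: ('g, 'k) group_algebra) = {0}" by (simp add: one_group_algebra.rep_eq)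
      have "g \<noteq> 0" using hg by auto
      then have "width \<phi> (support h) \<le> width \<phi> (support (h * g))"
        using h0 h g(1) zm.subspace_0[OF subspace] by (intro width_mult_le[OF \<phi>]) (auto simp: hg one)
      moreover have "width \<phi> (support (h * g)) = 0" unfolding hg one width_def by simp
      moreover have "\<phi> w2 \<le> Max (\<phi> ` support h)" "- \<phi> w1 \<le> Max ((\<lambda>x. - \<phi> x) ` support h)"
        using w(1,2) by (auto intro!: Max_ge)
      ultimately show False using w(3) unfolding width_def by linarith
    qed
    show "unit_in (monoid_algebra G) a \<or> unit_in (monoid_algebra G) b"
      if ab: "a \<in> monoid_algebra G" "b \<in> monoid_algebra G" "to_fract h = a * b" for a b
    proof -
      obtain f g where fg: "a = to_fract f" "b = to_fract g" "support f \<subseteq> G" "support g \<subseteq> G"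
        using rep ab by metis
      then have hfg: "h = f * g" using ab(3) by (metis to_fract_eq_iff to_fract_mult)
      then have "f \<noteq> 0" "g \<noteq> 0" using h0 by auto
      then have "(\<exists>a. support f = {a}) \<or> (\<exists>a. support g = {a})"
        by (rule monomial_factor[OF \<phi> \<omega> _ _ fg(3,4) h[unfolded hfg] w(1,2)[unfolded hfg] w(3,4)
            inner[unfolded hfg] short])
      then show ?thesis using unit_of_single_exponent fg by fastforce
    qed
  qed
qed

text \<open>
  Given coordinates \<open>e1\<close>, \<open>e2\<close> and an interior element \<open>c\<close>, the functional \<open>\<phi>\<close> vanishes on \<open>c\<close> and
  \<open>\<omega>\<close> vanishes on \<open>v = b1 + 2 j b2\<close>. For large \<open>j\<close>, the points \<open>- j b2\<close> and \<open>- j b2 + v\<close> lie below and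
  above the support of \<open>f\<close> with respect to \<open>\<phi>\<close>. A large multiple of \<open>c\<close> moves both points into the cone and
  above the support of \<open>f\<close> with respect to \<open>\<omega>\<close> without changing \<open>\<phi>\<close>. The edge between them is short
  since \<open>v\<close> has first coordinate \<open>1\<close>.
\<close>

lemma prime_near:
  fixes f :: "('g, 'k::field) group_algebra" and n :: nat
  assumes factorial: "factorial_in (monoid_algebra G :: ('g, 'k) group_algebra fract set)"
    and e: "functional e1" "functional e2" and b: "b1 \<in> G" "b2 \<in> G"
    and coord: "e1 b1 = 1" "e1 b2 = 0" "e2 b1 = 0" "e2 b2 = 1"
    and S: "add_submonoid S" "S \<subseteq> G" and c: "c \<in> S" "e1 c > 0"
    and interior: "\<And>g. g \<in> G \<Longrightarrow> \<exists>k. g + nscale k c \<in> S"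
    and f: "support f \<subseteq> G"
  defines "\<phi> \<equiv> \<lambda>x. e1 c * e2 x - e2 c * e1 x"
  assumes j: "\<And>s. s \<in> support f \<Longrightarrow> \<bar>\<phi> s\<bar> + \<bar>e2 c\<bar> < int j" "\<bar>e2 c\<bar> < int j"
  shows "\<exists>h. prime_in (monoid_algebra G) (to_fract h) \<and> support h \<subseteq> G \<and>
    (\<exists>d\<in>monoid_algebra S. to_fract h = to_fract f + variable c ^ n * d) \<and>
    width \<phi> (support h) = 2 * int j * e1 c - e2 c"
proof -
  have \<phi>: "functional \<phi>" unfolding \<phi>_def by (rule functional_combination[OF e(2,1)])
  define \<omega> where "\<omega> = (\<lambda>x. (2 * int j) * e1 x - 1 * e2 x)"
  have \<omega>: "functional \<omega>" unfolding \<omega>_def by (rule functional_combination[OF e])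
  have cG: "c \<in> G" using c S by blast
  define E where "E = Max (insert 0 ((\<lambda>s. \<bar>\<omega> s\<bar>) ` support f))"
  have E: "\<bar>\<omega> s\<bar> \<le> E" if "s \<in> support f" for s unfolding E_def using that by auto
  have E0: "0 \<le> E" unfolding E_def by auto
  have jb: "nscale j b2 \<in> G" "- nscale j b2 \<in> G" "b1 + nscale j b2 \<in> G"
    using b nscale_in zm.subspace_neg[OF subspace] zm.subspace_add[OF subspace] by auto
  obtain k1 where k1: "- nscale j b2 + nscale k1 c \<in> S" using interior jb by blast
  obtain k2 where k2: "b1 + nscale j b2 + nscale k2 c \<in> S" using interior jb by blast
  define N where "N = n + k1 + k2 + nat E + 1"
  define w1 where "w1 = - nscale j b2 + nscale N c"
  define w2 where "w2 = b1 + nscale j b2 + nscale N c"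
  have cS: "nscale m c \<in> S" for m using nscale_in_submonoid[OF S(1) c(1)] .
  define s1 where "s1 = (- nscale j b2 + nscale k1 c) + nscale (k2 + nat E + 1) c"
  define s2 where "s2 = (b1 + nscale j b2 + nscale k2 c) + nscale (k1 + nat E + 1) c"
  have s: "s1 \<in> S" "s2 \<in> S"
    unfolding s1_def s2_def using k1 k2 cS S(1) unfolding add_submonoid_def by blast+
  have w_s: "w1 = nscale n c + s1" "w2 = nscale n c + s2"
    unfolding w1_def w2_def s1_def s2_def N_def by (simp_all only: nscale_add ac_simps)
  have wG: "w1 \<in> G" "w2 \<in> G"
    unfolding w1_def w2_def by (rule zm.subspace_add[OF subspace _ nscale_in[OF cG]], rule jb)+
  have e_w: "e1 w1 = int N * e1 c" "e2 w1 = - int j + int N * e2 c"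
    "e1 w2 = 1 + int N * e1 c" "e2 w2 = int j + int N * e2 c"
    unfolding w1_def w2_def using b jb nscale_in[OF cG] cG coord e
    by (simp_all add: functional_add functional_diff functional_uminus functional_nscale nscale_in zm.subspace_add[OF subspace])
  have \<phi>_w: "\<phi> w1 = - (int j * e1 c)" "\<phi> w2 = int j * e1 c - e2 c"
    unfolding \<phi>_def e_w by (simp_all add: algebra_simps)
  have \<omega>_w: "\<omega> w1 = int N * (2 * int j * e1 c - e2 c) + int j" "\<omega> w2 = \<omega> w1"
    unfolding \<omega>_def e_w by (simp_all add: algebra_simps)
  have jC: "int j \<le> int j * e1 c" using c(2) mult_left_mono[of 1 "e1 c" "int j"] by simp
  have low: "\<phi> w1 < \<phi> s \<and> \<phi> s < \<phi> w2" if "s \<in> support f" for s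
    using j(1)[OF that] jC unfolding \<phi>_w by linarith
  have \<phi>_less: "\<phi> w1 < \<phi> w2" using j(2) jC unfolding \<phi>_w by linarith
  have "1 \<le> 2 * int j * e1 c - e2 c" using j(2) jC by linarith
  then have "int N \<le> int N * (2 * int j * e1 c - e2 c)"
    using mult_left_mono[of 1 "2 * int j * e1 c - e2 c" "int N"] by simp
  moreover have "E < int N" unfolding N_def using E0 by simp
  ultimately have high: "\<omega> s < \<omega> w1" if "s \<in> support f" for s
    using E[OF that] unfolding \<omega>_w by linarith
  define h where "h = f + (monomial 1 w1 + monomial 1 w2)"
  have "w1 \<notin> support f" "w2 \<notin> support f" "w1 \<noteq> w2" using low \<phi>_less by auto
  then have supp: "support h = insert w1 (insert w2 (support f))"
    unfolding h_def by (auto simp: plus_group_algebra.rep_eq in_keys_iff lookup_add lookup_single when_def split: if_splits)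
  have "prime_in (monoid_algebra G) (to_fract h)"
  proof (rule prime_of_short_edge[OF factorial \<phi> \<omega> _ _ _ \<phi>_less \<omega>_w(2)[symmetric]])
    show "support h \<subseteq> G" "w1 \<in> support h" "w2 \<in> support h" using f wG unfolding supp by auto
    show "\<phi> w1 < \<phi> s \<and> \<phi> s < \<phi> w2 \<and> \<omega> s < \<omega> w1"
      if "s \<in> support h" "s \<noteq> w1" "s \<noteq> w2" for s
      using that low high unfolding supp by blast
    show "\<phi> (w2 - w1) dvd \<phi> d" if d: "d \<in> G" "\<omega> d = 0" for d
    proof -
      have "\<phi> (w2 - w1) = 2 * int j * e1 c - e2 c"
        using functional_diff[OF \<phi> wG(2,1)] unfolding \<phi>_w by simp
      moreover have "e2 d = 2 * int j * e1 d" using d(2) unfolding \<omega>_def by simp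
      then have "\<phi> d = (2 * int j * e1 c - e2 c) * e1 d" unfolding \<phi>_def by (simp add: algebra_simps)
      ultimately show ?thesis by simp
    qed
  qed
  moreover have "support h \<subseteq> G" using f wG unfolding supp by auto
  moreover have "to_fract h = to_fract f + variable c ^ n * (variable s1 + variable s2)"
    unfolding h_def w_s variable_power by (simp add: distrib_left variable_add[unfolded to_fract_mult] del: to_fract_mult)
  moreover have "variable s1 + variable s2 \<in> (monoid_algebra S :: ('g, 'k) group_algebra fract set)"
    using s subdomain.add_closed[OF subdomain_monoid_algebra[OF S(1)]] monomial_in_monoid_algebra by blast
  moreover have "width \<phi> (support h) = 2 * int j * e1 c - e2 c"
  proof -
    have "Max (\<phi> ` support h) = \<phi> w2" using low \<phi>_less unfolding supp by (intro Max_eqI) (auto intro: less_imp_le)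
    moreover have "Max ((\<lambda>x. - \<phi> x) ` support h) = - \<phi> w1"
      using low \<phi>_less unfolding supp by (intro Max_eqI) (auto intro: less_imp_le)
    ultimately show ?thesis unfolding width_def \<phi>_w by simp
  qed
  ultimately show ?thesis by blast
qed

text \<open>
  Divisibility in both directions forces equal widths, and the widths of the primes constructed above grow
  with \<open>j\<close>.
\<close>

lemma infinitely_many_primes_near:
  fixes x :: "('g, 'k::field) group_algebra fract" and n :: nat
  assumes factorial: "factorial_in (monoid_algebra G :: ('g, 'k) group_algebra fract set)"
    and e: "functional e1" "functional e2" and b: "b1 \<in> G" "b2 \<in> G"
    and coord: "e1 b1 = 1" "e1 b2 = 0" "e2 b1 = 0" "e2 b2 = 1"
    and S: "add_submonoid S" "S \<subseteq> G" and c: "c \<in> S" "e1 c > 0"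
    and interior: "\<And>g. g \<in> G \<Longrightarrow> \<exists>k. g + nscale k c \<in> S"
    and x: "x \<in> monoid_algebra G"
  shows "infinite {(*) h ` monoid_algebra G |h. prime_in (monoid_algebra G) h \<and>
           (\<exists>d\<in>monoid_algebra S. h = x + variable c ^ n * d)}"
proof -
  let ?L = "monoid_algebra G :: ('g, 'k) group_algebra fract set"
  define \<phi> where "\<phi> = (\<lambda>x. e1 c * e2 x - e2 c * e1 x)"
  have \<phi>: "functional \<phi>" unfolding \<phi>_def by (rule functional_combination[OF e(2,1)])
  obtain f where f: "x = to_fract f" "support f \<subseteq> G" using x unfolding monoid_algebra_def by blast
  define B where "B = nat (Max (insert 0 ((\<lambda>s. \<bar>\<phi> s\<bar>) ` support f)) + \<bar>e2 c\<bar>)"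
  have "\<exists>h. prime_in ?L (to_fract h) \<and> support h \<subseteq> G \<and>
      (\<exists>d\<in>monoid_algebra S. to_fract h = x + variable c ^ n * d) \<and>
      width \<phi> (support h) = 2 * int j * e1 c - e2 c" if j: "j > B" for j
    unfolding f \<phi>_def
  proof (rule prime_near[OF factorial e b coord S c interior f(2)])
    fix s assume "s \<in> support f"
    then have "\<bar>\<phi> s\<bar> \<le> Max (insert 0 ((\<lambda>s. \<bar>\<phi> s\<bar>) ` support f))" by auto
    then show "\<bar>e1 c * e2 s - e2 c * e1 s\<bar> + \<bar>e2 c\<bar> < int j" using j unfolding B_def \<phi>_def by linarith
  next
    have "0 \<le> Max (insert 0 ((\<lambda>s. \<bar>\<phi> s\<bar>) ` support f))" by auto
    then show "\<bar>e2 c\<bar> < int j" using j unfolding B_def by linarith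
  qed
  then obtain h where h: "\<And>j. j > B \<Longrightarrow> prime_in ?L (to_fract (h j))" "\<And>j. j > B \<Longrightarrow> support (h j) \<subseteq> G"
    "\<And>j. j > B \<Longrightarrow> \<exists>d\<in>monoid_algebra S. to_fract (h j) = x + variable c ^ n * d"
    "\<And>j. j > B \<Longrightarrow> width \<phi> (support (h j)) = 2 * int j * e1 c - e2 c"
    by metis
  interpret L: subdomain ?L by (rule subdomain_monoid_algebra[OF subspace_add_submonoid[OF subspace]])
  have le: "i \<le> j" if ij: "i > B" "j > B" "(*) (to_fract (h i)) ` ?L = (*) (to_fract (h j)) ` ?L" for i j
  proof -
    have "to_fract (h j) * 1 \<in> (*) (to_fract (h i)) ` ?L" unfolding ij(3) using L.one_closed by (rule imageI)
    then obtain y where "y \<in> ?L" "to_fract (h j) = to_fract (h i) * y" by auto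
    then obtain g where g: "support g \<subseteq> G" "h j = h i * g"
      unfolding monoid_algebra_def by (metis (no_types, lifting) imageE mem_Collect_eq to_fract_eq_iff to_fract_mult)
    have "h j \<noteq> 0" using h(1)[OF ij(2)] unfolding prime_in_def by auto
    then have "h i \<noteq> 0" "g \<noteq> 0" using g(2) by auto
    then have "width \<phi> (support (h i)) \<le> width \<phi> (support (h j))"
      using h(2)[OF ij(1)] h(2)[OF ij(2)] g(1) unfolding g(2) by (intro width_mult_le[OF \<phi>]) auto
    then have "2 * int i * e1 c \<le> 2 * int j * e1 c" unfolding h(4)[OF ij(1)] h(4)[OF ij(2)] by simp
    then show ?thesis using c(2) by simp
  qed
  have "inj_on (\<lambda>j. (*) (to_fract (h j)) ` ?L) {B<..}"
  proof (rule inj_onI)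
    fix i j assume ij: "i \<in> {B<..}" "j \<in> {B<..}" "(*) (to_fract (h i)) ` ?L = (*) (to_fract (h j)) ` ?L"
    show "i = j" using le[OF _ _ ij(3)] le[OF _ _ ij(3)[symmetric]] ij(1,2) by auto
  qed
  then have "infinite ((\<lambda>j. (*) (to_fract (h j)) ` ?L) ` {B<..})"
    using infinite_Ioi[of B] finite_imageD by blast
  moreover have "(\<lambda>j. (*) (to_fract (h j)) ` ?L) ` {B<..} \<subseteq>
      {(*) h ` ?L |h. prime_in ?L h \<and> (\<exists>d\<in>monoid_algebra S. h = x + variable c ^ n * d)}"
    using h(1,3) by auto
  ultimately show ?thesis by (rule infinite_super[rotated])
qed

end

section \<open>Divisor classes of an affine monoid algebra\<close>

lemma (in field_subdomain) principal_v_product: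
  assumes I: "fractional_v_ideal D I" and y: "y \<in> quotient_field D" "y \<noteq> 0"
  shows "v_product D ((*) y ` D) I = (*) y ` I"
proof -
  have I_eq: "I = ideal_inverse D (ideal_inverse D I)" and Iq: "I \<subseteq> quotient_field D"
    and bounded: "\<exists>c\<in>D. c \<noteq> 0 \<and> (*) c ` I \<subseteq> D"
    using I unfolding fractional_v_ideal_def v_closure_def by auto
  obtain c where c: "c \<in> D" "c \<noteq> 0" "(*) c ` I \<subseteq> D" using bounded by blast
  have add: "i + i' \<in> I" if "i \<in> I" "i' \<in> I" for i i'
  proof -
    have "c * i + c * i' \<in> D" using that c by (intro add_closed) auto
    then have "(c * i + c * i') / c \<in> quotient_field D" using c by (intro quotient_fieldI)
    moreover have "(c * i + c * i') / c = i + i'" using c(2) by (simp add: add_divide_distrib)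
    ultimately have "i + i' \<in> quotient_field D" by simp
    moreover have "i \<in> ideal_inverse D (ideal_inverse D I)" "i' \<in> ideal_inverse D (ideal_inverse D I)"
      using that I_eq by auto
    ultimately have "i + i' \<in> ideal_inverse D (ideal_inverse D I)"
      unfolding ideal_inverse_def by (auto simp: distrib_right intro: add_closed)
    then show ?thesis using I_eq by simp
  qed
  have mult: "d * i \<in> I" if "d \<in> D" "i \<in> I" for d i
  proof -
    have "i \<in> ideal_inverse D (ideal_inverse D I)" using that I_eq by simp
    then have "d * i \<in> ideal_inverse D (ideal_inverse D I)"
      using that(1) quotient_field_mult subset_quotient_field
      unfolding ideal_inverse_def by (auto simp: mult.assoc intro: mult_closed)
    then show ?thesis using I_eq by simp
  qed
  have "0 \<in> ideal_inverse D (ideal_inverse D I)"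
    unfolding ideal_inverse_def using zero_closed subset_quotient_field by auto
  then have zero: "0 \<in> I" using I_eq by simp
  have sum: "(\<Sum>i<n. f i) \<in> (*) y ` I" if "\<And>i. i < n \<Longrightarrow> f i \<in> (*) y ` I" for f and n :: nat
    using that
  proof (induction n)
    case 0
    then show ?case using zero by (auto intro: image_eqI[of _ _ 0])
  next
    case (Suc n)
    have "(\<Sum>i<n. f i) \<in> (*) y ` I" "f n \<in> (*) y ` I" using Suc by auto
    then obtain i i' where "i \<in> I" "i' \<in> I" "(\<Sum>i<n. f i) = y * i" "f n = y * i'" by blast
    then have "(\<Sum>i<Suc n. f i) = y * (i + i')" "i + i' \<in> I" using add by (auto simp: distrib_left)
    then show ?case by blast
  qed
  have "ideal_product ((*) y ` D) I = (*) y ` I"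
  proof
    show "ideal_product ((*) y ` D) I \<subseteq> (*) y ` I"
    proof
      fix x assume "x \<in> ideal_product ((*) y ` D) I"
      then obtain a b and n :: nat where x: "x = (\<Sum>i<n. a i * b i)"
        and ab: "\<And>i. i < n \<Longrightarrow> a i \<in> (*) y ` D \<and> b i \<in> I"
        unfolding ideal_product_def by blast
      have "a i * b i \<in> (*) y ` I" if "i < n" for i
      proof -
        have abi: "a i \<in> (*) y ` D" "b i \<in> I" using ab[OF that] by auto
        then obtain d where d: "d \<in> D" "a i = y * d" by blast
        then have "a i * b i = y * (d * b i)" "d * b i \<in> I" using mult abi(2) by (auto simp: mult.assoc)
        then show ?thesis by blast
      qed
      then show "x \<in> (*) y ` I" unfolding x by (rule sum)
    qed
    show "(*) y ` I \<subseteq> ideal_product ((*) y ` D) I"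
    proof
      fix x assume "x \<in> (*) y ` I"
      then obtain i where i: "i \<in> I" "x = y * i" by blast
      have "y \<in> (*) y ` D" using one_closed by (intro image_eqI[of _ _ 1]) auto
      then show "x \<in> ideal_product ((*) y ` D) I"
        using ideal_productI[of "Suc 0" "\<lambda>_. y" "(*) y ` D" "\<lambda>_. i" I] i by simp
    qed
  qed
  moreover have "v_closure D I = I" using I unfolding fractional_v_ideal_def by simp
  ultimately show ?thesis unfolding v_product_def by (simp add: v_closure_scale[OF y])
qed

lemma span_basis_pair:
  fixes B :: "'a::torsion_free_ab_group_add set"
  assumes rank: "abelian_rank (zm.span B) \<ge> 2" and b: "b \<in> B"
  shows "\<exists>b'\<in>B. b' \<noteq> b"
proof (rule ccontr)
  assume "\<not> ?thesis"
  then have B: "B = {b}" using b by blast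
  have "card C \<le> 1" if C: "finite C" "C \<subseteq> zm.span B" "zm.independent C" for C
  proof (rule ccontr)
    assume "\<not> card C \<le> 1"
    then obtain x y where xy: "x \<in> C" "y \<in> C" "x \<noteq> y"
      by (metis C(1) One_nat_def card_le_Suc0_iff_eq)
    then obtain m n where mn: "x = zscale m b" "y = zscale n b"
      using C(2) unfolding B zm.span_singleton by blast
    have ind: "zm.independent {x, y}" using C(3) xy by (rule_tac zm.independent_mono) auto
    have sum: "(\<Sum>v\<in>{x, y}. zscale (if v = x then n else - m) v) = 0"
      using xy(3) unfolding mn by (auto simp: mult.commute)
    have "(if y = x then n else - m) = 0"
      by (rule zm.independentD[OF ind _ subset_refl sum]) auto
    then have "x = 0" using xy(3) mn by simp
    then show False using zm.dependent_zero xy(1) C(3) by blast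
  qed
  then have "abelian_rank (zm.span B) \<le> 1"
    unfolding abelian_rank_def by (intro SUP_least) (auto simp: one_enat_def)
  with rank have "(2::enat) \<le> 1" by (rule order_trans)
  then show False by (simp add: one_enat_def numeral_eq_enat)
qed

lemma interior_coordinates:
  fixes B :: "'g::torsion_free_ab_group_add set"
  assumes B: "finite B" "zm.independent B" and rank: "abelian_rank (zm.span B) \<ge> 2"
    and c: "c \<in> zm.span B" "c \<noteq> 0"
  shows "\<exists>e1 e2 b1 b2. ordered_subgroup.functional (zm.span B) e1 \<and> ordered_subgroup.functional (zm.span B) e2 \<and>
    b1 \<in> zm.span B \<and> b2 \<in> zm.span B \<and> e1 b1 = 1 \<and> e1 b2 = 0 \<and> e2 b1 = 0 \<and> e2 b2 = 1 \<and> e1 c > 0"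
proof -
  interpret ordered_subgroup "zm.span B" by unfold_locales simp
  let ?r = "zm.representation B"
  have "\<exists>b\<in>B. ?r c b \<noteq> 0"
  proof (rule ccontr)
    assume "\<not> ?thesis"
    then have "(\<Sum>b\<in>B. zscale (?r c b) b) = 0" by simp
    then show False using zm.sum_representation_eq[OF B(2) c(1) B(1) subset_refl] c(2) by simp
  qed
  then obtain b where b: "b \<in> B" "?r c b \<noteq> 0" by blast
  obtain b' where b': "b' \<in> B" "b' \<noteq> b" using span_basis_pair[OF rank b(1)] by blast
  have func: "functional (\<lambda>x. ?r x v)" for v
    unfolding functional_def using zm.representation_add[OF B(2)] by simp
  have r: "?r b b = 1" "?r b b' = 0" "?r b' b = 0" "?r b' b' = 1"
    using b b' zm.representation_basis[OF B(2)] by auto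
  have G: "b \<in> zm.span B" "b' \<in> zm.span B" "- b \<in> zm.span B"
    using b(1) b'(1) by (auto intro: zm.span_base zm.span_neg)
  have neg: "?r (- b) v = - ?r b v" for v using zm.representation_neg[OF B(2) G(1)] by simp
  show ?thesis
  proof (cases "?r c b > 0")
    case True
    then show ?thesis using func[of b] func[of b'] r G by blast
  next
    case False
    then have "- ?r c b > 0" using b(2) by simp
    then show ?thesis using functional_minus[OF func[of b]] func[of b'] r G neg
      by (intro exI[of _ "\<lambda>x. - ?r x b"] exI[of _ "\<lambda>x. ?r x b'"] exI[of _ "- b"] exI[of _ b']) auto
  qed
qed

lemma monoid_algebra_localization:
  fixes S :: "'g::torsion_free_ab_group_add set"
  assumes S: "add_submonoid S" "S \<subseteq> G" and G: "zm.subspace G" and c: "c \<in> S"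
    and interior: "\<And>g. g \<in> G \<Longrightarrow> \<exists>k. g + nscale k c \<in> S"
  shows "{x. \<exists>n. variable c ^ n * x \<in> monoid_algebra S} =
    (monoid_algebra G :: ('g, 'k::field) group_algebra fract set)"
proof
  interpret S: subdomain "monoid_algebra S :: ('g, 'k) group_algebra fract set"
    by (rule subdomain_monoid_algebra[OF S(1)])
  interpret G: subdomain "monoid_algebra G :: ('g, 'k) group_algebra fract set"
    by (rule subdomain_monoid_algebra[OF subspace_add_submonoid[OF G]])
  have cG: "variable (- c) \<in> (monoid_algebra G :: ('g, 'k) group_algebra fract set)"
    using c S(2) zm.subspace_neg[OF G] monomial_in_monoid_algebra by blast
  have cS: "variable c \<in> (monoid_algebra S :: ('g, 'k) group_algebra fract set)"
    using c by (rule monomial_in_monoid_algebra)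
  show "{x. \<exists>n. variable c ^ n * x \<in> monoid_algebra S} \<subseteq> (monoid_algebra G :: ('g, 'k) group_algebra fract set)"
  proof clarify
    fix x :: "('g, 'k) group_algebra fract" and n assume x: "variable c ^ n * x \<in> monoid_algebra S"
    have "variable (- c) ^ n * (variable c ^ n * x) \<in> monoid_algebra G"
      by (rule G.mult_closed[OF G.power_closed[OF cG] subsetD[OF monoid_algebra_mono[OF S(2)] x]])
    moreover have "variable (- c) ^ n * (variable c ^ n * x) = (variable c * variable (- c)) ^ n * x"
      by (simp add: power_mult_distrib ac_simps)
    ultimately show "x \<in> monoid_algebra G" unfolding variable_inverse by simp
  qed
  show "(monoid_algebra G :: ('g, 'k) group_algebra fract set) \<subseteq> {x. \<exists>n. variable c ^ n * x \<in> monoid_algebra S}"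
  proof (rule monoid_algebra_minimal)
    show "0 \<in> {x :: ('g, 'k) group_algebra fract. \<exists>n. variable c ^ n * x \<in> monoid_algebra S}"
      using S.zero_closed by simp
    fix a :: 'k and g assume "g \<in> G"
    then obtain k where k: "g + nscale k c \<in> S" using interior by blast
    have "variable c ^ k * to_fract (monomial a g) = to_fract (monomial a (g + nscale k c))"
      unfolding variable_power monomial_split by (rule mult.commute)
    also have "\<dots> \<in> monoid_algebra S" using k by (rule monomial_in_monoid_algebra)
    finally show "to_fract (monomial a g) \<in> {x. \<exists>n. variable c ^ n * x \<in> monoid_algebra S}" by blast
  next
    fix x y :: "('g, 'k) group_algebra fract"
    assume "x \<in> {x. \<exists>n. variable c ^ n * x \<in> monoid_algebra S}" "y \<in> {x. \<exists>n. variable c ^ n * x \<in> monoid_algebra S}"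
    then obtain m n where mn: "variable c ^ m * x \<in> monoid_algebra S" "variable c ^ n * y \<in> monoid_algebra S" by blast
    have "variable c ^ n * (variable c ^ m * x) + variable c ^ m * (variable c ^ n * y) \<in> monoid_algebra S"
      by (rule S.add_closed[OF S.mult_closed[OF S.power_closed[OF cS] mn(1)] S.mult_closed[OF S.power_closed[OF cS] mn(2)]])
    then have "variable c ^ (m + n) * (x + y) \<in> monoid_algebra S"
      by (simp only: power_add distrib_left distrib_right ac_simps)
    then show "x + y \<in> {x. \<exists>n. variable c ^ n * x \<in> monoid_algebra S}" by blast
  qed
qed

theorem theorem2:
  fixes S :: "'g::torsion_free_ab_group_add set"
    and D :: "('g, 'k::field) group_algebra fract set"
  assumes "affine_monoid S"
    and "factorial_submonoid (complete_integral_closure S)"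
    and "abelian_rank (quotient_group S) \<ge> 2"
    and "D = monoid_algebra S"
  shows "\<forall>C\<in>carrier (v_class_group D). infinite {P. prime_divisor D P \<and> P \<in> C}"
proof
  obtain A where A: "finite A" "S = add_submonoid hull A" using assms(1) unfolding affine_monoid_def by blast
  define G where "G = zm.span A"
  have G: "quotient_group S = G" unfolding A(2) G_def by (rule quotient_group_hull)
  have sub: "zm.subspace G" unfolding G_def by simp
  have S: "add_submonoid S" unfolding A(2) by (rule submonoid_hull)
  have SG: "S \<subseteq> G" unfolding A(2) G_def
    by (rule hull_minimal) (auto simp: zm.span_superset subspace_add_submonoid)
  obtain B where B: "finite B" "zm.independent B" "zm.span B = G" using basis_exists[OF A(1)] unfolding G_def by blast
  have rank: "abelian_rank (zm.span B) \<ge> 2" using assms(3) unfolding G B(3) .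
  have "B \<noteq> {}"
  proof
    assume "B = {}"
    then have "zm.span B = zm.span {0}" using zm.span_eq[of "{}" "{0}"] by auto
    then show False using span_basis_pair[of "{0 :: 'g}" 0] rank by auto
  qed
  then obtain b where b: "b \<in> B" by blast
  obtain c0 where c0: "c0 \<in> S" "\<forall>g\<in>G. \<exists>k. g + nscale k c0 \<in> S"
    using interior_element[OF A(1)] unfolding A(2) G_def by blast
  (* An interior element is zero only if the monoid is a group, in which all elements are interior. *)
  have "\<exists>c\<in>S. c \<noteq> 0 \<and> (\<forall>g\<in>G. \<exists>k. g + nscale k c \<in> S)"
  proof (cases "c0 = 0")
    case True
    then have "G \<subseteq> S" using c0 by auto
    moreover have "b \<in> G" using b B(3) zm.span_base by blast
    moreover have "b \<noteq> 0" using b B(2) zm.dependent_zero by blast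
    ultimately show ?thesis by (intro bexI[of _ b]) (auto intro!: exI[of _ "0::nat"])
  next
    case False
    then show ?thesis using c0 by blast
  qed
  then obtain c where c: "c \<in> S" "c \<noteq> 0" "\<And>g. g \<in> G \<Longrightarrow> \<exists>k. g + nscale k c \<in> S" by blast
  interpret ordered_subgroup G by unfold_locales (rule sub)
  obtain e1 e2 b1 b2 where e: "functional e1" "functional e2" "b1 \<in> G" "b2 \<in> G"
    "e1 b1 = 1" "e1 b2 = 0" "e2 b1 = 0" "e2 b2 = 1" "e1 c > 0"
    using interior_coordinates[OF B(1,2) rank] c SG unfolding B(3) by blast
  have factorial: "factorial_in (monoid_algebra G :: ('g, 'k) group_algebra fract set)"
    using factorial_in_group_algebra[OF B(1,2)] unfolding B(3) .
  have loc: "{x. \<exists>n. variable c ^ n * x \<in> D} = monoid_algebra G"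
    unfolding assms(4) by (rule monoid_algebra_localization[OF S SG sub c(1,3)])
  interpret D: subdomain D unfolding assms(4) by (rule subdomain_monoid_algebra[OF S])
  interpret D: factorial_localization D "variable c"
  proof unfold_locales
    show "variable c \<in> D" unfolding assms(4) using c(1) by (rule monomial_in_monoid_algebra)
    show "variable c \<noteq> (0 :: ('g, 'k) group_algebra fract)" by (rule variable_nonzero)
    show "noetherian_in D" unfolding assms(4) A(2) by (rule noetherian_in_monoid_algebra[OF A(1)])
    show "factorial_in {x. \<exists>n. variable c ^ n * x \<in> D}" unfolding loc by (rule factorial)
  qed
  have L: "D.L = monoid_algebra G" unfolding D.L_def by (rule loc)
  fix C assume "C \<in> carrier (v_class_group D)"
  then obtain I where I: "v_invertible D I" and
    C: "C = (\<Union>H\<in>principal_fractional_ideals D. {v_product D H I})"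
    unfolding v_class_group_def FactGroup_def RCOSETS_def r_coset_def v_ideal_group_def by auto
  have "infinite {P. prime_divisor D P \<and> (\<exists>y\<in>quotient_field D. y \<noteq> 0 \<and> P = (*) y ` I)}"
  proof (rule D.prime_divisors_in_class[OF _ I])
    fix x :: "('g, 'k) group_algebra fract" and n :: nat assume "x \<in> D.L"
    then have x: "x \<in> monoid_algebra G" unfolding L .
    show "infinite {(*) h ` D.L |h. prime_in D.L h \<and> (\<exists>d\<in>D. h = x + variable c ^ n * d)}"
      unfolding L unfolding assms(4)
      by (rule infinitely_many_primes_near[OF factorial e(1-8) S SG c(1) e(9) _ x]) (rule c(3))
  qed
  moreover have "{P. prime_divisor D P \<and> (\<exists>y\<in>quotient_field D. y \<noteq> 0 \<and> P = (*) y ` I)} \<subseteq>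
      {P. prime_divisor D P \<and> P \<in> C}"
  proof clarify
    fix y assume y: "y \<in> quotient_field D" "y \<noteq> 0"
    have "(*) y ` I = v_product D ((*) y ` D) I"
      using D.principal_v_product[OF _ y] I unfolding v_invertible_def by simp
    moreover have "(*) y ` D \<in> principal_fractional_ideals D" unfolding principal_fractional_ideals_def using y by blast
    ultimately show "(*) y ` I \<in> C" unfolding C by blast
  qed
  ultimately show "infinite {P. prime_divisor D P \<and> P \<in> C}" by (rule infinite_super[rotated])
qed

end
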